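(* Let $\mathbf n=(n_1,\dots,n_r)$ with $r\ge1$ and $n_i\ge2$ for all $i$. For every integer $k$ with $0\le k\le\sum_{i=1}^r\big\lfloor\frac{n_i-2}{2}\big\rfloor$ we have $\delta_{pr}(k,\mathbf n)=2k+r+1$.
   Context: $\Delta_m$ denotes the $m$-dimensional simplex; for $\mathbf n=(n_1,\dots,n_r)$, $\Delta_{\mathbf n}:=\Delta_{n_1}\times\dots\times\Delta_{n_r}$. The $k$-skeleton of a polytope is the poset of its faces of dimension at most $k$; two $k$-skeleta are combinatorially equivalent if these posets are isomorphic. A convex polytope is $(k,\mathbf n)$-PSN if its $k$-skeleton is combinatorially equivalent to that of $\Delta_{\mathbf n}$, and $(k,\mathbf n)$-PPSN if in addition it is the image under a linear projection of a polytope combinatorially equivalent to $\Delta_{\mathbf n}$. $\delta_{pr}(k,\mathbf n)$ is the smallest dimension of a $(k,\mathbf n)$-PPSN polytope. *)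

theory Defs
  imports "HOL-Analysis.Analysis"
begin

definition skel :: "int \<Rightarrow> 'a::euclidean_space set \<Rightarrow> 'a set set" where
  "skel k P = {F. F face_of P \<and> F \<noteq> {} \<and> aff_dim F \<le> k}"

text \<open>Face poset of Delta_n = Delta_{n_1} x ... x Delta_{n_r}: its nonempty faces are the
  products F_1 x ... x F_r of nonempty faces of the factors; a nonempty face of Delta_m is
  the convex hull of a nonempty subset of its m+1 vertices {0..m}. Such a face is encoded
  by the list of vertex sets (S_1,...,S_r); its dimension is the sum of (card S_i - 1), and
  face inclusion is componentwise inclusion.\<close>
definition delta_faces :: "nat list \<Rightarrow> nat set list set" where
  "delta_faces ns = {S. length S = length ns \<and>
      (\<forall>i<length ns. S ! i \<noteq> {} \<and> S ! i \<subseteq> {0..ns ! i})}"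

definition delta_face_dim :: "nat set list \<Rightarrow> int" where
  "delta_face_dim S = (\<Sum>i<length S. int (card (S ! i)) - 1)"

definition delta_le :: "nat set list \<Rightarrow> nat set list \<Rightarrow> bool" where
  "delta_le S T \<longleftrightarrow> length S = length T \<and> (\<forall>i<length S. S ! i \<subseteq> T ! i)"

definition delta_skel :: "int \<Rightarrow> nat list \<Rightarrow> nat set list set" where
  "delta_skel k ns = {S \<in> delta_faces ns. delta_face_dim S \<le> k}"

definition skel_equiv_delta :: "int \<Rightarrow> nat list \<Rightarrow> 'a::euclidean_space set \<Rightarrow> bool" where
  "skel_equiv_delta k ns P \<longleftrightarrow>
     (\<exists>g. bij_betw g (skel k P) (delta_skel k ns) \<and>
          (\<forall>F\<in>skel k P. \<forall>G\<in>skel k P. F \<subseteq> G \<longleftrightarrow> delta_le (g F) (g G)))"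

definition PSN :: "int \<Rightarrow> nat list \<Rightarrow> 'a::euclidean_space set \<Rightarrow> bool" where
  "PSN k ns P \<longleftrightarrow> polytope P \<and> skel_equiv_delta k ns P"

text \<open>Q is combinatorially equivalent to Delta_n: its whole face poset (all faces, of
  dimension at most dim Delta_n = sum n_i, hence at most any bound) is isomorphic to that of Delta_n.\<close>
definition comb_equiv_delta :: "nat list \<Rightarrow> 'a::euclidean_space set \<Rightarrow> bool" where
  "comb_equiv_delta ns Q \<longleftrightarrow> polytope Q \<and>
     skel_equiv_delta (max (int (sum_list ns)) (aff_dim Q)) ns Q"

definition PPSN_via :: "int \<Rightarrow> nat list \<Rightarrow> 'b::euclidean_space set \<Rightarrow> 'a::euclidean_space set \<Rightarrow> bool" where
  "PPSN_via k ns Q P \<longleftrightarrow> PSN k ns P \<and> comb_equiv_delta ns Q \<and>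
     (\<exists>f::'b \<Rightarrow> 'a. linear f \<and> P = f ` Q)"

end

(* Upper bound: a point u_i(t) = (t e_i, t^2, ..., t^(2k+2)) of R^(r+2k+1) restricts linear
   functionals to polynomials f_i = g + (affine part), i = 1..r, that share their second derivative.
   Placing the vertices of the i-th simplex at nodes u_i(t_ij) with the blocks of nodes in disjoint
   intervals, a face S of dimension K <= k is exposed by the solution of a homogeneous linear system
   that makes every f_i vanish doubly on S_i; Rolle's theorem and deg f_i'' <= 2K exclude further zeros.

   Lower bound: let Q be equivalent to Delta_n and f : Q -> P preserve the k-skeleton. A kernel vector
   v <> 0 of f cannot point into Q from the relative interior of a preserved face S, so the facet
   normals outside S cannot all be nonpositive on v. If dim P <= 2k+r, there is an r-dimensional space
   of kernel vectors on which all but 2k_i+3 normals of block i vanish (sum of the k_i equal to k).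
   The Borsuk-Ulam theorem, applied to r-1 differences of median-like odd functions, gives such a v
   with at most k_i+1 positive values in block i, and these values select a face S of the k-skeleton. *)

theory Submission
  imports
    Defs
    "HOL-Homology.Invariance_of_Domain"
    "HOL-Computational_Algebra.Polynomial"
begin

text \<open>Origin of the numbers: the kernel of f on the directions of Q has dimension at least sum
  n_i - (2k + r). Block i has n_i + 1 normals; making all but 2 k_i + 3 of them vanish costs n_i - 2
  k_i - 2 dimensions, in total sum n_i - 2k - 2r, so that r dimensions remain. The bound on k is
  what provides k_i with 2 k_i + 2 <= n_i. The odd number 2 (k_i + 1) + 1 of remaining values in
  block i has a median, and if it is nonpositive, at most k_i + 1 values are positive; that many
  vertices of block i contribute at most k_i to the dimension of a face. It is enough that the r
  medians agree, which is r - 1 equations: replacing v by -v then makes the common value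
  nonpositive. The obstacle is that the k-skeleton of P is known only up to an abstract isomorphism
  that need not have anything to do with f. Preimages under f of faces of P are faces of Q, but a
  priori of unknown label and dimension. An argument with the vertices and edges of the skeleton
  settles this before kernel vectors can be used.\<close>

section \<open>The Borsuk-Ulam theorem\<close>

definition bvec :: "nat \<Rightarrow> 'a::euclidean_space" where
  "bvec = (SOME b. bij_betw b {..<DIM('a)} (Basis::'a set))"

lemma bij_betw_bvec: "bij_betw bvec {..<DIM('a)} (Basis::'a::euclidean_space set)"
proof -
  have "\<exists>b. bij_betw b {..<DIM('a)} (Basis::'a set)"
    using ex_bij_betw_nat_finite[of "Basis::'a set"] by (simp add: atLeast0LessThan)
  then show ?thesis
    unfolding bvec_def by (rule someI_ex)
qed

lemma bvec_in_Basis: "i < DIM('a) \<Longrightarrow> (bvec i :: 'a::euclidean_space) \<in> Basis"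
  using bij_betw_bvec bij_betwE by blast

lemma inner_bvec:
  assumes "i < DIM('a)" "j < DIM('a)"
  shows "(bvec i :: 'a::euclidean_space) \<bullet> bvec j = (if i = j then 1 else 0)"
  using assms bij_betw_bvec[where 'a='a] bvec_in_Basis[where 'a='a]
  by (auto simp: inner_Basis bij_betw_def inj_on_def)

text \<open>Degrees belong to \<open>nsphere m\<close>, whereas polynomials, derivatives and
  reflections are taken in a normed space. The induction over m inside a single type needs a
  subspace of dimension m + 1 for every m, whose unit sphere is a copy of
  \<open>nsphere m\<close>.\<close>

definition coord_space :: "nat \<Rightarrow> 'a::euclidean_space set" where
  "coord_space m = span (bvec ` {..m})"

definition of_coords :: "nat \<Rightarrow> (nat \<Rightarrow> real) \<Rightarrow> 'a::euclidean_space" where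
  "of_coords m x = (\<Sum>i\<le>m. x i *\<^sub>R bvec i)"

definition to_coords :: "nat \<Rightarrow> 'a::euclidean_space \<Rightarrow> nat \<Rightarrow> real" where
  "to_coords m v = (\<lambda>i. if i \<le> m then v \<bullet> bvec i else 0)"

lemma subspace_coord_space: "subspace (coord_space m)"
  by (simp add: coord_space_def)

lemma of_coords_in: "of_coords m x \<in> coord_space m"
  unfolding of_coords_def coord_space_def
  by (intro span_sum span_scale span_base) auto

lemma of_coords_inner:
  assumes "m < DIM('a)" "j \<le> m"
  shows "(of_coords m x :: 'a::euclidean_space) \<bullet> bvec j = x j"
proof -
  have "(of_coords m x :: 'a) \<bullet> bvec j = (\<Sum>i\<le>m. x i * ((bvec i :: 'a) \<bullet> bvec j))"
    by (simp add: of_coords_def inner_sum_left)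
  also have "\<dots> = (\<Sum>i\<le>m. if i = j then x i else 0)"
    using assms by (intro sum.cong) (auto simp: inner_bvec)
  finally show ?thesis using assms by simp
qed

lemma of_coords_to_coords:
  fixes v :: "'a::euclidean_space"
  assumes "m < DIM('a)" "v \<in> coord_space m"
  shows "of_coords m (to_coords m v) = v"
  using assms(2) unfolding coord_space_def
proof (induction rule: span_induct_alt)
  case base
  then show ?case by (simp add: of_coords_def to_coords_def)
next
  case (step c x y)
  then obtain j where j: "j \<le> m" "x = bvec j" by auto
  have "of_coords m (to_coords m (c *\<^sub>R x + y)) =
     c *\<^sub>R (\<Sum>i\<le>m. (x \<bullet> bvec i) *\<^sub>R bvec i) + of_coords m (to_coords m y)"
    by (simp add: of_coords_def to_coords_def inner_add_left scaleR_add_left sum.distrib scaleR_sum_right)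
  also have "(\<Sum>i\<le>m. (x \<bullet> bvec i) *\<^sub>R bvec i) = (\<Sum>i\<le>m. if i = j then bvec i else 0)"
    using assms(1) j by (intro sum.cong) (auto simp: inner_bvec)
  also have "\<dots> = x" using j by simp
  finally show ?case using step by simp
qed

lemma norm_of_coords:
  assumes "m < DIM('a)"
  shows "(norm (of_coords m x :: 'a::euclidean_space))\<^sup>2 = (\<Sum>i\<le>m. (x i)\<^sup>2)"
proof -
  have "(norm (of_coords m x :: 'a))\<^sup>2 = (of_coords m x :: 'a) \<bullet> (\<Sum>i\<le>m. x i *\<^sub>R bvec i)"
    by (simp add: power2_norm_eq_inner of_coords_def)
  also have "\<dots> = (\<Sum>i\<le>m. x i * ((of_coords m x :: 'a) \<bullet> bvec i))"
    by (simp add: inner_sum_right)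
  also have "\<dots> = (\<Sum>i\<le>m. (x i)\<^sup>2)"
    by (intro sum.cong) (auto simp: of_coords_inner[OF assms] power2_eq_square)
  finally show ?thesis .
qed

abbreviation coord_sphere :: "nat \<Rightarrow> 'a::euclidean_space set" where
  "coord_sphere m \<equiv> sphere 0 1 \<inter> coord_space m"

lemma topspace_nsphere: 
  "topspace (nsphere n) = {x. (\<Sum>i\<le>n. x i ^ 2) = 1 \<and> (\<forall>i>n. x i = 0)}"
  by (simp add: nsphere)

lemma of_coords_sphere:
  assumes "m < DIM('a)" "x \<in> topspace (nsphere m)"
  shows "(of_coords m x :: 'a::euclidean_space) \<in> coord_sphere m"
proof -
  have "(norm (of_coords m x :: 'a))\<^sup>2 = 1"
    using assms by (simp add: norm_of_coords topspace_nsphere)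
  then have "norm (of_coords m x :: 'a) = 1"
    by (metis norm_ge_zero one_power2 power2_eq_imp_eq zero_le_one)
  then show ?thesis by (simp add: of_coords_in)
qed

lemma to_coords_sphere:
  fixes v :: "'a::euclidean_space"
  assumes "m < DIM('a)" "v \<in> coord_sphere m"
  shows "to_coords m v \<in> topspace (nsphere m)"
proof -
  have "(\<Sum>i\<le>m. (to_coords m v i)\<^sup>2) = (norm v)\<^sup>2"
    using assms by (metis IntD2 norm_of_coords of_coords_to_coords)
  then show ?thesis using assms by (simp add: topspace_nsphere to_coords_def)
qed

lemma to_coords_of_coords:
  assumes "m < DIM('a)" "x \<in> topspace (nsphere m)"
  shows "to_coords m (of_coords m x :: 'a::euclidean_space) = x"
  using assms by (auto simp: to_coords_def of_coords_inner topspace_nsphere fun_eq_iff)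

lemma continuous_map_of_coords:
  assumes "m < DIM('a)"
  shows "continuous_map (nsphere m) (top_of_set (coord_sphere m :: 'a::euclidean_space set)) (of_coords m)"
proof -
  have "continuous_map (nsphere m) euclidean (of_coords m :: _ \<Rightarrow> 'a)"
    unfolding of_coords_def
    by (intro continuous_map_sum finite_atMost
         continuous_map_compose[OF continuous_map_nsphere_projection, unfolded o_def,
           where g = "\<lambda>c. c *\<^sub>R bvec _"])
       (auto intro!: continuous_intros)
  then show ?thesis
    using of_coords_sphere[OF assms] by (auto simp: continuous_map_in_subtopology)
qed

lemma continuous_map_to_coords:
  assumes "m < DIM('a)"
  shows "continuous_map (top_of_set (coord_sphere m :: 'a::euclidean_space set)) (nsphere m) (to_coords m)"
proof -
  have "continuous_map (top_of_set (coord_sphere m :: 'a set)) (powertop_real UNIV) (to_coords m)"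
    unfolding continuous_map_componentwise_UNIV
  proof
    fix k
    show "continuous_map (top_of_set (coord_sphere m :: 'a set)) euclideanreal (\<lambda>x. to_coords m x k)"
      by (auto simp: to_coords_def intro!: continuous_intros)
  qed
  moreover have "\<And>v::'a. v \<in> coord_sphere m \<Longrightarrow> to_coords m v \<in> {x. (\<Sum>i\<le>m. (x i)\<^sup>2) = 1 \<and> (\<forall>i>m. x i = 0)}"
    using to_coords_sphere[OF assms] by (auto simp: topspace_nsphere)
  ultimately show ?thesis
    unfolding nsphere by (auto simp: continuous_map_in_subtopology)
qed

text \<open>Normalizing with \<open>sgn\<close> admits every F without zeros on the sphere, so that
  a deformation of F only has to avoid 0 and may leave the sphere.\<close>

definition sphere_map :: "nat \<Rightarrow> ('a::euclidean_space \<Rightarrow> 'a) \<Rightarrow> (nat \<Rightarrow> real) \<Rightarrow> nat \<Rightarrow> real" where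
  "sphere_map m F = to_coords m \<circ> sgn \<circ> F \<circ> of_coords m"

lemma continuous_map_sgn:
  "continuous_map (top_of_set (coord_space m - {0})) (top_of_set (coord_sphere m)) sgn"
  by (auto simp: continuous_map_in_subtopology norm_sgn sgn_div_norm subspace_coord_space
      intro!: continuous_intros subspace_scale)

lemma continuous_map_sphere_map:
  fixes F :: "'a::euclidean_space \<Rightarrow> 'a"
  assumes "m < DIM('a)" "continuous_on (coord_sphere m) F"
    and "\<And>v. v \<in> coord_sphere m \<Longrightarrow> F v \<in> coord_space m - {0}"
  shows "continuous_map (nsphere m) (nsphere m) (sphere_map m F)"
proof -
  have "continuous_map (top_of_set (coord_sphere m)) (top_of_set (coord_space m - {0})) F"
    using assms by (auto simp: continuous_map_in_subtopology)
  then show ?thesis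
    unfolding sphere_map_def using assms(1)
    by (meson continuous_map_compose continuous_map_of_coords continuous_map_to_coords continuous_map_sgn)
qed

text \<open>The straight-line homotopy from F to G avoids 0 and therefore survives
  normalization.\<close>

lemma Brouwer_degree2_sphere_map_cong:
  fixes F G :: "'a::euclidean_space \<Rightarrow> 'a"
  assumes "m < DIM('a)" "continuous_on (coord_sphere m) F" "continuous_on (coord_sphere m) G"
    and "\<And>v. v \<in> coord_sphere m \<Longrightarrow> closed_segment (F v) (G v) \<subseteq> coord_space m - {0}"
  shows "Brouwer_degree2 m (sphere_map m F) = Brouwer_degree2 m (sphere_map m G)"
proof -
  have "homotopic_with_canon (\<lambda>z. True) (coord_sphere m) (coord_space m - {0}) F G"
    by (rule homotopic_with_linear) (use assms in auto)
  then have "homotopic_with (\<lambda>z. True) (top_of_set (coord_sphere m)) (nsphere m)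
      ((to_coords m \<circ> sgn) \<circ> F) ((to_coords m \<circ> sgn) \<circ> G)"
    by (rule homotopic_with_compose_continuous_map_left)
       (use assms(1) in \<open>auto intro: continuous_map_compose continuous_map_sgn continuous_map_to_coords\<close>)
  then have "homotopic_with (\<lambda>z. True) (nsphere m) (nsphere m)
      (((to_coords m \<circ> sgn) \<circ> F) \<circ> of_coords m) (((to_coords m \<circ> sgn) \<circ> G) \<circ> of_coords m)"
    by (rule homotopic_with_compose_continuous_map_right)
       (use assms(1) in \<open>auto intro: continuous_map_of_coords\<close>)
  then show ?thesis
    unfolding sphere_map_def by (rule Brouwer_degree2_homotopic)
qed

lemma of_coords_uminus: "of_coords m (\<lambda>i. - x i) = - of_coords m x"
  by (simp add: of_coords_def sum_negf)

lemma to_coords_uminus: "to_coords m (- v) = (\<lambda>i. - to_coords m v i)"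
  by (simp add: to_coords_def fun_eq_iff)

lemma sphere_map_uminus:
  fixes F :: "'a::euclidean_space \<Rightarrow> 'a"
  assumes "m < DIM('a)" "\<And>v. v \<in> coord_sphere m \<Longrightarrow> F (- v) = - F v"
    "x \<in> topspace (nsphere m)"
  shows "sphere_map m F (\<lambda>i. - x i) = (\<lambda>i. - sphere_map m F x i)"
  using assms of_coords_sphere[of m x, where 'a='a]
  by (simp add: sphere_map_def of_coords_uminus to_coords_uminus sgn_minus)

text \<open>\<open>nsphere 0\<close> consists of two antipodal points, which an odd map either fixes
  or exchanges: the degree is 1 or -1.\<close>

lemma odd_map_nsphere_0:
  assumes f: "f \<in> topspace (nsphere 0) \<rightarrow> topspace (nsphere 0)"
    and odd: "\<And>x. x \<in> topspace (nsphere 0) \<Longrightarrow> f (\<lambda>i. - x i) = (\<lambda>i. - f x i)"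
  shows "odd (Brouwer_degree2 0 f)"
proof -
  define e :: "nat \<Rightarrow> real" where "e = (\<lambda>i. if i = 0 then 1 else 0)"
  have top: "topspace (nsphere 0) = {e, \<lambda>i. - e i}"
    by (auto simp: topspace_nsphere e_def fun_eq_iff power2_eq_1_iff)
  then consider "f e = e" | "f e = (\<lambda>i. - e i)" using f by auto
  then show ?thesis
  proof cases
    case 1
    then have "Brouwer_degree2 0 f = Brouwer_degree2 0 id"
      using odd[of e] by (intro Brouwer_degree2_eq) (auto simp: top)
    then show ?thesis by simp
  next
    case 2
    have "Brouwer_degree2 0 f = Brouwer_degree2 0 (\<lambda>x i. if i = 0 then - x i else x i)"
    proof (rule Brouwer_degree2_eq)
      fix x assume "x \<in> topspace (nsphere 0)"
      then have "f x = (\<lambda>i. - x i)"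
        using odd[of e] 2 by (auto simp: top)
      moreover have "x i = 0" if "i \<noteq> 0" for i
        using \<open>x \<in> topspace (nsphere 0)\<close> that by (simp add: topspace_nsphere)
      ultimately show "f x = (\<lambda>i. if i = 0 then - x i else x i)"
        by (auto simp: fun_eq_iff)
    qed
    then show ?thesis by (simp add: Brouwer_degree2_reflection)
  qed
qed

section \<open>Odd polynomial approximation and reflections\<close>

lemma polynomial_function_comp_uminus:
  fixes p :: "'a::euclidean_space \<Rightarrow> 'b::euclidean_space"
  assumes "polynomial_function p"
  shows "polynomial_function (\<lambda>v. p (- v))"
  using polynomial_function_compose[OF polynomial_function_minus[OF polynomial_function_id] assms]
  by (simp add: o_def)

text \<open>The odd part of any polynomial approximation q approximates as well as q does, because F
  is its own odd part on the symmetric set S.\<close>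

lemma odd_polynomial_approximation:
  fixes F :: "'a::euclidean_space \<Rightarrow> 'b::euclidean_space"
  assumes "compact S" "continuous_on S F" "0 < e" "subspace T" "F ` S \<subseteq> T"
    and sym: "\<And>v. v \<in> S \<Longrightarrow> - v \<in> S" and odd: "\<And>v. v \<in> S \<Longrightarrow> F (- v) = - F v"
  shows "\<exists>p. polynomial_function p \<and> p ` S \<subseteq> T \<and> (\<forall>v. p (- v) = - p v) \<and>
    (\<forall>v\<in>S. norm (F v - p v) < e)"
proof -
  obtain q where q: "polynomial_function q" "q ` S \<subseteq> T" "\<And>v. v \<in> S \<Longrightarrow> norm (F v - q v) < e"
    using Stone_Weierstrass_polynomial_function_subspace[OF assms(1-5)] by metis
  define p where "p v = (1/2) *\<^sub>R (q v - q (- v))" for v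
  show ?thesis
  proof (intro exI[of _ p] conjI allI ballI)
    show "polynomial_function p"
      unfolding p_def using q(1) polynomial_function_comp_uminus
      by (intro polynomial_function_cmul polynomial_function_diff)
    show "p ` S \<subseteq> T"
      using q(2) sym assms(4) by (auto simp: p_def intro!: subspace_scale subspace_diff)
    show "p (- v) = - p v" for v
      by (simp add: p_def algebra_simps)
    show "norm (F v - p v) < e" if "v \<in> S" for v
    proof -
      have "F v - p v = (1/2) *\<^sub>R ((F v - q v) - (F (- v) - q (- v)))"
        using odd[OF that] by (simp add: p_def algebra_simps scaleR_half_double flip: scaleR_add_left)
      then have "norm (F v - p v) = 1/2 * norm ((F v - q v) - (F (- v) - q (- v)))"
        by simp
      also have "\<dots> \<le> 1/2 * (norm (F v - q v) + norm (F (- v) - q (- v)))"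
        by (intro mult_left_mono norm_triangle_ineq4) simp
      also have "\<dots> < e" using q(3)[OF that] q(3)[OF sym[OF that]] by simp
      finally show ?thesis .
    qed
  qed
qed

text \<open>The orthogonal reflection in the hyperplane perpendicular to w; for w = 0 the quotient
  is 0 and the map is the identity.\<close>

definition reflect :: "'a::euclidean_space \<Rightarrow> 'a \<Rightarrow> 'a" where
  "reflect w v = v - (2 * (v \<bullet> w) / (w \<bullet> w)) *\<^sub>R w"

lemma linear_reflect: "linear (reflect w)"
  unfolding reflect_def
  by (intro linearI) (simp_all add: inner_add_left add_divide_distrib algebra_simps)

lemma inner_reflect: "reflect w u \<bullet> reflect w v = u \<bullet> v"
  by (cases "w = 0") (simp_all add: reflect_def inner_diff_left inner_diff_right inner_commute field_simps)

lemma reflect_reflect: "reflect w (reflect w v) = v"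
proof (cases "w = 0")
  case False
  then have "reflect w v \<bullet> w = - (v \<bullet> w)"
    by (simp add: reflect_def inner_diff_left)
  then show ?thesis by (simp add: reflect_def[of w "reflect w v"]) (simp add: reflect_def)
qed (simp add: reflect_def)

text \<open>As the norms agree, the perpendicular bisector of a and b passes through 0, and a - b is
  normal to it.\<close>

lemma reflect_swap:
  assumes "norm a = norm b"
  shows "reflect (a - b) a = b"
proof (cases "a = b")
  case False
  have ab: "a \<bullet> a = b \<bullet> b" using assms by (simp add: norm_eq)
  then have "2 * (a \<bullet> (a - b)) = (a - b) \<bullet> (a - b)"
    by (simp add: inner_diff_left inner_diff_right inner_commute)
  then show ?thesis using False by (simp add: reflect_def)
qed (simp add: reflect_def)

text \<open>A reflection preserves norms, so it commutes with \<open>sgn\<close> and the degree is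
  multiplicative; being an involution, it has a degree whose square is 1. Leaving the sign open
  covers w = 0 and is enough for parity.\<close>

lemma sphere_map_reflect:
  fixes F :: "'a::euclidean_space \<Rightarrow> 'a"
  assumes m: "m < DIM('a)" and F: "continuous_on (coord_sphere m) F"
    "\<And>v. v \<in> coord_sphere m \<Longrightarrow> F v \<in> coord_space m - {0}"
    and w: "w \<in> coord_space m"
  shows "\<bar>Brouwer_degree2 m (sphere_map m (reflect w \<circ> F))\<bar> = \<bar>Brouwer_degree2 m (sphere_map m F)\<bar>"
proof -
  let ?R = "sphere_map m (reflect w)"
  have contR: "continuous_on X (reflect w)" for X
    using linear_reflect linear_continuous_on linear_conv_bounded_linear by blast
  have normR: "norm (reflect w v) = norm v" for v
    by (simp add: norm_eq_sqrt_inner inner_reflect)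
  have R0: "reflect w v = 0 \<longleftrightarrow> v = 0" for v
    using normR[of v] by (metis norm_eq_zero)
  have inR: "reflect w v \<in> coord_space m" if "v \<in> coord_space m" for v
    unfolding reflect_def by (intro subspace_diff subspace_scale subspace_coord_space that w)
  have cR: "continuous_map (nsphere m) (nsphere m) ?R"
    using contR inR by (intro continuous_map_sphere_map m) (auto simp: R0)
  have cF: "continuous_map (nsphere m) (nsphere m) (sphere_map m F)"
    by (intro continuous_map_sphere_map m F)
  have sgnR: "sgn (reflect w v) = reflect w (sgn v)" for v
    by (simp add: sgn_div_norm normR linear_cmul[OF linear_reflect])
  have comp: "sphere_map m (reflect w \<circ> G) x = (?R \<circ> sphere_map m G) x"
    if "x \<in> topspace (nsphere m)" "\<And>v. v \<in> coord_sphere m \<Longrightarrow> G v \<in> coord_space m - {0}" for G x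
  proof -
    have "of_coords m x \<in> (coord_sphere m :: 'a set)" using that(1) m by (rule of_coords_sphere[rotated])
    then have "G (of_coords m x) \<in> coord_space m - {0}" by (rule that(2))
    then have "sgn (G (of_coords m x)) \<in> coord_space m" "norm (sgn (G (of_coords m x))) = 1"
      by (auto simp: sgn_div_norm intro!: subspace_scale subspace_coord_space)
    then show ?thesis
      by (simp add: sphere_map_def of_coords_to_coords m sgnR) (simp add: sgn_div_norm)
  qed
  have "Brouwer_degree2 m (sphere_map m (reflect w \<circ> F)) = Brouwer_degree2 m (?R \<circ> sphere_map m F)"
    by (intro Brouwer_degree2_eq comp F(2))
  also have "\<dots> = Brouwer_degree2 m ?R * Brouwer_degree2 m (sphere_map m F)"
    by (rule Brouwer_degree2_compose[OF cF cR])
  finally have eq: "Brouwer_degree2 m (sphere_map m (reflect w \<circ> F)) =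
      Brouwer_degree2 m ?R * Brouwer_degree2 m (sphere_map m F)" .
  have "Brouwer_degree2 m id = Brouwer_degree2 m (?R \<circ> ?R)"
  proof (rule Brouwer_degree2_eq)
    fix x assume x: "x \<in> topspace (nsphere m)"
    have "(?R \<circ> ?R) x = sphere_map m (reflect w \<circ> reflect w) x"
      using inR by (intro comp[symmetric] x) (auto simp: R0)
    also have "\<dots> = to_coords m (of_coords m x :: 'a)"
      using of_coords_sphere[OF m x] by (simp add: sphere_map_def reflect_reflect sgn_div_norm)
    finally show "id x = (?R \<circ> ?R) x" by (simp add: to_coords_of_coords m x)
  qed
  also have "\<dots> = Brouwer_degree2 m ?R * Brouwer_degree2 m ?R"
    by (rule Brouwer_degree2_compose[OF cR cR])
  finally have "\<bar>Brouwer_degree2 m ?R\<bar> = 1"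
    by (metis Brouwer_degree2_id abs_zmult_eq_1 abs_1)
  then show ?thesis by (simp add: eq abs_mult)
qed

lemma sphere_map_of_nsphere_map:
  assumes m: "m < DIM('a)" and f: "continuous_map (nsphere m) (nsphere m) f"
  obtains F :: "'a::euclidean_space \<Rightarrow> 'a" where
    "continuous_on (coord_sphere m) F" "F \<in> coord_sphere m \<rightarrow> coord_sphere m"
    "\<And>x. x \<in> topspace (nsphere m) \<Longrightarrow> sphere_map m F x = f x"
    "F = of_coords m \<circ> f \<circ> to_coords m"
proof -
  define F :: "'a \<Rightarrow> 'a" where "F = of_coords m \<circ> f \<circ> to_coords m"
  have "continuous_map (top_of_set (coord_sphere m)) (top_of_set (coord_sphere m)) F"
    unfolding F_def
    by (meson continuous_map_compose continuous_map_of_coords continuous_map_to_coords f m)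
  then have 1: "continuous_on (coord_sphere m) F" and 2: "F \<in> coord_sphere m \<rightarrow> coord_sphere m"
    by (auto simp: continuous_map_in_subtopology)
  have 3: "sphere_map m F x = f x" if x: "x \<in> topspace (nsphere m)" for x
  proof -
    have fx: "f x \<in> topspace (nsphere m)"
      using f x by (auto simp: continuous_map_def)
    then have "sgn (of_coords m (f x) :: 'a) = of_coords m (f x)"
      using of_coords_sphere[OF m fx] by (simp add: sgn_div_norm)
    then show ?thesis
      using fx by (simp add: sphere_map_def F_def to_coords_of_coords m x)
  qed
  show ?thesis using that[OF 1 2 3 F_def] .
qed

lemma dim_coord_space:
  assumes "m < DIM('a)"
  shows "dim (coord_space m :: 'a::euclidean_space set) = Suc m"
proof -
  have sub: "bvec ` {..m} \<subseteq> (Basis :: 'a set)"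
    using assms by (auto intro!: bvec_in_Basis)
  have "inj_on (bvec :: nat \<Rightarrow> 'a) {..m}"
    by (rule inj_on_subset[OF bij_betw_imp_inj_on[OF bij_betw_bvec]]) (use assms in auto)
  then have "card (bvec ` {..m} :: 'a set) = Suc m"
    by (simp add: card_image)
  moreover have "independent (bvec ` {..m} :: 'a set)"
    using sub independent_Basis independent_mono by blast
  ultimately show ?thesis
    unfolding coord_space_def by (simp add: dim_span dim_eq_card_independent)
qed

text \<open>To apply \<open>Borsuk_odd_mapping_degree_step\<close>, the map is deformed through odd maps until it preserves
  the equator: an odd polynomial approximation misses a pair \<open>\<plusminus>a\<close> on the equator by dimension, so
  subtracting the \<open>a\<close>-component near the equator and reflecting \<open>a\<close> to the pole works.\<close>

theorem odd_map_odd_degree: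
  assumes m: "m < DIM('a::euclidean_space)"
    and f: "continuous_map (nsphere m) (nsphere m) f"
    and odd: "\<And>x. x \<in> topspace (nsphere m) \<Longrightarrow> f (\<lambda>i. - x i) = (\<lambda>i. - f x i)"
  shows "odd (Brouwer_degree2 m f)"
  using assms
proof (induction m arbitrary: f)
  case 0
  then show ?case
    by (intro odd_map_nsphere_0) (auto simp: continuous_map_def)
next
  case (Suc n)
  let ?m = "Suc n"
  let ?S = "coord_sphere ?m :: 'a set" and ?T = "coord_space ?m :: 'a set"
  let ?K = "coord_sphere n :: 'a set"
  let ?b = "bvec ?m :: 'a"
  obtain F :: "'a \<Rightarrow> 'a" where F: "continuous_on ?S F" "F \<in> ?S \<rightarrow> ?S"
    "\<And>x. x \<in> topspace (nsphere ?m) \<Longrightarrow> sphere_map ?m F x = f x"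
    "F = of_coords ?m \<circ> f \<circ> to_coords ?m"
    using sphere_map_of_nsphere_map[OF Suc.prems(1,2)] by metis
  have sym: "- v \<in> ?S" if "v \<in> ?S" for v
    using that by (simp add: subspace_neg subspace_coord_space)
  have oddF: "F (- v) = - F v" if "v \<in> ?S" for v
    using to_coords_sphere[OF Suc.prems(1) that]
    by (simp add: F(4) to_coords_uminus Suc.prems(3) of_coords_uminus)
  have "closed ?T" by (simp add: closed_subspace subspace_coord_space)
  then have compS: "compact ?S" by (simp add: compact_Int_closed)
  have FT: "F ` ?S \<subseteq> ?T" using F(2) by auto
  obtain p where p: "polynomial_function p" "p ` ?S \<subseteq> ?T" "\<And>v. p (- v) = - p v"
    "\<And>v. v \<in> ?S \<Longrightarrow> norm (F v - p v) < 1"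
  proof -
    have "\<exists>p. polynomial_function p \<and> p ` ?S \<subseteq> ?T \<and> (\<forall>v. p (- v) = - p v) \<and>
        (\<forall>v\<in>?S. norm (F v - p v) < 1)"
      by (rule odd_polynomial_approximation)
         (use compS F(1) subspace_coord_space FT sym oddF in \<open>blast intro: zero_less_one\<close>)+
    then show ?thesis using that by blast
  qed
  have normF: "norm (F v) = 1" if "v \<in> ?S" for v using F(2) that by auto
  have p0: "p v \<noteq> 0" if "v \<in> ?S" for v
    using p(4)[OF that] normF[OF that] by auto
  have KS: "?K \<subseteq> ?S"
    unfolding coord_space_def by (intro Int_mono order_refl span_mono) auto
  have subT: "coord_space n \<subseteq> ?T"
    unfolding coord_space_def by (intro span_mono) auto
  \<comment> \<open>A differentiable map on the unit sphere of a subspace cannot cover the unit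
    sphere of a subspace of larger dimension.\<close>
  have "(sgn \<circ> p) ` (sphere 0 1 \<inter> coord_space n) \<noteq> ?S"
  proof (rule spheremap_lemma1)
    have "(sgn \<circ> p) differentiable at v" if "v \<in> ?K" for v
    proof (rule differentiable_chain_at)
      show "p differentiable at v" using p(1) by (simp add: differentiable_at_polynomial_function)
      have "(\<lambda>y::'a. inverse (norm y) *\<^sub>R y) differentiable at (p v)"
        using KS p0 that
        by (intro differentiable_scaleR differentiable_inverse differentiable_norm_at differentiable_ident) auto
      then show "sgn differentiable at (p v)" by (simp add: sgn_div_norm[abs_def])
    qed
    then show "(sgn \<circ> p) differentiable_on ?K"
      by (simp add: differentiable_on_def differentiable_at_withinI)
  qed (use Suc.prems(1) dim_coord_space[where 'a='a] in \<open>simp_all add: subspace_coord_space subT\<close>)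
  moreover have "(sgn \<circ> p) ` ?K \<subseteq> ?S"
    using KS p(2) p0 by (force simp: norm_sgn sgn_div_norm intro!: subspace_scale subspace_coord_space)
  ultimately obtain a where a: "a \<in> ?S" "a \<notin> (sgn \<circ> p) ` ?K" by blast
  have na: "norm a = 1" "a \<bullet> a = 1" using a(1) by (auto simp: norm_eq_1)
  \<comment> \<open>Since p is odd and the equator is symmetric, missing a means missing -a as
    well.\<close>
  have notpar: "p v \<noteq> c *\<^sub>R a" if "v \<in> ?K" for v c
  proof
    assume eq: "p v = c *\<^sub>R a"
    then have "c \<noteq> 0" using p0 KS that by auto
    then have "sgn (p v) = a \<or> sgn (p v) = - a"
      by (cases "c > 0") (auto simp: eq sgn_div_norm na)
    then have "(sgn \<circ> p) v = a \<or> (sgn \<circ> p) (- v) = a"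
      by (auto simp: p(3) sgn_minus)
    moreover have "- v \<in> ?K" using that by (simp add: subspace_neg subspace_coord_space)
    ultimately show False using a(2) that by (metis image_eqI)
  qed
  \<comment> \<open>\<open>\<phi>\<close> is 1 exactly on the equator, where G therefore loses its
    whole component along a. Elsewhere the factor is below 1 and cannot cancel a nonzero multiple of
    a.\<close>
  define \<phi> where "\<phi> v = 1 - \<bar>v \<bullet> ?b\<bar>" for v :: 'a
  define G where "G v = p v - (\<phi> v * (p v \<bullet> a)) *\<^sub>R a" for v
  have contp: "continuous_on X p" for X
    using p(1) by (simp add: continuous_on_polymonial_function)
  have contG: "continuous_on X G" for X
    unfolding G_def \<phi>_def by (intro continuous_intros contp)
  have pT: "p v \<in> ?T" if "v \<in> ?S" for v using p(2) that by auto
  have aT: "a \<in> ?T" using a by simp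
  have GT: "G v \<in> ?T" if "v \<in> ?S" for v
    unfolding G_def by (intro subspace_diff subspace_scale subspace_coord_space pT that aT)
  have phi: "\<phi> v \<le> 1" "0 \<le> \<phi> v" if "v \<in> ?S" for v
  proof -
    have "\<bar>v \<bullet> ?b\<bar> \<le> norm v * norm ?b" by (rule Cauchy_Schwarz_ineq2)
    then show "\<phi> v \<le> 1" "0 \<le> \<phi> v"
      using that Suc.prems(1) bvec_in_Basis[of ?m, where 'a='a] by (auto simp: \<phi>_def)
  qed
  have equator: "v \<in> ?K" if "v \<in> ?S" "v \<bullet> ?b = 0" for v
  proof -
    have "v = of_coords ?m (to_coords ?m v)"
      using that Suc.prems(1) by (simp add: of_coords_to_coords)
    also have "\<dots> = of_coords n (to_coords n v)"
      using that by (auto simp: of_coords_def to_coords_def intro!: sum.cong)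
    finally show ?thesis using that(1) of_coords_in by (metis IntE IntI)
  qed
  have deg1: "Brouwer_degree2 ?m (sphere_map ?m F) = Brouwer_degree2 ?m (sphere_map ?m p)"
  proof (rule Brouwer_degree2_sphere_map_cong[OF Suc.prems(1) F(1) contp])
    fix v assume v: "v \<in> ?S"
    have "0 \<notin> closed_segment (F v) (p v)"
    proof
      assume "0 \<in> closed_segment (F v) (p v)"
      then have "norm (0 - F v) \<le> norm (F v - p v)"
        by (metis dist_in_closed_segment dist_norm norm_minus_commute)
      then show False using p(4)[OF v] normF[OF v] by simp
    qed
    moreover have "F v \<in> ?T" using F(2) v by auto
    then have "closed_segment (F v) (p v) \<subseteq> ?T"
      by (intro closed_segment_subset pT v subspace_imp_convex subspace_coord_space)
    ultimately show "closed_segment (F v) (p v) \<subseteq> ?T - {0}" by auto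
  qed
  have seg: "closed_segment (p v) (G v) \<subseteq> ?T - {0}" if v: "v \<in> ?S" for v
  proof -
    have "0 \<notin> closed_segment (p v) (G v)"
    proof
      assume "0 \<in> closed_segment (p v) (G v)"
      then obtain t where t: "0 \<le> t" "t \<le> 1" "0 = (1 - t) *\<^sub>R p v + t *\<^sub>R G v"
        by (auto simp: in_segment)
      then have eq: "p v = (t * \<phi> v * (p v \<bullet> a)) *\<^sub>R a"
        by (simp add: G_def algebra_simps)
      then have "p v \<bullet> a = t * \<phi> v * (p v \<bullet> a)"
        using na(2) by (metis inner_scaleR_left mult.right_neutral)
      moreover have "p v \<bullet> a \<noteq> 0" using eq p0[OF v] by auto
      \<comment> \<open>Both factors lie between 0 and 1, so both are 1. Then v is on the equator,
        where p v is no multiple of a.\<close>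
      ultimately have "t * \<phi> v = 1" by simp
      then have "\<phi> v = 1"
        using t phi[OF v] by (smt (verit) mult_left_le_one_le)
      then have "v \<in> ?K" using equator v by (simp add: \<phi>_def)
      then show False using notpar eq by blast
    qed
    moreover have "closed_segment (p v) (G v) \<subseteq> ?T"
      by (intro closed_segment_subset pT GT v subspace_imp_convex subspace_coord_space)
    ultimately show ?thesis by auto
  qed
  then have G0: "G v \<in> ?T - {0}" if "v \<in> ?S" for v
    using that ends_in_segment(2) by blast
  have deg2: "Brouwer_degree2 ?m (sphere_map ?m p) = Brouwer_degree2 ?m (sphere_map ?m G)"
    by (rule Brouwer_degree2_sphere_map_cong[OF Suc.prems(1) contp contG seg])
  \<comment> \<open>G maps the equator into the orthogonal complement of a. Exchanging a with the
    pole \<open>?b\<close> turns this complement into the equatorial hyperplane.\<close>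
  let ?w = "a - ?b"
  let ?H = "reflect ?w \<circ> G"
  have bT: "?b \<in> ?T" by (simp add: coord_space_def span_base)
  have nb: "norm ?b = 1" using Suc.prems(1) by (simp add: bvec_in_Basis)
  have deg3: "\<bar>Brouwer_degree2 ?m (sphere_map ?m ?H)\<bar> = \<bar>Brouwer_degree2 ?m (sphere_map ?m G)\<bar>"
    by (intro sphere_map_reflect Suc.prems(1) contG G0 subspace_diff subspace_coord_space aT bT)
  have H0: "?H v \<in> ?T - {0}" if "v \<in> ?S" for v
  proof -
    have "reflect ?w (G v) \<in> ?T"
      unfolding reflect_def by (intro subspace_diff subspace_scale subspace_coord_space GT that aT bT)
    moreover have "reflect ?w (G v) \<noteq> 0"
      using G0[OF that] inner_reflect[of ?w "G v" "G v"] by auto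
    ultimately show ?thesis by simp
  qed
  have "continuous_on UNIV (reflect ?w)"
    using linear_reflect linear_continuous_on linear_conv_bounded_linear by blast
  then have contH: "continuous_on ?S ?H"
    by (intro continuous_on_compose contG) (auto intro: continuous_on_subset)
  have oddH: "?H (- v) = - ?H v" for v
  proof -
    have "G (- v) = - G v" by (simp add: G_def \<phi>_def p(3))
    then show ?thesis by (simp add: linear_neg[OF linear_reflect])
  qed
  let ?h = "sphere_map ?m ?H"
  have conth: "continuous_map (nsphere ?m) (nsphere ?m) ?h"
    by (rule continuous_map_sphere_map[OF Suc.prems(1) contH H0])
  have oddh: "?h (\<lambda>i. - x i) = (\<lambda>i. - ?h x i)" if "x \<in> topspace (nsphere ?m)" for x
    using that by (intro sphere_map_uminus[OF Suc.prems(1)] oddH)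
  have nsub: "topspace (nsphere n) \<subseteq> topspace (nsphere ?m)"
    by (auto simp: topspace_nsphere)
  have heq: "?h x \<in> topspace (nsphere n)" if x: "x \<in> topspace (nsphere n)" for x
  proof -
    define v where "v = (of_coords ?m x :: 'a)"
    have xm: "x \<in> topspace (nsphere ?m)" using x nsub by auto
    have v: "v \<in> ?S" using of_coords_sphere[OF Suc.prems(1) xm] by (simp add: v_def)
    have "v \<bullet> ?b = 0"
      using x Suc.prems(1) by (simp add: v_def of_coords_inner topspace_nsphere)
    then have "G v \<bullet> a = 0" by (simp add: G_def \<phi>_def inner_diff_left na)
    then have "reflect ?w (G v) \<bullet> reflect ?w a = 0" by (simp add: inner_reflect)
    then have "?H v \<bullet> ?b = 0" using reflect_swap[of a ?b] na nb by simp
    then have "sgn (?H v) \<bullet> ?b = 0" by (simp add: sgn_div_norm)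
    then have "?h x ?m = 0" by (simp add: sphere_map_def to_coords_def v_def)
    moreover have "?h x \<in> topspace (nsphere ?m)"
      using conth xm by (auto simp: continuous_map_def)
    ultimately show ?thesis using topspace_nsphere_minus1[of "?h x" ?m] by simp
  qed
  have "even (Brouwer_degree2 ?m ?h - Brouwer_degree2 (?m - Suc 0) ?h)"
    by (rule Borsuk_odd_mapping_degree_step) (use conth oddh heq in auto)
  moreover have "odd (Brouwer_degree2 n ?h)"
  proof (rule Suc.IH)
    have eq: "nsphere n = subtopology (nsphere ?m) {x. x ?m = 0}"
      by (simp add: subtopology_nsphere_equator)
    have "continuous_map (nsphere n) (nsphere ?m) ?h"
      unfolding eq by (rule continuous_map_from_subtopology[OF conth])
    then show "continuous_map (nsphere n) (nsphere n) ?h"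
      using heq by (subst (2) eq) (auto simp: continuous_map_in_subtopology topspace_nsphere)
  qed (use Suc.prems(1) in simp, use oddh nsub in blast)
  ultimately have "odd (Brouwer_degree2 ?m ?h)" by simp
  then have "odd (Brouwer_degree2 ?m (sphere_map ?m F))"
    using deg1 deg2 deg3 by (metis even_abs_add_iff even_add dvd_abs_iff)
  moreover have "Brouwer_degree2 ?m (sphere_map ?m F) = Brouwer_degree2 ?m f"
    by (rule Brouwer_degree2_eq[OF F(3)])
  ultimately show ?case by simp
qed

text \<open>Without a common zero, the functions, transported to \<open>coord_space n\<close> by an
  isometry, form an odd map of the n-sphere into its equator. It is not surjective, so its degree is
  0, contrary to \<open>odd_map_odd_degree\<close>.\<close>

theorem Borsuk_Ulam_subspace:
  fixes L :: "'a::euclidean_space set" and \<phi> :: "nat \<Rightarrow> 'a \<Rightarrow> real"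
  assumes L: "subspace L" "dim L = Suc n"
    and cont: "\<And>i. i < n \<Longrightarrow> continuous_on UNIV (\<phi> i)"
    and odd: "\<And>i v. i < n \<Longrightarrow> \<phi> i (- v) = - \<phi> i v"
  obtains v where "v \<in> L" "v \<noteq> 0" "\<And>i. i < n \<Longrightarrow> \<phi> i v = 0"
proof -
  have n: "n < DIM('a)" using L(2) dim_subset_UNIV[of L] by simp
  have "\<exists>v\<in>L. v \<noteq> 0 \<and> (\<forall>i<n. \<phi> i v = 0)"
  proof (rule ccontr)
    assume "\<not> ?thesis"
    then have no: "\<exists>i<n. \<phi> i v \<noteq> 0" if "v \<in> L" "v \<noteq> 0" for v
      using that by auto
    \<comment> \<open>For n = 0 there is no equator to map into, and any nonzero vector of L would
      do.\<close>
    have "n \<noteq> 0"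
    proof
      assume "n = 0"
      then have "L \<subseteq> {0}" using no by auto
      then have "dim L = 0" by (simp only: dim_eq_0)
      then show False using L(2) by simp
    qed
    then obtain p where p: "n = Suc p" using not0_implies_Suc by blast
    obtain f :: "'a \<Rightarrow> 'a" where f: "linear f" "f ` coord_space n = L"
      "\<And>x. x \<in> coord_space n \<Longrightarrow> norm (f x) = norm x"
    proof -
      have "dim (coord_space n :: 'a set) = dim L" by (simp add: dim_coord_space n L(2))
      from isometry_subspaces[OF subspace_coord_space L(1) this] that show ?thesis by blast
    qed
    define F :: "'a \<Rightarrow> 'a" where "F v = of_coords p (\<lambda>i. \<phi> i (f v))" for v
    have contf: "continuous_on UNIV f"
      using f(1) linear_continuous_on linear_conv_bounded_linear by blast
    have "continuous_on UNIV (\<lambda>v. \<phi> i (f v))" if "i \<le> p" for i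
      using continuous_on_compose2[OF cont contf, of i] that by (simp add: p)
    then have cF: "continuous_on (coord_sphere n) F"
      unfolding F_def of_coords_def
      by (intro continuous_on_sum continuous_on_scaleR continuous_on_const)
         (auto intro: continuous_on_subset)
    have pn: "coord_space p \<subseteq> (coord_space n :: 'a set)"
      unfolding coord_space_def by (intro span_mono) (auto simp: p)
    have F0: "F v \<in> coord_space n - {0}" if v: "v \<in> coord_sphere n" for v
    proof -
      have "f v \<in> L" using f(2) v by auto
      moreover have "f v \<noteq> 0" using f(3)[of v] v by fastforce
      ultimately obtain i where i: "i \<le> p" "\<phi> i (f v) \<noteq> 0" using no p by (metis less_Suc_eq_le)
      then have "F v \<bullet> bvec i \<noteq> 0" using n by (simp add: F_def of_coords_inner p)
      then show ?thesis using of_coords_in pn by (auto simp: F_def)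
    qed
    let ?g = "sphere_map n F"
    have cg: "continuous_map (nsphere n) (nsphere n) ?g"
      by (rule continuous_map_sphere_map[OF n cF F0])
    have oddg: "odd (Brouwer_degree2 n ?g)"
    proof (rule odd_map_odd_degree[OF n cg sphere_map_uminus[OF n]])
      show "F (- v) = - F v" for v
        by (simp add: F_def linear_neg[OF f(1)] odd p of_coords_def sum_negf)
    qed
    have g0: "?g x n = 0" for x
    proof -
      have "of_coords p y \<bullet> (bvec n :: 'a) = 0" for y
        using n by (auto simp: of_coords_def inner_sum_left inner_bvec p intro!: sum.neutral)
      then show ?thesis by (simp add: sphere_map_def to_coords_def F_def sgn_div_norm)
    qed
    let ?e = "\<lambda>i. if i = n then 1 else (0::real)"
    have "?e \<notin> ?g ` topspace (nsphere n)"
    proof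
      assume "?e \<in> ?g ` topspace (nsphere n)"
      then obtain x where "?e = ?g x" by blast
      then have "?e n = ?g x n" by (rule fun_cong)
      then show False by (simp add: g0)
    qed
    moreover have "?e \<in> topspace (nsphere n)"
      by (simp add: topspace_nsphere if_distrib[of "\<lambda>x. x\<^sup>2"] cong: if_cong)
    ultimately have "Brouwer_degree2 n ?g = 0"
      by (intro Brouwer_degree2_nonsurjective[OF cg]) blast
    with oddg show False by simp
  qed
  then show ?thesis using that by blast
qed

section \<open>Polynomials with prescribed double zeros\<close>

text \<open>There is a zero of the derivative strictly between any two consecutive points of Z. That
  these zeros avoid Z allows counting them together with double zeros when Rolle is applied a second
  time.\<close>

lemma Rolle_poly_set:
  fixes p :: "real poly"
  assumes "finite Z" "Z \<noteq> {}" "Z \<subseteq> {a..b}" "\<And>z. z \<in> Z \<Longrightarrow> poly p z = 0"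
  shows "\<exists>Y. finite Y \<and> Suc (card Y) = card Z \<and> Y \<subseteq> {a<..<b} - Z \<and> (\<forall>y\<in>Y. poly (pderiv p) y = 0)"
  using assms
proof (induction Z arbitrary: b rule: finite_linorder_max_induct)
  case empty
  then show ?case by simp
next
  case (insert z Z)
  show ?case
  proof (cases "Z = {}")
    case True
    then show ?thesis by (intro exI[of _ "{}"]) auto
  next
    case False
    define m where "m = Max Z"
    have m: "m \<in> Z" "\<And>x. x \<in> Z \<Longrightarrow> x \<le> m"
      using insert.hyps(1) False by (auto simp: m_def)
    have "Z \<subseteq> {a..m}" using insert.prems m by auto
    then obtain Y where Y: "finite Y" "Suc (card Y) = card Z" "Y \<subseteq> {a<..<m} - Z"
      "\<forall>y\<in>Y. poly (pderiv p) y = 0"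
      using insert.IH[of m] False insert.prems by auto
    have mz: "m < z" using insert.hyps(2) m(1) by auto
    obtain y where y: "m < y" "y < z" "poly (pderiv p) y = 0"
    proof -
      obtain y where "m < y" "y < z" "poly p z - poly p m = (z - m) * poly (pderiv p) y"
        using poly_MVT[OF mz] by blast
      moreover have "poly p z = 0" "poly p m = 0" using m(1) insert.prems by auto
      ultimately show ?thesis using that by auto
    qed
    have am: "a \<le> m" and zb: "z \<le> b" using m(1) insert.prems by auto
    have yY: "y \<notin> Y" using Y(3) y(1) by fastforce
    show ?thesis
    proof (intro exI[of _ "insert y Y"] conjI ballI)
      show "finite (insert y Y)" using Y(1) by simp
      have "z \<notin> Z" using insert.hyps(2) by blast
      then show "Suc (card (insert y Y)) = card (insert z Z)"
        using Y(1,2) yY insert.hyps(1) by simp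
      have "y \<notin> Z" "z \<notin> Y" using m(2) y(1) Y(3) mz by fastforce+
      then show "insert y Y \<subseteq> {a<..<b} - insert z Z"
        using Y(3) y(1,2) am zb mz by fastforce
      show "poly (pderiv p) x = 0" if "x \<in> insert y Y" for x
        using that Y(4) y(3) by blast
    qed
  qed
qed

lemma prod_root_factors_dvd:
  fixes p :: "'a::idom poly"
  assumes "finite R" "\<And>z. z \<in> R \<Longrightarrow> poly p z = 0"
  shows "(\<Prod>z\<in>R. [:- z, 1:]) dvd p"
  using assms
proof (induction R)
  case (insert z R)
  then obtain h where h: "p = (\<Prod>z\<in>R. [:- z, 1:]) * h" by (auto elim: dvdE)
  have "poly (\<Prod>z\<in>R. [:- z, 1:]) z \<noteq> 0"
    using insert.hyps by (auto simp: poly_prod)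
  then have "poly h z = 0" using insert.prems[of z] by (simp add: h)
  then obtain h' where "h = [:- z, 1:] * h'" by (auto simp: poly_eq_0_iff_dvd elim: dvdE)
  then show ?case using insert.hyps by (simp add: h ac_simps del: mult_pCons_left mult_pCons_right)
qed simp

lemma prod_double_root_factors_dvd:
  fixes p :: "'a::{idom,semiring_char_0} poly"
  assumes "finite R" "\<And>z. z \<in> R \<Longrightarrow> poly p z = 0" "\<And>z. z \<in> R \<Longrightarrow> poly (pderiv p) z = 0"
  shows "(\<Prod>z\<in>R. [:- z, 1:])\<^sup>2 dvd p"
  using assms
proof (induction R)
  case (insert z R)
  then obtain h where h: "p = (\<Prod>z\<in>R. [:- z, 1:])\<^sup>2 * h" by (auto elim: dvdE)
  have nz: "poly ((\<Prod>z\<in>R. [:- z, 1:])\<^sup>2) z \<noteq> 0"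
    using insert.hyps by (auto simp: poly_prod)
  then have "poly h z = 0" using insert.prems(1)[of z] by (simp add: h)
  then obtain h' where h': "h = [:- z, 1:] * h'" by (auto simp: poly_eq_0_iff_dvd elim: dvdE)
  have "poly (pderiv h) z = 0"
    using insert.prems(2)[of z] nz \<open>poly h z = 0\<close> by (simp add: h pderiv_mult)
  then have "poly h' z = 0" 
    by (simp add: h' pderiv_mult pderiv_pCons del: mult_pCons_left mult_pCons_right)
  then obtain h'' where "h' = [:- z, 1:] * h''" by (auto simp: poly_eq_0_iff_dvd elim: dvdE)
  then have "p = (\<Prod>z\<in>insert z R. [:- z, 1:])\<^sup>2 * h''"
    using insert.hyps 
    by (simp add: h h' power2_eq_square ac_simps del: mult_pCons_left mult_pCons_right)
  then show ?case by simp
qed simp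

text \<open>All other terms of the second derivative keep a factor x - z. At a double zero the
  second derivative thus has the sign of the cofactor.\<close>

lemma poly_second_derivative_at_double_root:
  fixes z :: "'a::idom"
  shows "poly (pderiv (pderiv ([:- z, 1:]\<^sup>2 * h))) z = 2 * poly h z"
  by (simp add: pderiv_mult pderiv_pCons pderiv_add power2_eq_square del: mult_pCons_left mult_pCons_right)

text \<open>If every \<open>f i\<close> has double zeros on \<open>S i\<close>, Rolle's theorem yields at least
  \<open>2 (card (S i) - 1)\<close> zeros of the common second derivative \<open>q\<close> inside block \<open>i\<close>. The degree bound
  leaves no room for further zeros, and an even number of zeros per block makes \<open>q\<close> positive
  at the largest point of each \<open>S i\<close>.\<close>

lemma double_roots_positive:
  fixes f :: "'i \<Rightarrow> real poly" and S :: "'i \<Rightarrow> real set"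
  assumes fin: "finite I" "\<And>i. i \<in> I \<Longrightarrow> finite (S i)" "\<And>i. i \<in> I \<Longrightarrow> S i \<noteq> {}"
    and sub: "\<And>i. i \<in> I \<Longrightarrow> S i \<subseteq> {lo i..hi i}"
    and disj: "\<And>i j. i \<in> I \<Longrightarrow> j \<in> I \<Longrightarrow> i \<noteq> j \<Longrightarrow> hi i < lo j \<or> hi j < lo i"
    and f0: "\<And>i s. i \<in> I \<Longrightarrow> s \<in> S i \<Longrightarrow> poly (f i) s = 0"
    and f1: "\<And>i s. i \<in> I \<Longrightarrow> s \<in> S i \<Longrightarrow> poly (pderiv (f i)) s = 0"
    and f2: "\<And>i. i \<in> I \<Longrightarrow> pderiv (pderiv (f i)) = q"
    and deg: "degree q \<le> (\<Sum>i\<in>I. 2 * (card (S i) - 1))"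
    and lead: "lead_coeff q > 0"
    and i: "i \<in> I" and t: "t \<in> {lo i..hi i}" "t \<notin> S i"
  shows "poly (f i) t > 0"
proof -
  \<comment> \<open>The n + 1 zeros Z of \<open>f j\<close> give n zeros of its derivative off Z.
    The double zeros \<open>S j\<close> are further zeros of the derivative, and a second
    application of Rolle leaves card (S j) + n - 1 zeros of q. This serves for Z = S j and for Z
    with one point more.\<close>
  have second: "\<exists>Y. finite Y \<and> Suc (card Y) = card (S j) + n \<and> Y \<subseteq> {a<..<b} - S j \<and> (\<forall>y\<in>Y. poly q y = 0)"
    if j: "j \<in> I" and Z: "finite Z" "card Z = Suc n" "S j \<subseteq> Z" "Z \<subseteq> {a..b}" "\<And>z. z \<in> Z \<Longrightarrow> poly (f j) z = 0"
    for j Z n a b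
  proof -
    have "Z \<noteq> {}" using Z by auto
    then obtain Y where Y: "finite Y" "Suc (card Y) = card Z" "Y \<subseteq> {a<..<b} - Z"
        "\<forall>y\<in>Y. poly (pderiv (f j)) y = 0"
      using Rolle_poly_set[OF Z(1) _ Z(4,5)] by auto
    let ?W = "S j \<union> Y"
    have "card ?W = card (S j) + card Y"
      using Y Z fin(2)[OF j] by (intro card_Un_disjoint) auto
    moreover have "\<exists>X. finite X \<and> Suc (card X) = card ?W \<and> X \<subseteq> {a<..<b} - ?W \<and>
        (\<forall>x\<in>X. poly (pderiv (pderiv (f j))) x = 0)"
      using Y Z fin(2,3)[OF j] f1[OF j] by (intro Rolle_poly_set) auto
    ultimately show ?thesis using Y(2) Z(2) f2[OF j] by auto
  qed
  have "\<exists>Y. finite Y \<and> card Y = 2 * (card (S j) - 1) \<and> Y \<subseteq> {Min (S j)<..<Max (S j)} - S j \<and>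
      (\<forall>y\<in>Y. poly q y = 0)" if j: "j \<in> I" for j
  proof -
    obtain n where n: "card (S j) = Suc n"
      using fin(2,3)[OF j] by (metis card_eq_0_iff not0_implies_Suc)
    have "S j \<subseteq> {Min (S j)..Max (S j)}" using fin(2)[OF j] by auto
    then show ?thesis
      using second[OF j fin(2)[OF j] n order_refl _ f0[OF j], of "Min (S j)" "Max (S j)"] n
      by (simp add: mult_2)
  qed
  then obtain Y where Y: "\<And>j. j \<in> I \<Longrightarrow> finite (Y j)" "\<And>j. j \<in> I \<Longrightarrow> card (Y j) = 2 * (card (S j) - 1)"
    "\<And>j. j \<in> I \<Longrightarrow> Y j \<subseteq> {Min (S j)<..<Max (S j)} - S j" "\<And>j y. j \<in> I \<Longrightarrow> y \<in> Y j \<Longrightarrow> poly q y = 0"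
    by metis
  have Ylohi: "Y j \<subseteq> {lo j<..<hi j}" if j: "j \<in> I" for j
  proof -
    have "Min (S j) \<in> S j" "Max (S j) \<in> S j" using fin(2,3)[OF j] by auto
    then have "lo j \<le> Min (S j)" "Max (S j) \<le> hi j" using sub[OF j] by auto
    then show ?thesis using Y(3)[OF j] by fastforce
  qed
  define R where "R = (\<Union>j\<in>I. Y j)"
  have finR: "finite R" using fin(1) Y(1) by (auto simp: R_def)
  have disjY: "Y j \<inter> Y l = {}" if "j \<in> I" "l \<in> I" "j \<noteq> l" for j l
    using Ylohi[OF that(1)] Ylohi[OF that(2)] disj[OF that] by force
  have cardR: "card R = (\<Sum>j\<in>I. 2 * (card (S j) - 1))"
    unfolding R_def using fin(1) Y(1,2) disjY by (subst card_UN_disjoint) auto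
  have "(\<Prod>z\<in>R. [:- z, 1:]) dvd q"
    using finR Y(4) by (intro prod_root_factors_dvd) (auto simp: R_def)
  then obtain h where h: "q = (\<Prod>z\<in>R. [:- z, 1:]) * h" by (auto elim: dvdE)
  have q0: "q \<noteq> 0" using lead by auto
  have degR: "degree (\<Prod>z\<in>R. [:- z, 1:]) = card R"
    by (simp add: degree_prod_eq_sum_degree)
  have leadR: "lead_coeff (\<Prod>z\<in>R. [:- z, 1:]) = 1"
    by (simp only: lead_coeff_prod) simp
  \<comment> \<open>The zeros in R exhaust the degree of q, so q is a positive constant times the
    product over R and vanishes nowhere else.\<close>
  have "degree q = card R + degree h"
    using q0 h degR by (metis degree_mult_eq mult_zero_left mult_zero_right)
  then have "degree h = 0" using deg cardR by simp
  then obtain c where c: "h = [:c:]" by (metis degree_eq_zeroE)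
  have "lead_coeff q = c" by (simp only: h c lead_coeff_mult leadR) simp
  then have cpos: "c > 0" using lead by simp
  have qeq: "poly q x = (\<Prod>z\<in>R. x - z) * c" for x
    by (simp add: h c poly_prod)
  have qroots: "poly q x = 0 \<longleftrightarrow> x \<in> R" for x
    using finR cpos by (auto simp: qeq)
  have Rblock: "R \<inter> {lo i..hi i} = Y i"
  proof
    show "R \<inter> {lo i..hi i} \<subseteq> Y i"
    proof
      fix x assume x: "x \<in> R \<inter> {lo i..hi i}"
      then obtain j where j: "j \<in> I" "x \<in> Y j" by (auto simp: R_def)
      have "j = i"
        using Ylohi[OF j(1)] j(2) x disj[OF j(1) i] by force
      then show "x \<in> Y i" using j by simp
    qed
  qed (use Ylohi[OF i] i in \<open>auto simp: R_def\<close>)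
  have qS: "poly q s \<noteq> 0" if "s \<in> S i" for s
    using that Rblock Y(3)[OF i] sub[OF i] qroots by blast
  define m where "m = Max (S i)"
  have m: "m \<in> S i" using fin(2,3)[OF i] by (simp add: m_def)
  \<comment> \<open>The zeros in block i lie to the left of m. Those in another block all lie on one
    side of m and are even in number. Hence every block contributes a positive factor.\<close>
  have "(\<Prod>z\<in>R. m - z) = (\<Prod>j\<in>I. \<Prod>z\<in>Y j. m - z)"
    unfolding R_def using fin(1) Y(1) disjY by (intro prod.UNION_disjoint) auto
  also have "\<dots> > 0"
  proof (rule prod_pos)
    fix j assume j: "j \<in> I"
    have mlohi: "m \<in> {lo i..hi i}" using m sub[OF i] by auto
    consider "\<And>z. z \<in> Y j \<Longrightarrow> z < m" | "\<And>z. z \<in> Y j \<Longrightarrow> m < z"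
    proof (cases "j = i")
      case True
      have "z < m" if "z \<in> Y j" for z
        using that True Y(3)[OF i] by (auto simp: m_def)
      then show ?thesis by (rule that(1))
    next
      case False
      from disj[OF j i False] show ?thesis
      proof
        assume "hi j < lo i"
        then show ?thesis using Ylohi[OF j] mlohi by (intro that(1)) fastforce
      next
        assume "hi i < lo j"
        then show ?thesis using Ylohi[OF j] mlohi by (intro that(2)) fastforce
      qed
    qed
    then show "0 < (\<Prod>z\<in>Y j. m - z)"
    proof cases
      case 1
      then show ?thesis by (intro prod_pos) auto
    next
      case 2
      have "(\<Prod>z\<in>Y j. m - z) = (\<Prod>z\<in>Y j. (-1) * (z - m))" by simp
      also have "\<dots> = (\<Prod>z\<in>Y j. z - m)"
        unfolding prod.distrib by (simp add: Y(2)[OF j])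
      also have "\<dots> > 0" using 2 by (intro prod_pos) auto
      finally show ?thesis .
    qed
  qed
  finally have qm: "poly q m > 0" using cpos by (simp add: qeq)
  have "(\<Prod>z\<in>S i. [:- z, 1:])\<^sup>2 dvd f i"
    using fin(2)[OF i] f0[OF i] f1[OF i] by (intro prod_double_root_factors_dvd)
  then obtain E where E: "f i = (\<Prod>z\<in>S i. [:- z, 1:])\<^sup>2 * E" by (auto elim: dvdE)
  \<comment> \<open>On \<open>S i\<close> the cofactor E has the sign of q.\<close>
  have ES: "\<exists>d>0. poly q s = d * poly E s" if s: "s \<in> S i" for s
  proof -
    define D where "D = (\<Prod>z\<in>S i - {s}. [:- z, 1:])\<^sup>2"
    have "f i = [:- s, 1:]\<^sup>2 * (D * E)"
      unfolding E D_def prod.remove[OF fin(2)[OF i] s] power_mult_distrib mult.assoc ..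
    then have "poly q s = 2 * poly D s * poly E s"
      using f2[OF i] poly_second_derivative_at_double_root[of s "D * E"] by simp
    moreover have "poly D s > 0"
      using fin(2)[OF i] by (simp add: D_def poly_prod) 
    ultimately show ?thesis by (intro exI[of _ "2 * poly D s"]) simp
  qed
  have Em: "poly E m > 0" using ES[OF m] qm by (auto simp: zero_less_mult_iff)
  \<comment> \<open>One more zero of \<open>f i\<close> in its block would force 2 card (S i) - 1
    zeros of q there, one more than \<open>Y i\<close> contains.\<close>
  have noroot: "poly (f i) x \<noteq> 0" if x: "x \<in> {lo i..hi i}" "x \<notin> S i" for x
  proof
    assume "poly (f i) x = 0"
    then have "\<exists>X. finite X \<and> Suc (card X) = card (S i) + card (S i) \<and> X \<subseteq> {lo i<..<hi i} - S i \<and>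
        (\<forall>y\<in>X. poly q y = 0)"
      using i fin(2)[OF i] x sub[OF i] f0[OF i] by (intro second[of i "insert x (S i)"]) auto
    then obtain X where X: "finite X" "Suc (card X) = card (S i) + card (S i)" "X \<subseteq> {lo i<..<hi i}"
        "\<forall>y\<in>X. poly q y = 0" by auto
    then have "X \<subseteq> Y i" using Rblock qroots by fastforce
    then have "card X \<le> card (Y i)" using Y(1)[OF i] by (rule card_mono[rotated])
    moreover have "card (S i) > 0" using fin(2,3)[OF i] by (simp add: card_gt_0_iff)
    ultimately show False using X(2) Y(2)[OF i] by linarith
  qed
  have Enz: "poly E x \<noteq> 0" if x: "x \<in> {lo i..hi i}" for x
  proof (cases "x \<in> S i")
    case True
    then show ?thesis using ES qS by fastforce
  next
    case False
    then show ?thesis using noroot[OF x] by (auto simp: E)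
  qed
  \<comment> \<open>E has no zero in the block, so its positive sign at m extends to t.\<close>
  have "poly E t > 0"
  proof (rule ccontr)
    assume "\<not> poly E t > 0"
    then have neg: "poly E t < 0" using Enz[OF t(1)] by auto
    have mlohi: "m \<in> {lo i..hi i}" using m sub[OF i] by auto
    have "m \<noteq> t" using neg Em by auto
    then consider "t < m" | "m < t" by linarith
    then show False
    proof cases
      case 1
      then obtain x where "t < x" "x < m" "poly E x = 0"
        using poly_IVT_pos[OF 1 neg Em] by auto
      then show False using Enz[of x] t mlohi by auto
    next
      case 2
      then obtain x where "m < x" "x < t" "poly E x = 0"
        using poly_IVT_neg[OF 2 Em neg] by auto
      then show False using Enz[of x] t mlohi by auto
    qed
  qed
  moreover have "poly (\<Prod>z\<in>S i. [:- z, 1:]) t \<noteq> 0"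
    using t(2) fin(2)[OF i] by (auto simp: poly_prod)
  ultimately show ?thesis by (simp add: E)
qed

section \<open>Sums of point families and products of simplices\<close>

lemma delta_le_refl: "delta_le S S"
  by (simp add: delta_le_def)

lemma delta_le_trans: "delta_le S T \<Longrightarrow> delta_le T U \<Longrightarrow> delta_le S U"
  by (fastforce simp: delta_le_def)

lemma delta_le_antisym: "delta_le S T \<Longrightarrow> delta_le T S \<Longrightarrow> S = T"
  by (auto simp: delta_le_def intro!: nth_equalityI)

lemma delta_faces_finite_nth:
  assumes "S \<in> delta_faces ns" "i < length ns"
  shows "finite (S ! i)" "S ! i \<noteq> {}" "card (S ! i) > 0" "S ! i \<subseteq> {0..ns ! i}"
proof -
  show 1: "S ! i \<noteq> {}" "S ! i \<subseteq> {0..ns ! i}" using assms by (auto simp: delta_faces_def)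
  then show "finite (S ! i)" by (meson finite_atLeastAtMost finite_subset)
  then show "card (S ! i) > 0" using 1 by (simp add: card_gt_0_iff)
qed

lemma length_delta_face: "S \<in> delta_faces ns \<Longrightarrow> length S = length ns"
  by (simp add: delta_faces_def)

lemma delta_face_dim_nat:
  assumes "S \<in> delta_faces ns"
  shows "delta_face_dim S = int (\<Sum>i<length ns. card (S ! i) - 1)"
proof -
  have "int (card (S ! i)) - 1 = int (card (S ! i) - 1)" if "i < length ns" for i
    using delta_faces_finite_nth(3)[OF assms that] by linarith
  then show ?thesis
    using length_delta_face[OF assms] by (simp add: delta_face_dim_def)
qed

lemma delta_face_dim_update:
  assumes "S \<in> delta_faces ns" "i < length ns"
  shows "delta_face_dim (S[i := A]) = delta_face_dim S + int (card A) - int (card (S ! i))"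
proof -
  have len: "length S = length ns" using length_delta_face[OF assms(1)] .
  have "delta_face_dim (S[i := A]) = (\<Sum>j\<in>{..<length ns} - {i}. int (card (S ! j)) - 1) + (int (card A) - 1)"
    unfolding delta_face_dim_def using assms(2) len by (simp add: sum.remove[of _ i])
  moreover have "delta_face_dim S = (\<Sum>j\<in>{..<length ns} - {i}. int (card (S ! j)) - 1) + (int (card (S ! i)) - 1)"
    unfolding delta_face_dim_def using assms(2) len by (simp add: sum.remove[of _ i])
  ultimately show ?thesis by simp
qed

lemma delta_face_reduce:
  assumes S: "S \<in> delta_faces ns" and pos: "delta_face_dim S > 0"
  obtains S' where "S' \<in> delta_faces ns" "delta_le S' S" "S' \<noteq> S"
    "delta_face_dim S' = delta_face_dim S - 1"
proof -
  have "\<exists>i<length ns. card (S ! i) - 1 \<noteq> 0"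
  proof (rule ccontr)
    assume "\<not> ?thesis"
    then have "delta_face_dim S = 0" using delta_face_dim_nat[OF S] by simp
    then show False using pos by simp
  qed
  then obtain i where i: "i < length ns" "card (S ! i) - 1 \<noteq> 0" by auto
  note fin = delta_faces_finite_nth[OF S i(1)]
  obtain x where x: "x \<in> S ! i" using fin by auto
  have c: "card (S ! i - {x}) = card (S ! i) - 1" using fin x by simp
  then have ne: "S ! i - {x} \<noteq> {}" using i(2) by (metis card.empty)
  have len: "length S = length ns" using length_delta_face[OF S] .
  let ?S = "S[i := S ! i - {x}]"
  show ?thesis
  proof (rule that[of ?S])
    show "?S \<in> delta_faces ns"
      using S ne fin i len by (auto simp: delta_faces_def nth_list_update)
    show "delta_le ?S S" using len i by (auto simp: delta_le_def nth_list_update)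
    show "?S \<noteq> S" using x i len by (metis Diff_iff insertI1 nth_list_update_eq)
    show "delta_face_dim ?S = delta_face_dim S - 1"
      using delta_face_dim_update[OF S i(1)] c i(2) by simp
  qed
qed

definition delta_top :: "nat list \<Rightarrow> nat set list" where
  "delta_top ns = map (\<lambda>n. {0..n}) ns"

lemma delta_top_in: "delta_top ns \<in> delta_faces ns"
  by (simp add: delta_faces_def delta_top_def)

lemma delta_le_top: "S \<in> delta_faces ns \<Longrightarrow> delta_le S (delta_top ns)"
  by (auto simp: delta_faces_def delta_top_def delta_le_def)

section \<open>Faces of a sum of point families\<close>

definition prod_verts :: "(nat \<Rightarrow> nat \<Rightarrow> 'a::real_vector) \<Rightarrow> nat set list \<Rightarrow> 'a set" where
  "prod_verts u S = (\<lambda>a. \<Sum>i<length S. u i (a i)) ` (\<Pi>\<^sub>E i\<in>{..<length S}. S ! i)"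

text \<open>A Minkowski sum in one space in place of a Cartesian product: the product of simplices
  is the case of independent families, and a linear projection merely replaces u by its
  image.\<close>

definition prod_face :: "(nat \<Rightarrow> nat \<Rightarrow> 'a::real_vector) \<Rightarrow> nat set list \<Rightarrow> 'a set" where
  "prod_face u S = convex hull (prod_verts u S)"

text \<open>Minimizing a functional over a sum decouples into the blocks. With
  \<open>\<beta> i\<close> as block minima, this makes c attain its minimum over the whole sum
  precisely on the face labelled S.\<close>

definition exposes ::
  "(nat \<Rightarrow> nat \<Rightarrow> 'a::real_inner) \<Rightarrow> nat list \<Rightarrow> nat set list \<Rightarrow> 'a \<Rightarrow> (nat \<Rightarrow> real) \<Rightarrow> bool" where
  "exposes u ns S c \<beta> \<longleftrightarrow>
     (\<forall>i<length ns. \<forall>j\<le>ns ! i. \<beta> i \<le> c \<bullet> u i j \<and> (c \<bullet> u i j = \<beta> i \<longleftrightarrow> j \<in> S ! i))"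

lemma prod_verts_iff:
  "x \<in> prod_verts u S \<longleftrightarrow> (\<exists>a. (\<forall>i<length S. a i \<in> S ! i) \<and> x = (\<Sum>i<length S. u i (a i)))"
proof
  assume "\<exists>a. (\<forall>i<length S. a i \<in> S ! i) \<and> x = (\<Sum>i<length S. u i (a i))"
  then obtain a where "\<forall>i<length S. a i \<in> S ! i" "x = (\<Sum>i<length S. u i (a i))" by auto
  then show "x \<in> prod_verts u S"
    unfolding prod_verts_def by (intro image_eqI[of _ _ "restrict a {..<length S}"]) auto
qed (auto simp: prod_verts_def PiE_def Pi_def)

lemma finite_prod_verts: "S \<in> delta_faces ns \<Longrightarrow> finite (prod_verts u S)"
  using delta_faces_finite_nth length_delta_face
  unfolding prod_verts_def by (intro finite_imageI finite_PiE) auto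

lemma prod_verts_nonempty:
  assumes "S \<in> delta_faces ns" shows "prod_verts u S \<noteq> {}"
  using assms unfolding prod_verts_def image_is_empty PiE_eq_empty_iff delta_faces_def by simp

lemma prod_verts_mono: "delta_le S T \<Longrightarrow> prod_verts u S \<subseteq> prod_verts u T"
  unfolding prod_verts_iff delta_le_def subset_iff by metis

lemma prod_face_mono: "delta_le S T \<Longrightarrow> prod_face u S \<subseteq> prod_face u T"
  by (simp add: prod_face_def hull_mono prod_verts_mono)

lemma convex_hull_Int_supporting_hyperplane:
  fixes c :: "'a::euclidean_space"
  assumes "finite V" "\<And>v. v \<in> V \<Longrightarrow> b \<le> c \<bullet> v"
  shows "convex hull V \<inter> {x. c \<bullet> x = b} = convex hull (V \<inter> {x. c \<bullet> x = b})"
    and "convex hull V \<subseteq> {x. c \<bullet> x \<ge> b}"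
proof -
  show ge: "convex hull V \<subseteq> {x. c \<bullet> x \<ge> b}"
    using assms(2) by (intro hull_minimal convex_halfspace_ge) auto
  have "(convex hull V \<inter> {x. c \<bullet> x = b}) face_of (convex hull V)"
    using ge by (intro face_of_Int_supporting_hyperplane_ge) auto
  then obtain V' where V': "V' \<subseteq> V" "convex hull V \<inter> {x. c \<bullet> x = b} = convex hull V'"
    using face_of_convex_hull_subset[OF finite_imp_compact[OF assms(1)]] by metis
  then have "V' \<subseteq> V \<inter> {x. c \<bullet> x = b}"
    using hull_subset[of V' convex] by auto
  then have "convex hull V \<inter> {x. c \<bullet> x = b} \<subseteq> convex hull (V \<inter> {x. c \<bullet> x = b})"
    unfolding V'(2) by (rule hull_mono)
  moreover have "convex hull (V \<inter> {x. c \<bullet> x = b}) \<subseteq> {x. c \<bullet> x = b}"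
    by (rule hull_minimal) (auto simp: convex_hyperplane)
  moreover have "convex hull (V \<inter> {x. c \<bullet> x = b}) \<subseteq> convex hull V"
    by (rule hull_mono) simp
  ultimately show "convex hull V \<inter> {x. c \<bullet> x = b} = convex hull (V \<inter> {x. c \<bullet> x = b})"
    by blast
qed

text \<open>A sum reaches the sum of its termwise lower bounds only if each term reaches its own, so
  a vertex on the supporting hyperplane is chosen from S in every block.\<close>

lemma exposes_face:
  fixes u :: "nat \<Rightarrow> nat \<Rightarrow> 'a::euclidean_space"
  assumes S: "S \<in> delta_faces ns" and e: "exposes u ns S c \<beta>"
  shows "prod_face u S = prod_face u (delta_top ns) \<inter> {x. c \<bullet> x = (\<Sum>i<length ns. \<beta> i)}"
    and "prod_face u (delta_top ns) \<subseteq> {x. c \<bullet> x \<ge> (\<Sum>i<length ns. \<beta> i)}"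
proof -
  let ?V = "prod_verts u (delta_top ns)"
  have len: "length S = length ns" using length_delta_face[OF S] .
  have top: "length (delta_top ns) = length ns" "\<And>i. i < length ns \<Longrightarrow> delta_top ns ! i = {0..ns ! i}"
    by (simp_all add: delta_top_def)
  have ge: "(\<Sum>i<length ns. \<beta> i) \<le> c \<bullet> v" if "v \<in> ?V" for v
    using that e by (auto simp: prod_verts_iff top exposes_def inner_sum_right intro!: sum_mono)
  have "?V \<inter> {x. c \<bullet> x = (\<Sum>i<length ns. \<beta> i)} = prod_verts u S"
  proof (intro equalityI subsetI)
    fix v assume v: "v \<in> ?V \<inter> {x. c \<bullet> x = (\<Sum>i<length ns. \<beta> i)}"
    then obtain a where a: "\<forall>i<length ns. a i \<le> ns ! i" "v = (\<Sum>i<length ns. u i (a i))"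
      by (auto simp: prod_verts_iff top)
    have "(\<Sum>i<length ns. c \<bullet> u i (a i)) = (\<Sum>i<length ns. \<beta> i)"
      using v a(2) by (simp add: inner_sum_right)
    then have eq: "(\<Sum>i<length ns. \<beta> i) = (\<Sum>i<length ns. c \<bullet> u i (a i))" by simp
    have "a i \<in> S ! i" if i: "i < length ns" for i
    proof -
      have "\<beta> i = c \<bullet> u i (a i)"
        using eq by (rule sum_mono_inv) (use e a(1) i in \<open>auto simp: exposes_def\<close>)
      then have "c \<bullet> u i (a i) = \<beta> i" ..
      then show ?thesis using e a(1) i by (auto simp: exposes_def)
    qed
    then show "v \<in> prod_verts u S" using a(2) len by (auto simp: prod_verts_iff)
  next
    fix v assume v: "v \<in> prod_verts u S"
    then obtain a where a: "\<forall>i<length ns. a i \<in> S ! i" "v = (\<Sum>i<length ns. u i (a i))"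
      by (auto simp: prod_verts_iff len)
    moreover have "a i \<le> ns ! i" if "i < length ns" for i
      using a(1) delta_faces_finite_nth(4)[OF S that] that by auto
    ultimately have "c \<bullet> v = (\<Sum>i<length ns. \<beta> i)"
      using e by (auto simp: inner_sum_right exposes_def intro!: sum.cong)
    moreover have "v \<in> ?V" using v prod_verts_mono[OF delta_le_top[OF S]] by auto
    ultimately show "v \<in> ?V \<inter> {x. c \<bullet> x = (\<Sum>i<length ns. \<beta> i)}" by simp
  qed
  then show "prod_face u S = prod_face u (delta_top ns) \<inter> {x. c \<bullet> x = (\<Sum>i<length ns. \<beta> i)}"
    using convex_hull_Int_supporting_hyperplane(1)[OF finite_prod_verts[OF delta_top_in] ge]
    by (simp add: prod_face_def)
  show "prod_face u (delta_top ns) \<subseteq> {x. c \<bullet> x \<ge> (\<Sum>i<length ns. \<beta> i)}"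
    using convex_hull_Int_supporting_hyperplane(2)[OF finite_prod_verts[OF delta_top_in] ge]
    by (simp add: prod_face_def)
qed

lemma polytope_prod_face: "polytope (prod_face u (delta_top ns))"
  unfolding polytope_def prod_face_def using finite_prod_verts[OF delta_top_in] by blast

text \<open>Faces of a polytope are exposed, and the label of an exposed face collects the
  minimizers of the functional in each block.\<close>

lemma face_of_prod_face:
  fixes u :: "nat \<Rightarrow> nat \<Rightarrow> 'a::euclidean_space"
  assumes F: "F face_of prod_face u (delta_top ns)" "F \<noteq> {}"
  obtains S where "S \<in> delta_faces ns" "F = prod_face u S"
proof -
  let ?P = "prod_face u (delta_top ns)"
  have "F exposed_face_of ?P"
    using F(1) exposed_face_of_polyhedron polytope_imp_polyhedron polytope_prod_face by blast
  then obtain a b where ab: "?P \<subseteq> {x. a \<bullet> x \<le> b}" "F = ?P \<inter> {x. a \<bullet> x = b}"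
    by (auto simp: exposed_face_of_def)
  define c where "c = - a"
  define \<beta> where "\<beta> i = Min ((\<lambda>j. c \<bullet> u i j) ` {0..ns ! i})" for i
  define S where "S = map (\<lambda>i. {j \<in> {0..ns ! i}. c \<bullet> u i j = \<beta> i}) [0..<length ns]"
  have nth: "S ! i = {j \<in> {0..ns ! i}. c \<bullet> u i j = \<beta> i}" if "i < length ns" for i
    using that by (simp add: S_def)
  have e: "exposes u ns S c \<beta>"
    by (auto simp: exposes_def nth \<beta>_def)
  have "\<beta> i \<in> (\<lambda>j. c \<bullet> u i j) ` {0..ns ! i}" for i
    unfolding \<beta>_def by (intro Min_in) auto
  then have S: "S \<in> delta_faces ns"
    by (force simp: delta_faces_def nth S_def)
  have ne: "prod_face u S \<noteq> {}"
    using prod_verts_nonempty[OF S] by (simp add: prod_face_def)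
  obtain x where x: "x \<in> F" using F(2) by auto
  obtain y where y: "y \<in> prod_face u S" using ne by auto
  have "c \<bullet> x \<ge> (\<Sum>i<length ns. \<beta> i)" "c \<bullet> y = (\<Sum>i<length ns. \<beta> i)" "y \<in> ?P"
    using exposes_face[OF S e] x y ab(2) by auto
  moreover have "c \<bullet> y \<ge> - b" "c \<bullet> x = - b"
    using ab x \<open>y \<in> ?P\<close> by (auto simp: c_def)
  ultimately have "(\<Sum>i<length ns. \<beta> i) = - b" by simp
  then have "F = prod_face u S"
    using exposes_face(1)[OF S e] ab(2) by (auto simp: c_def)
  then show ?thesis using that S by blast
qed

text \<open>Each vertex differs from a fixed one by at most one difference vector per block, and
  block i offers only card (S ! i) - 1 of them.\<close>

lemma aff_dim_prod_face_le:
  fixes u :: "nat \<Rightarrow> nat \<Rightarrow> 'a::euclidean_space"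
  assumes S: "S \<in> delta_faces ns"
  shows "aff_dim (prod_face u S) \<le> delta_face_dim S"
proof -
  have len: "length S = length ns" using length_delta_face[OF S] .
  have "\<forall>i<length ns. \<exists>j. j \<in> S ! i" using delta_faces_finite_nth(2)[OF S] by blast
  then obtain o' where o': "\<And>i. i < length ns \<Longrightarrow> o' i \<in> S ! i" by metis
  define v0 where "v0 = (\<Sum>i<length ns. u i (o' i))"
  define D where "D = (\<Union>i<length ns. (\<lambda>j. u i j - u i (o' i)) ` (S ! i - {o' i}))"
  have fin: "finite D"
    using delta_faces_finite_nth(1)[OF S] by (auto simp: D_def)
  have sub: "prod_verts u S \<subseteq> (+) v0 ` span D"
  proof
    fix v assume "v \<in> prod_verts u S"
    then obtain a where a: "\<forall>i<length ns. a i \<in> S ! i" "v = (\<Sum>i<length ns. u i (a i))"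
      by (auto simp: prod_verts_iff len)
    have "u i (a i) - u i (o' i) \<in> span D" if "i < length ns" for i
      using a(1) that by (cases "a i = o' i") (auto simp: D_def span_zero intro!: span_base)
    then have "(\<Sum>i<length ns. u i (a i) - u i (o' i)) \<in> span D"
      by (intro span_sum) auto
    moreover have "v = v0 + (\<Sum>i<length ns. u i (a i) - u i (o' i))"
      by (simp add: a v0_def sum_subtractf)
    ultimately show "v \<in> (+) v0 ` span D" by blast
  qed
  have "aff_dim (prod_face u S) \<le> aff_dim ((+) v0 ` span D)"
    unfolding prod_face_def aff_dim_convex_hull by (rule aff_dim_subset[OF sub])
  also have "\<dots> = int (dim D)"
    by (simp add: aff_dim_translation_eq aff_dim_subspace)
  also have "dim D \<le> card D" using fin by (rule dim_le_card')
  also have "card D \<le> (\<Sum>i<length ns. card ((\<lambda>j. u i j - u i (o' i)) ` (S ! i - {o' i})))"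
    unfolding D_def by (intro card_UN_le) simp
  also have "\<dots> \<le> (\<Sum>i<length ns. card (S ! i) - 1)"
  proof (rule sum_mono)
    fix i assume "i \<in> {..<length ns}"
    then have i: "i < length ns" by simp
    have "card ((\<lambda>j. u i j - u i (o' i)) ` (S ! i - {o' i})) \<le> card (S ! i - {o' i})"
      using delta_faces_finite_nth(1)[OF S i] by (intro card_image_le) simp
    then show "card ((\<lambda>j. u i j - u i (o' i)) ` (S ! i - {o' i})) \<le> card (S ! i) - 1"
      using o'[OF i] by simp
  qed
  finally show ?thesis using delta_face_dim_nat[OF S] by simp
qed

text \<open>Exposing functionals turn the labels of dimension at most k into faces with the right
  inclusions. It then remains to exclude that a larger label gives a face of affine dimension at
  most k.\<close>

lemma PSN_prod_face:
  fixes u :: "nat \<Rightarrow> nat \<Rightarrow> 'a::euclidean_space"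
  assumes e: "\<And>S. S \<in> delta_skel k ns \<Longrightarrow> \<exists>c \<beta>. exposes u ns S c \<beta>"
  shows "PSN k ns (prod_face u (delta_top ns))"
proof -
  let ?P = "prod_face u (delta_top ns)"
  have skelD: "S \<in> delta_faces ns" "delta_face_dim S \<le> k" if "S \<in> delta_skel k ns" for S
    using that by (auto simp: delta_skel_def)
  have face: "prod_face u S face_of ?P" if "S \<in> delta_skel k ns" for S
  proof -
    obtain c \<beta> where "exposes u ns S c \<beta>" using e[OF \<open>S \<in> _\<close>] by auto
    note * = exposes_face[OF skelD(1)[OF that] this]
    show ?thesis
      unfolding *(1) using *(2) 
      by (intro face_of_Int_supporting_hyperplane_ge) (auto simp: prod_face_def)
  qed
  have ne: "prod_face u S \<noteq> {}" if "S \<in> delta_faces ns" for S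
    using prod_verts_nonempty[OF that] by (simp add: prod_face_def)
  have le: "delta_le S T" if ST: "S \<in> delta_faces ns" "T \<in> delta_skel k ns" "prod_face u S \<subseteq> prod_face u T" for S T
  proof -
    obtain c \<beta> where cb: "exposes u ns T c \<beta>" using e[OF ST(2)] by auto
    have len: "length S = length ns" "length T = length ns"
      using length_delta_face ST(1) skelD(1)[OF ST(2)] by auto
    have "\<forall>i<length ns. \<exists>j. j \<in> S ! i" using delta_faces_finite_nth(2)[OF ST(1)] by blast
    then obtain o' where o': "\<And>i. i < length ns \<Longrightarrow> o' i \<in> S ! i" by metis
    have "j \<in> T ! i" if i: "i < length ns" and j: "j \<in> S ! i" for i j
    proof -
      define a where "a = o'(i := j)"
      have a: "a l \<in> S ! l" if "l < length ns" for l using o' that j by (auto simp: a_def)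
      then have al: "a l \<le> ns ! l" if "l < length ns" for l
        using delta_faces_finite_nth(4)[OF ST(1)] that by fastforce
      define v where "v = (\<Sum>l<length ns. u l (a l))"
      have "v \<in> prod_verts u S" using a by (auto simp: prod_verts_iff v_def len)
      then have "v \<in> prod_face u S" unfolding prod_face_def by (rule hull_inc)
      then have "c \<bullet> v = (\<Sum>l<length ns. \<beta> l)"
        using ST(3) exposes_face(1)[OF skelD(1)[OF ST(2)] cb] by auto
      then have "(\<Sum>l<length ns. \<beta> l) = (\<Sum>l<length ns. c \<bullet> u l (a l))"
        by (simp add: v_def inner_sum_right)
      then have "\<beta> i = c \<bullet> u i (a i)"
        by (rule sum_mono_inv) (use cb al i in \<open>auto simp: exposes_def\<close>)
      then have "c \<bullet> u i (a i) = \<beta> i" ..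
      then show ?thesis using cb al[OF i] i by (auto simp: exposes_def a_def)
    qed
    then show ?thesis by (auto simp: delta_le_def len)
  qed
  \<comment> \<open>A label of dimension above k need not give a face, so the dimension is known to
    grow strictly only while the smaller label is in the k-skeleton. Hence the cap at k + 1, which
    already keeps larger labels out of the k-skeleton.\<close>
  have dim_ge: "aff_dim (prod_face u S) \<ge> min (int d) (k + 1)"
    if "S \<in> delta_faces ns" "delta_face_dim S = int d" for S d
    using that
  proof (induction d arbitrary: S)
    case 0
    then have "aff_dim (prod_face u S) \<noteq> -1" using ne[OF 0(1)] by (simp add: aff_dim_empty)
    then show ?case using aff_dim_geq[of "prod_face u S"] by linarith
  next
    case (Suc d)
    obtain S' where S': "S' \<in> delta_faces ns" "delta_le S' S" "S' \<noteq> S"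
      "delta_face_dim S' = int d"
      using delta_face_reduce[OF Suc.prems(1)] Suc.prems(2) by force
    note IH = Suc.IH[OF S'(1,4)]
    have sub: "prod_face u S' \<subseteq> prod_face u S" by (rule prod_face_mono[OF S'(2)])
    show ?case
    proof (cases "int d \<le> k")
      case True
      then have sk: "S' \<in> delta_skel k ns" using S' by (simp add: delta_skel_def)
      have "prod_face u S' face_of prod_face u S"
        using face[OF sk] sub prod_face_mono[OF delta_le_top[OF Suc.prems(1)]] by (rule face_of_subset)
      moreover have "prod_face u S' \<noteq> prod_face u S"
        using le[OF Suc.prems(1) sk] S'(2,3) delta_le_antisym by auto
      ultimately have "aff_dim (prod_face u S') < aff_dim (prod_face u S)"
        by (intro face_of_aff_dim_lt) (auto simp: prod_face_def)
      then show ?thesis using IH by auto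
    next
      case False
      then show ?thesis using IH aff_dim_subset[OF sub] by auto
    qed
  qed
  have bij: "bij_betw (prod_face u) (delta_skel k ns) (skel k ?P)"
    unfolding bij_betw_def
  proof
    show "inj_on (prod_face u) (delta_skel k ns)"
      by (intro inj_onI) (metis delta_le_antisym le order_refl skelD(1))
    show "prod_face u ` delta_skel k ns = skel k ?P"
    proof (intro equalityI subsetI)
      fix F assume "F \<in> prod_face u ` delta_skel k ns"
      then obtain S where S: "S \<in> delta_skel k ns" "F = prod_face u S" by auto
      then show "F \<in> skel k ?P"
        using face[OF S(1)] ne skelD[OF S(1)] aff_dim_prod_face_le[OF skelD(1)[OF S(1)], of u]
        by (simp add: skel_def)
    next
      fix F assume F: "F \<in> skel k ?P"
      then obtain S where S: "S \<in> delta_faces ns" "F = prod_face u S"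
        by (auto simp: skel_def elim: face_of_prod_face)
      obtain d where d: "delta_face_dim S = int d" using delta_face_dim_nat[OF S(1)] by blast
      have "min (int d) (k + 1) \<le> k" using dim_ge[OF S(1) d] F S(2) by (simp add: skel_def)
      then have "S \<in> delta_skel k ns" using S(1) d by (simp add: delta_skel_def)
      then show "F \<in> prod_face u ` delta_skel k ns" using S(2) by blast
    qed
  qed
  define g where "g = the_inv_into (delta_skel k ns) (prod_face u)"
  have g: "bij_betw g (skel k ?P) (delta_skel k ns)"
    unfolding g_def by (rule bij_betw_the_inv_into[OF bij])
  have pg: "prod_face u (g F) = F" if "F \<in> skel k ?P" for F
    using that bij unfolding g_def bij_betw_def by (metis f_the_inv_into_f)
  have "F \<subseteq> G \<longleftrightarrow> delta_le (g F) (g G)" if FG: "F \<in> skel k ?P" "G \<in> skel k ?P" for F G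
  proof -
    have "g F \<in> delta_skel k ns" "g G \<in> delta_skel k ns" using g FG by (auto simp: bij_betw_def)
    then have "prod_face u (g F) \<subseteq> prod_face u (g G) \<longleftrightarrow> delta_le (g F) (g G)"
      using le skelD(1) prod_face_mono by blast
    then show ?thesis by (simp add: pg FG)
  qed
  then show ?thesis
    unfolding PSN_def skel_equiv_delta_def using g polytope_prod_face by blast
qed

section \<open>Projected products of simplices on moment curves\<close>

lemma dim_Int_hyperplanes:
  fixes T :: "'a::euclidean_space set"
  assumes "subspace T" "finite V"
  shows "dim T \<le> dim (T \<inter> {x. \<forall>v\<in>V. v \<bullet> x = 0}) + card V"
  using assms(2)
proof (induction V)
  case (insert v V)
  let ?U = "T \<inter> {x. \<forall>v\<in>V. v \<bullet> x = 0}" and ?H = "{x. v \<bullet> x = 0}"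
  have "subspace {x. \<forall>v\<in>V. v \<bullet> x = 0}"
    unfolding subspace_def by (simp add: inner_add_right)
  then have subU: "subspace ?U" by (rule subspace_inter[OF assms(1)])
  have subH: "subspace ?H" by (rule subspace_hyperplane)
  have "dim {x + y |x y. x \<in> ?U \<and> y \<in> ?H} + dim (?U \<inter> ?H) = dim ?U + dim ?H"
    by (rule dim_sums_Int[OF subU subH])
  moreover have "dim {x + y |x y. x \<in> ?U \<and> y \<in> ?H} \<le> DIM('a)"
    by (rule dim_subset_UNIV)
  moreover have "DIM('a) \<le> dim ?H + 1"
    by (cases "v = 0") (simp_all add: dim_hyperplane)
  ultimately have "dim ?U \<le> dim (?U \<inter> ?H) + 1" by linarith
  moreover have "?U \<inter> ?H = T \<inter> {x. \<forall>w\<in>insert v V. w \<bullet> x = 0}" by auto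
  ultimately have "dim ?U \<le> dim (T \<inter> {x. \<forall>w\<in>insert v V. w \<bullet> x = 0}) + 1" by simp
  then show ?case using insert by simp
qed simp

definition moment_curve :: "nat \<Rightarrow> nat \<Rightarrow> nat \<Rightarrow> real \<Rightarrow> 'a::euclidean_space" where
  "moment_curve r k i t = t *\<^sub>R bvec i + (\<Sum>j<2*k+1. t ^ (j + 2) *\<^sub>R bvec (r + j))"

definition moment_deriv :: "nat \<Rightarrow> nat \<Rightarrow> nat \<Rightarrow> real \<Rightarrow> 'a::euclidean_space" where
  "moment_deriv r k i t = bvec i + (\<Sum>j<2*k+1. (real (j + 2) * t ^ (j + 1)) *\<^sub>R bvec (r + j))"

text \<open>The part of c along the curve that is common to all blocks. The affine part depends on
  the block and disappears in the second derivative.\<close>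

definition moment_poly :: "nat \<Rightarrow> nat \<Rightarrow> 'a::euclidean_space \<Rightarrow> real poly" where
  "moment_poly r k c = (\<Sum>j<2*k+1. Polynomial.monom (c \<bullet> bvec (r + j)) (j + 2))"

lemma moment_poly_uminus: "moment_poly r k (- c) = - moment_poly r k c"
  by (simp add: moment_poly_def Polynomial.minus_monom[symmetric] sum_negf)

lemma poly_moment_poly:
  "poly (moment_poly r k c + [:b, c \<bullet> bvec i:]) t = c \<bullet> moment_curve r k i t + b"
  by (simp add: moment_poly_def moment_curve_def poly_sum Polynomial.poly_monom inner_add_right inner_sum_right
      algebra_simps)

lemma pderiv_sum': "pderiv (\<Sum>x\<in>A. f x) = (\<Sum>x\<in>A. pderiv (f x))"
  by (induction A rule: infinite_finite_induct) (simp_all add: pderiv_add)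

lemma poly_pderiv_moment_poly:
  "poly (pderiv (moment_poly r k c + [:b, c \<bullet> bvec i:])) t = c \<bullet> moment_deriv r k i t"
  by (simp add: moment_poly_def moment_deriv_def poly_sum Polynomial.poly_monom inner_add_right inner_sum_right
      pderiv_add pderiv_sum' Polynomial.pderiv_monom pderiv_pCons algebra_simps)

lemma coeff_moment_poly:
  "Polynomial.coeff (moment_poly r k c) (j + 2) = (if j < 2*k+1 then c \<bullet> bvec (r + j) else 0)"
proof -
  have "Polynomial.coeff (moment_poly r k c) (j + 2) = (\<Sum>l<2*k+1. if l = j then c \<bullet> bvec (r + l) else 0)"
    unfolding moment_poly_def coeff_sum by (intro sum.cong) auto
  then show ?thesis by (simp add: sum.delta)
qed

lemma coeff_pderiv_pderiv: "Polynomial.coeff (pderiv (pderiv p)) n = of_nat (n + 1) * of_nat (n + 2) * Polynomial.coeff p (n + 2)"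
  by (simp add: coeff_pderiv algebra_simps)

text \<open>Block i starts at i (N + 1) with N = \<open>sum_list ns\<close>. No entry of ns exceeds
  N, so the blocks of nodes lie in disjoint intervals.\<close>

definition node :: "nat list \<Rightarrow> nat \<Rightarrow> nat \<Rightarrow> real" where
  "node ns i j = real (i * Suc (sum_list ns) + j)"

lemma inj_node: "inj (node ns i)"
  by (auto simp: inj_on_def node_def)

lemma node_less:
  assumes "i < j" "i < length ns"
  shows "node ns i (ns ! i) < node ns j 0"
proof -
  have "i * Suc (sum_list ns) + ns ! i < Suc i * Suc (sum_list ns)"
    using elem_le_sum_list[OF assms(2)] by simp
  also have "\<dots> \<le> j * Suc (sum_list ns)" using assms(1) by (intro mult_le_mono1) simp
  finally show ?thesis unfolding node_def of_nat_less_iff add_0_right .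
qed

text \<open>Subtracting the point of index 0 puts one vertex of every simplex at the origin, so that
  a linear map can produce the points; it only shifts the block minima.\<close>

lemma exposes_moment_curve:
  fixes ns :: "nat list"
  defines "r \<equiv> length ns"
  assumes D: "2 * k + r + 1 \<le> DIM('a)" and S: "S \<in> delta_skel (int k) ns"
  shows "\<exists>c \<beta>. exposes (\<lambda>i j. moment_curve r k i (node ns i j) - moment_curve r k i (node ns i 0) :: 'a::euclidean_space) ns S c \<beta>"
proof -
  let ?m = "moment_curve r k :: nat \<Rightarrow> real \<Rightarrow> 'a" and ?d = "moment_deriv r k :: nat \<Rightarrow> real \<Rightarrow> 'a"
  let ?x = "node ns"
  have Sf: "S \<in> delta_faces ns" using S by (simp add: delta_skel_def)
  define K where "K = (\<Sum>i<r. card (S ! i) - 1)"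
  have "delta_face_dim S = int K" unfolding K_def r_def by (rule delta_face_dim_nat[OF Sf])
  then have Kk: "K \<le> k" using S by (simp add: delta_skel_def)
  note fin = delta_faces_finite_nth[OF Sf, folded r_def]
  have "\<forall>i<r. \<exists>j. j \<in> S ! i" using fin(2) by blast
  then obtain o' where o': "\<And>i. i < r \<Longrightarrow> o' i \<in> S ! i" by metis
  \<comment> \<open>V1 demands a critical point of \<open>f i\<close> at each node of
    \<open>S ! i\<close>, which is at most K + r equations. V2 demands equal values at these nodes,
    at most K equations; the common value is absorbed by the constant term of
    \<open>f i\<close>.\<close>
  define V1 where "V1 = (\<Union>i<r. (\<lambda>j. ?d i (?x i j)) ` (S ! i))"
  define V2 where "V2 = (\<Union>i<r. (\<lambda>j. ?m i (?x i j) - ?m i (?x i (o' i))) ` (S ! i - {o' i}))"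
  have finV: "finite V1" "finite V2" using fin(1) by (auto simp: V1_def V2_def)
  have "card V1 \<le> (\<Sum>i<r. card ((\<lambda>j. ?d i (?x i j)) ` (S ! i)))"
    unfolding V1_def by (intro card_UN_le) simp
  also have "\<dots> \<le> (\<Sum>i<r. card (S ! i) - 1 + 1)"
  proof (intro sum_mono)
    fix i assume "i \<in> {..<r}"
    then have i: "i < r" by simp
    show "card ((\<lambda>j. ?d i (?x i j)) ` (S ! i)) \<le> card (S ! i) - 1 + 1"
      using card_image_le[OF fin(1)[OF i]] fin(3)[OF i] by simp
  qed
  also have "\<dots> = K + r" by (simp only: sum.distrib K_def) simp
  finally have c1: "card V1 \<le> K + r" .
  have "card V2 \<le> (\<Sum>i<r. card ((\<lambda>j. ?m i (?x i j) - ?m i (?x i (o' i))) ` (S ! i - {o' i})))"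
    unfolding V2_def by (intro card_UN_le) simp
  also have "\<dots> \<le> (\<Sum>i<r. card (S ! i) - 1)"
  proof (intro sum_mono)
    fix i assume "i \<in> {..<r}"
    then have i: "i < r" by simp
    have "card ((\<lambda>j. ?m i (?x i j) - ?m i (?x i (o' i))) ` (S ! i - {o' i})) \<le> card (S ! i - {o' i})"
      using fin(1)[OF i] by (intro card_image_le) simp
    then show "card ((\<lambda>j. ?m i (?x i j) - ?m i (?x i (o' i))) ` (S ! i - {o' i})) \<le> card (S ! i) - 1"
      using o'[OF i] by simp
  qed
  finally have c2: "card V2 \<le> K" by (simp add: K_def)
  have mD: "r + 2 * K < DIM('a)" using D Kk by simp
  \<comment> \<open>The dimension r + 2K + 1 exceeds the number of equations by one. Cutting off the
    coordinates of the powers beyond 2K + 2 keeps the degree of the second derivative within 2K also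
    when K < k.\<close>
  let ?T = "coord_space (r + 2 * K) :: 'a set"
  have "dim ?T \<le> dim (?T \<inter> {x. \<forall>v\<in>V1 \<union> V2. v \<bullet> x = 0}) + card (V1 \<union> V2)"
    using finV by (intro dim_Int_hyperplanes subspace_coord_space) auto
  moreover have "card (V1 \<union> V2) \<le> r + 2 * K" using card_Un_le[of V1 V2] c1 c2 by simp
  ultimately have "0 < dim (?T \<inter> {x. \<forall>v\<in>V1 \<union> V2. v \<bullet> x = 0})"
    using dim_coord_space[OF mD] by linarith
  moreover have "dim X = 0" if "X \<subseteq> {0}" for X :: "'a set"
    using that by (simp only: dim_eq_0)
  ultimately have "\<not> ?T \<inter> {x. \<forall>v\<in>V1 \<union> V2. v \<bullet> x = 0} \<subseteq> {0}"
    by force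
  then obtain c0 where c0: "c0 \<in> ?T" "c0 \<noteq> 0" "\<And>v. v \<in> V1 \<union> V2 \<Longrightarrow> v \<bullet> c0 = 0" by auto
  have hi: "c0 \<bullet> bvec (r + j) = 0" if "2 * K < j" "j < 2 * k + 1" for j
  proof -
    have "c0 \<bullet> bvec (r + j) = of_coords (r + 2 * K) (to_coords (r + 2 * K) c0) \<bullet> (bvec (r + j) :: 'a)"
      using of_coords_to_coords[OF mD c0(1)] by simp
    also have "\<dots> = 0"
      using that D mD unfolding of_coords_def inner_sum_left by (intro sum.neutral) (auto simp: inner_bvec)
    finally show ?thesis .
  qed
  have orth1: "c0 \<bullet> ?d i (?x i j) = 0" if "i < r" "j \<in> S ! i" for i j
    using c0(3)[of "?d i (?x i j)"] that by (auto simp: V1_def inner_commute)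
  have orth2: "c0 \<bullet> ?m i (?x i j) = c0 \<bullet> ?m i (?x i (o' i))" if "i < r" "j \<in> S ! i" for i j
  proof (cases "j = o' i")
    case False
    then have "(?m i (?x i j) - ?m i (?x i (o' i))) \<bullet> c0 = 0"
      using that by (intro c0(3)) (auto simp: V2_def)
    then show ?thesis by (simp add: inner_diff_left) (simp add: inner_commute)
  qed simp
  let ?q = "\<lambda>c::'a. pderiv (pderiv (moment_poly r k c))"
  \<comment> \<open>If the common second derivative vanished, each \<open>f i\<close> would be
    affine with a critical point, hence of slope 0, and all coordinates of c0 would vanish.\<close>
  have "?q c0 \<noteq> 0"
  proof
    assume "?q c0 = 0"
    then have "Polynomial.coeff (?q c0) n = 0" for n by simp
    then have z: "c0 \<bullet> bvec (r + j) = 0" if "j < 2 * k + 1" for j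
      using that coeff_moment_poly[of r k c0 j] unfolding coeff_pderiv_pderiv by auto
    then have "c0 \<bullet> ?d i t = c0 \<bullet> bvec i" for i t
      by (simp add: moment_deriv_def inner_add_right inner_sum_right)
    then have "c0 \<bullet> bvec i = 0" if "i < r" for i using orth1[OF that o'[OF that]] by simp
    then have "c0 \<bullet> bvec i = 0" if "i \<le> r + 2 * K" for i
      using z[of "i - r"] that Kk by (cases "i < r") auto
    then have "to_coords (r + 2 * K) c0 = (\<lambda>_. 0)" by (auto simp: to_coords_def)
    then have "c0 = 0" using of_coords_to_coords[OF mD c0(1)] by (simp add: of_coords_def)
    then show False using c0(2) by simp
  qed
  \<comment> \<open>The equations are homogeneous, so the sign of the solution is free.\<close>
  then have "lead_coeff (?q c0) > 0 \<or> lead_coeff (?q (- c0)) > 0"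
    by (simp add: moment_poly_uminus pderiv_minus) (metis leading_coeff_0_iff linorder_neqE_linordered_idom)
  then obtain c where lead: "lead_coeff (?q c) > 0" and cc: "c = c0 \<or> c = - c0" by auto
  have o1: "c \<bullet> ?d i (?x i j) = 0" if "i < r" "j \<in> S ! i" for i j
    using orth1[OF that] cc by auto
  have o2: "c \<bullet> ?m i (?x i j) = c \<bullet> ?m i (?x i (o' i))" if "i < r" "j \<in> S ! i" for i j
    using orth2[OF that] cc by auto
  have hi': "c \<bullet> bvec (r + j) = 0" if "2 * K < j" "j < 2 * k + 1" for j
    using hi[OF that] cc by auto
  define f where "f i = moment_poly r k c + [:- (c \<bullet> ?m i (?x i (o' i))), c \<bullet> bvec i:]" for i
  have fval: "poly (f i) t = c \<bullet> ?m i t - c \<bullet> ?m i (?x i (o' i))" for i t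
    by (simp only: f_def poly_moment_poly diff_conv_add_uminus)
  have fder: "poly (pderiv (f i)) t = c \<bullet> ?d i t" for i t
    by (simp only: f_def poly_pderiv_moment_poly)
  have deg: "degree (?q c) \<le> 2 * K"
  proof (rule degree_le, intro allI impI)
    fix n assume "2 * K < n"
    then show "Polynomial.coeff (?q c) n = 0"
      unfolding coeff_pderiv_pderiv coeff_moment_poly using hi'[of n] by auto
  qed
  have pos: "poly (f i) (?x i j) > 0" if i: "i < r" and j: "j \<le> ns ! i" "j \<notin> S ! i" for i j
  proof (rule double_roots_positive[where I = "{..<r}" and S = "\<lambda>i. ?x i ` (S ! i)" and f = f and q = "?q c"
        and lo = "\<lambda>i. ?x i 0" and hi = "\<lambda>i. ?x i (ns ! i)"])
    show "?x l ` (S ! l) \<subseteq> {?x l 0..?x l (ns ! l)}" if "l \<in> {..<r}" for l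
      using fin(4)[of l] that by (auto simp: node_def)
    show "?x l (ns ! l) < ?x l' 0 \<or> ?x l' (ns ! l') < ?x l 0"
      if "l \<in> {..<r}" "l' \<in> {..<r}" "l \<noteq> l'" for l l'
      using node_less[of l l' ns] node_less[of l' l ns] that by (auto simp: r_def neq_iff)
    show "pderiv (pderiv (f l)) = ?q c" for l
      by (simp add: f_def pderiv_add pderiv_pCons)
    have "card (?x l ` (S ! l)) = card (S ! l)" for l
      using inj_node by (intro card_image) (auto intro: inj_on_subset)
    then show "degree (?q c) \<le> (\<Sum>l\<in>{..<r}. 2 * (card (?x l ` (S ! l)) - 1))"
      using deg by (simp add: K_def sum_distrib_left)
    show "?x i j \<notin> ?x i ` (S ! i)" using j(2) inj_node[of ns i] by (auto simp: inj_def)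
    show "?x i j \<in> {?x i 0..?x i (ns ! i)}" using j(1) by (auto simp: node_def)
    show "lead_coeff (?q c) > 0" by (rule lead)
  qed (use fin i o1 o2 in \<open>auto simp: fval fder\<close>)
  define \<beta> where "\<beta> i = c \<bullet> ?m i (?x i (o' i)) - c \<bullet> ?m i (?x i 0)" for i
  have "exposes (\<lambda>i j. ?m i (?x i j) - ?m i (?x i 0)) ns S c \<beta>"
    unfolding exposes_def
  proof (intro allI impI)
    fix i j assume ij: "i < length ns" "j \<le> ns ! i"
    then have i: "i < r" by (simp add: r_def)
    show "\<beta> i \<le> c \<bullet> (?m i (?x i j) - ?m i (?x i 0)) \<and>
      (c \<bullet> (?m i (?x i j) - ?m i (?x i 0)) = \<beta> i \<longleftrightarrow> j \<in> S ! i)"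
      using pos[OF i ij(2)] o2[OF i, of j]
      by (cases "j \<in> S ! i") (auto simp: \<beta>_def fval inner_diff_right)
  qed
  then show ?thesis by blast
qed

lemma exposes_product_of_simplices:
  fixes e :: "nat \<times> nat \<Rightarrow> 'b::euclidean_space"
  assumes e: "inj_on e (Sigma {..<length ns} (\<lambda>i. {1..ns ! i}))" "e ` Sigma {..<length ns} (\<lambda>i. {1..ns ! i}) \<subseteq> Basis"
    and S: "S \<in> delta_faces ns"
  shows "\<exists>c \<beta>. exposes (\<lambda>i j. if j = 0 then 0 else e (i, j)) ns S c \<beta>"
proof -
  let ?A = "Sigma {..<length ns} (\<lambda>i. {1..ns ! i})"
  \<comment> \<open>Vertex 0 of each block is the origin and has value 0 under every functional. If
    it belongs to the face, the vertices off the face are raised to 1; otherwise those on the face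
    are lowered to -1.\<close>
  define w :: "nat \<Rightarrow> nat \<Rightarrow> real" where
    "w i j = (if 0 \<in> S ! i then (if j \<in> S ! i then 0 else 1) else (if j \<in> S ! i then - 1 else 0))" for i j
  define c where "c = (\<Sum>p\<in>?A. w (fst p) (snd p) *\<^sub>R e p)"
  have ce: "c \<bullet> e p = w (fst p) (snd p)" if p: "p \<in> ?A" for p
  proof -
    have "c \<bullet> e p = (\<Sum>p'\<in>?A. if p' = p then w (fst p) (snd p) else 0)"
      unfolding c_def inner_sum_left
    proof (rule sum.cong[OF refl])
      fix p' assume p': "p' \<in> ?A"
      then have "e p' \<in> Basis" "e p \<in> Basis" using e(2) p by auto
      moreover have "e p' = e p \<longleftrightarrow> p' = p" using e(1) p p' by (auto dest: inj_onD)
      ultimately show "(w (fst p') (snd p') *\<^sub>R e p') \<bullet> e p = (if p' = p then w (fst p) (snd p) else 0)"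
        by (simp add: inner_Basis)
    qed
    also have "\<dots> = w (fst p) (snd p)" using p by (simp add: sum.delta)
    finally show ?thesis .
  qed
  define \<beta> where "\<beta> i = (if 0 \<in> S ! i then 0 else - 1 :: real)" for i
  have "exposes (\<lambda>i j. if j = 0 then 0 else e (i, j)) ns S c \<beta>"
    unfolding exposes_def
  proof (intro allI impI)
    fix i j assume ij: "i < length ns" "j \<le> ns ! i"
    show "\<beta> i \<le> c \<bullet> (if j = 0 then 0 else e (i, j)) \<and>
       (c \<bullet> (if j = 0 then 0 else e (i, j)) = \<beta> i \<longleftrightarrow> j \<in> S ! i)"
    proof (cases "j = 0")
      case False
      then have "c \<bullet> e (i, j) = w i j" using ce[of "(i, j)"] ij by auto
      then show ?thesis using False by (auto simp: w_def \<beta>_def)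
    qed (auto simp: \<beta>_def)
  qed
  then show ?thesis by blast
qed

lemma linear_image_prod_face:
  assumes "linear f" "\<And>i j. i < length S \<Longrightarrow> j \<in> S ! i \<Longrightarrow> f (u i j) = v i j"
  shows "f ` prod_face u S = prod_face v S"
proof -
  have "f ` prod_verts u S = prod_verts v S"
    unfolding prod_verts_def image_image
    by (intro image_cong refl) (auto simp: linear_sum[OF assms(1)] assms(2) PiE_def Pi_def intro!: sum.cong)
  then show ?thesis
    by (simp add: prod_face_def convex_hull_linear_image[OF assms(1)])
qed

text \<open>Q is the product of the simplices with vertices 0 and distinct basis vectors
  \<open>e (i, j)\<close>. A linear map is free on basis vectors, so f can send them to the shifted
  points of the moment curves.\<close>

theorem PPSN_exists:
  fixes ns :: "nat list"
  assumes "2 * k + length ns + 1 \<le> DIM('a)" "sum_list ns \<le> DIM('b)"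
  obtains P :: "'a::euclidean_space set" and Q :: "'b::euclidean_space set"
  where "PPSN_via (int k) ns Q P" "aff_dim P \<le> int (2 * k + length ns + 1)"
proof -
  let ?r = "length ns"
  let ?A = "Sigma {..<?r} (\<lambda>i. {1..ns ! i})"
  have "card ?A = sum_list ns"
    by (simp add: sum_list_sum_nth atLeast0LessThan)
  then obtain e :: "nat \<times> nat \<Rightarrow> 'b" where e: "inj_on e ?A" "e ` ?A \<subseteq> Basis"
    using card_le_inj[of ?A "Basis :: 'b set"] assms(2) by auto
  define u where "u i j = (if j = 0 then 0 else e (i, j))" for i j
  define v :: "nat \<Rightarrow> nat \<Rightarrow> 'a" where
    "v i j = moment_curve ?r k i (node ns i j) - moment_curve ?r k i (node ns i 0)" for i j
  define f :: "'b \<Rightarrow> 'a" where "f x = (\<Sum>p\<in>?A. (x \<bullet> e p) *\<^sub>R v (fst p) (snd p))" for x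
  have lf: "linear f"
    unfolding f_def by (intro linear_compose_sum ballI linearI)
      (simp_all add: inner_add_left scaleR_add_left)
  have fe: "f (e p) = v (fst p) (snd p)" if p: "p \<in> ?A" for p
  proof -
    have "f (e p) = (\<Sum>p'\<in>?A. if p' = p then v (fst p) (snd p) else 0)"
      unfolding f_def
    proof (rule sum.cong[OF refl])
      fix p' assume p': "p' \<in> ?A"
      then have "e p' \<in> Basis" "e p \<in> Basis" using e(2) p by auto
      moreover have "e p = e p' \<longleftrightarrow> p' = p" using e(1) p p' by (auto dest: inj_onD)
      ultimately show "(e p \<bullet> e p') *\<^sub>R v (fst p') (snd p') = (if p' = p then v (fst p) (snd p) else 0)"
        by (simp add: inner_Basis)
    qed
    also have "\<dots> = v (fst p) (snd p)" using p by (simp add: sum.delta)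
    finally show ?thesis .
  qed
  have fu: "f (u i j) = v i j" if "i < ?r" "j \<le> ns ! i" for i j
    using fe[of "(i, j)"] that by (auto simp: u_def v_def linear_0[OF lf])
  let ?Q = "prod_face u (delta_top ns)" and ?P = "prod_face v (delta_top ns)"
  have fQ: "?P = f ` ?Q"
    by (rule linear_image_prod_face[OF lf, symmetric]) (auto simp: delta_top_def fu)
  have "PSN (int k) ns ?P"
    unfolding v_def by (intro PSN_prod_face exposes_moment_curve) (use assms(1) in simp_all)
  moreover have "PSN l ns ?Q" for l
    unfolding u_def[abs_def]
    by (intro PSN_prod_face exposes_product_of_simplices[OF e]) (simp add: delta_skel_def)
  then have "comb_equiv_delta ns ?Q"
    unfolding comb_equiv_delta_def PSN_def by blast
  ultimately have "PPSN_via (int k) ns ?Q ?P"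
    unfolding PPSN_via_def using lf fQ by blast
  moreover have "aff_dim ?P \<le> int (2 * k + ?r + 1)"
  proof -
    let ?T = "coord_space (2 * k + ?r) :: 'a set"
    have b: "bvec m \<in> ?T" if "m \<le> 2 * k + ?r" for m
      using that by (auto simp: coord_space_def intro: span_base)
    have "moment_curve ?r k i t \<in> ?T" if "i < ?r" for i t
      unfolding moment_curve_def using that
      by (intro subspace_add subspace_sum subspace_scale subspace_coord_space b) auto
    then have "prod_verts v (delta_top ns) \<subseteq> ?T"
      by (auto simp: prod_verts_iff v_def delta_top_def intro!: subspace_sum subspace_diff subspace_coord_space)
    then have "aff_dim ?P \<le> aff_dim ?T"
      unfolding prod_face_def aff_dim_convex_hull by (rule aff_dim_subset)
    also have "\<dots> = int (2 * k + ?r + 1)"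
      using assms(1) by (simp add: aff_dim_subspace subspace_coord_space dim_coord_space)
    finally show ?thesis .
  qed
  ultimately show ?thesis using that by blast
qed

section \<open>Embeddings of skeleta\<close>

lemma finite_delta_faces: "finite (delta_faces ns)"
proof (rule finite_subset)
  show "delta_faces ns \<subseteq> {S. set S \<subseteq> Pow {0..sum_list ns} \<and> length S = length ns}"
  proof
    fix S assume S: "S \<in> delta_faces ns"
    have "A \<subseteq> {0..sum_list ns}" if "A \<in> set S" for A
    proof -
      obtain i where i: "i < length ns" "A = S ! i"
        using \<open>A \<in> set S\<close> length_delta_face[OF S] by (metis in_set_conv_nth)
      then show ?thesis
        using delta_faces_finite_nth(4)[OF S i(1)] elem_le_sum_list[OF i(1)] by fastforce
    qed
    then show "S \<in> {S. set S \<subseteq> Pow {0..sum_list ns} \<and> length S = length ns}"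
      using length_delta_face[OF S] by auto
  qed
qed (intro finite_lists_length_eq, simp)

lemma delta_face_dim_nonneg: "S \<in> delta_faces ns \<Longrightarrow> 0 \<le> delta_face_dim S"
  by (simp add: delta_face_dim_nat del: of_nat_sum)

lemma delta_face_dim_mono:
  assumes "S \<in> delta_faces ns" "T \<in> delta_faces ns" "delta_le S T"
  shows "delta_face_dim S \<le> delta_face_dim T"
proof -
  have "card (S ! i) \<le> card (T ! i)" if "i < length ns" for i
    using assms that delta_faces_finite_nth(1)[OF assms(2) that] length_delta_face[OF assms(1)]
    by (auto simp: delta_le_def intro: card_mono)
  then show ?thesis
    using length_delta_face[OF assms(1)] length_delta_face[OF assms(2)]
    unfolding delta_face_dim_def by (auto intro!: sum_mono diff_right_mono simp del: diff_le_eq)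
qed

section \<open>Vertices and edges of a product of simplices\<close>

definition delta_vertices :: "nat list \<Rightarrow> nat set list set" where
  "delta_vertices ns = {S \<in> delta_faces ns. delta_face_dim S = 0}"

definition delta_edges :: "nat list \<Rightarrow> nat set list set" where
  "delta_edges ns = {S \<in> delta_faces ns. delta_face_dim S = 1}"

lemma delta_vertex_card:
  assumes "v \<in> delta_vertices ns" "i < length ns"
  shows "card (v ! i) = 1"
proof -
  have v: "v \<in> delta_faces ns" "delta_face_dim v = 0" using assms by (auto simp: delta_vertices_def)
  then have "(\<Sum>i<length ns. card (v ! i) - 1) = 0"
    using delta_face_dim_nat[OF v(1)] by (simp only: of_nat_eq_0_iff)
  then have "card (v ! i) - 1 = 0" using assms(2) by simp
  then show ?thesis using delta_faces_finite_nth(3)[OF v(1) assms(2)] by simp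
qed

lemma delta_vertex_minimal:
  assumes "v \<in> delta_vertices ns" "S \<in> delta_faces ns" "delta_le S v"
  shows "S = v"
proof -
  have v: "v \<in> delta_faces ns" using assms by (auto simp: delta_vertices_def)
  have len: "length S = length ns" "length v = length ns"
    using length_delta_face assms(2) v by auto
  show ?thesis
  proof (rule nth_equalityI)
    fix i assume "i < length S"
    then have i: "i < length ns" by (simp add: len)
    obtain x where "v ! i = {x}" using delta_vertex_card[OF assms(1) i] by (auto simp: card_1_singleton_iff)
    moreover have "S ! i \<subseteq> v ! i" using assms(3) i by (simp add: delta_le_def len)
    ultimately show "S ! i = v ! i" using delta_faces_finite_nth(2)[OF assms(2) i] by auto
  qed (simp add: len)
qed

lemma delta_vertex_through:
  assumes S: "S \<in> delta_faces ns" and i: "i < length ns" and x: "x \<in> S ! i"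
  obtains v where "v \<in> delta_vertices ns" "delta_le v S" "x \<in> v ! i"
proof -
  note fin = delta_faces_finite_nth[OF S]
  have "\<forall>l<length ns. \<exists>j. j \<in> S ! l" using fin(2) by blast
  then obtain a where a: "\<And>l. l < length ns \<Longrightarrow> a l \<in> S ! l" by metis
  define v where "v = map (\<lambda>l. {if l = i then x else a l}) [0..<length ns]"
  have nth: "v ! l = {if l = i then x else a l}" if "l < length ns" for l
    using that by (simp add: v_def)
  have len: "length v = length ns" by (simp add: v_def)
  show ?thesis
  proof (rule that[of v])
    have "v \<in> delta_faces ns"
      using fin(4) a x i by (fastforce simp: delta_faces_def nth len)
    then show "v \<in> delta_vertices ns"
      by (simp add: delta_vertices_def delta_face_dim_def nth len)
    show "delta_le v S"
      using a x by (auto simp: delta_le_def nth len length_delta_face[OF S])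
    show "x \<in> v ! i" by (simp add: nth i)
  qed
qed

lemma delta_vertex_exists:
  assumes "S \<in> delta_faces ns"
  obtains v where "v \<in> delta_vertices ns" "delta_le v S"
proof (cases "length ns = 0")
  case True
  then show ?thesis using assms that[of S] delta_le_refl
    by (auto simp: delta_vertices_def delta_face_dim_def length_delta_face)
next
  case False
  then obtain x where "x \<in> S ! 0" using delta_faces_finite_nth(2)[OF assms, of 0] by auto
  then show ?thesis using delta_vertex_through[OF assms, of 0 x] False that by auto
qed

lemma delta_le_iff_vertices:
  assumes S: "S \<in> delta_faces ns" and T: "T \<in> delta_faces ns"
    and sub: "\<And>v. v \<in> delta_vertices ns \<Longrightarrow> delta_le v S \<Longrightarrow> delta_le v T"
  shows "delta_le S T"
  unfolding delta_le_def
proof (intro conjI allI impI subsetI)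
  fix i x assume "i < length S" and x: "x \<in> S ! i"
  then have i: "i < length ns" by (simp add: length_delta_face[OF S])
  obtain v where v: "v \<in> delta_vertices ns" "delta_le v S" "x \<in> v ! i"
    using delta_vertex_through[OF S i x] .
  then have "delta_le v T" using sub by blast
  then show "x \<in> T ! i" using v(3) i length_delta_face[OF T] by (auto simp: delta_le_def)
qed (use length_delta_face S T in auto)

lemma delta_edge_cases:
  assumes e: "e \<in> delta_edges ns" and v: "v \<in> delta_vertices ns" and le: "delta_le v e"
  obtains i x where "i < length ns" "x \<notin> v ! i" "x \<in> e ! i" "e = v[i := insert x (v ! i)]"
proof -
  have ef: "e \<in> delta_faces ns" "delta_face_dim e = 1" and vf: "v \<in> delta_faces ns"
    using e v by (auto simp: delta_edges_def delta_vertices_def)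
  note fin = delta_faces_finite_nth[OF ef(1)]
  have len: "length e = length ns" "length v = length ns"
    using length_delta_face ef vf by auto
  have sum1: "(\<Sum>i<length ns. card (e ! i) - 1) = 1"
    using delta_face_dim_nat[OF ef(1)] ef(2) by linarith
  have "\<exists>i<length ns. card (e ! i) - 1 \<noteq> 0"
  proof (rule ccontr)
    assume "\<not> ?thesis"
    then have "(\<Sum>i<length ns. card (e ! i) - 1) = 0" by simp
    then show False using sum1 by simp
  qed
  then obtain i where i: "i < length ns" "card (e ! i) - 1 \<noteq> 0" by auto
  have "(\<Sum>l<length ns. card (e ! l) - 1) = card (e ! i) - 1 + (\<Sum>l\<in>{..<length ns} - {i}. card (e ! l) - 1)"
    using i by (simp add: sum.remove)
  then have ci: "card (e ! i) = 2" and cl: "(\<Sum>l\<in>{..<length ns} - {i}. card (e ! l) - 1) = 0"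
    using sum1 i(2) by linarith+
  have vsub: "v ! l \<subseteq> e ! l" if "l < length ns" for l
    using le that by (simp add: delta_le_def len)
  have same: "e ! l = v ! l" if "l < length ns" "l \<noteq> i" for l
  proof -
    have "card (e ! l) - 1 = 0" using cl that by simp
    then have "card (e ! l) = card (v ! l)"
      using fin(3)[OF that(1)] delta_vertex_card[OF v that(1)] by simp
    then show ?thesis using card_subset_eq[OF fin(1)[OF that(1)] vsub[OF that(1)]] by simp
  qed
  have "card (e ! i - v ! i) = 1"
    using ci delta_vertex_card[OF v i(1)] vsub[OF i(1)] fin(1)[OF i(1)]
    by (subst card_Diff_subset) (auto intro: finite_subset)
  then obtain x where x: "e ! i - v ! i = {x}" by (auto simp: card_1_singleton_iff)
  show ?thesis
  proof (rule that[of i x])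
    show "e = v[i := insert x (v ! i)]"
    proof (rule nth_equalityI)
      fix l assume "l < length e"
      then have l: "l < length ns" by (simp add: len)
      show "e ! l = v[i := insert x (v ! i)] ! l"
        using x vsub[OF i(1)] same[OF l] l by (cases "l = i") (auto simp: len)
    qed (simp add: len)
  qed (use i x in auto)
qed

text \<open>A product of simplices is simple: an edge of S at v adds one new element x of S ! i to
  one block i, and the pairs (i, x) count the dimension.\<close>

lemma card_edges_at_vertex:
  assumes v: "v \<in> delta_vertices ns" and S: "S \<in> delta_faces ns" and le: "delta_le v S"
  shows "int (card {e \<in> delta_edges ns. delta_le v e \<and> delta_le e S}) = delta_face_dim S"
proof -
  have vf: "v \<in> delta_faces ns" "delta_face_dim v = 0" using v by (auto simp: delta_vertices_def)
  have len: "length S = length ns" "length v = length ns"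
    using length_delta_face S vf by auto
  note fin = delta_faces_finite_nth[OF S]
  have vsub: "v ! l \<subseteq> S ! l" if "l < length ns" for l
    using le that by (simp add: delta_le_def len)
  let ?A = "Sigma {..<length ns} (\<lambda>i. S ! i - v ! i)"
  let ?up = "\<lambda>(i, x). v[i := insert x (v ! i)]"
  have vcard: "card (v ! l) = 1" if "l < length ns" for l using delta_vertex_card[OF v that] .
  have vfin: "finite (v ! l)" if "l < length ns" for l using delta_faces_finite_nth(1)[OF vf(1) that] .
  have inj: "inj_on ?up ?A"
  proof (intro inj_onI)
    fix p q assume p: "p \<in> ?A" and q: "q \<in> ?A" and eq: "?up p = ?up q"
    obtain i x j y where pq: "p = (i, x)" "q = (j, y)" by (cases p, cases q) auto
    have ix: "i < length ns" "x \<notin> v ! i" and jy: "j < length ns" "y \<notin> v ! j" using p q pq by auto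
    have 1: "v[i := insert x (v ! i)] ! l = v[j := insert y (v ! j)] ! l" for l using eq pq by simp
    have "i = j"
      using 1[of i] ix jy len by (cases "i = j") auto
    moreover from this have "x = y" using 1[of i] ix jy len by auto
    ultimately show "p = q" using pq by simp
  qed
  have "?up ` ?A = {e \<in> delta_edges ns. delta_le v e \<and> delta_le e S}"
  proof (intro equalityI subsetI)
    fix e assume "e \<in> ?up ` ?A"
    then obtain i x where ix: "i < length ns" "x \<in> S ! i" "x \<notin> v ! i" "e = v[i := insert x (v ! i)]" by auto
    have "e \<in> delta_faces ns"
      using vf ix fin(4)[OF ix(1)] delta_faces_finite_nth(2,4)[OF vf(1)]
      by (auto simp: delta_faces_def nth_list_update)
    moreover have "delta_face_dim e = 1"
      unfolding ix(4) using delta_face_dim_update[OF vf(1) ix(1)] vf(2) ix(3) vfin[OF ix(1)] by simp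
    moreover have "delta_le v e" using ix len by (auto simp: delta_le_def nth_list_update)
    moreover have "delta_le e S" using ix len vsub by (auto simp: delta_le_def nth_list_update)
    ultimately show "e \<in> {e \<in> delta_edges ns. delta_le v e \<and> delta_le e S}" by (simp add: delta_edges_def)
  next
    fix e assume e: "e \<in> {e \<in> delta_edges ns. delta_le v e \<and> delta_le e S}"
    then have "e \<in> delta_edges ns" "delta_le v e" by simp_all
    then obtain i x where ix: "i < length ns" "x \<notin> v ! i" "x \<in> e ! i" "e = v[i := insert x (v ! i)]"
      using delta_edge_cases[OF _ v] by metis
    have "length e = length ns" using ix(4) len by simp
    then have "e ! i \<subseteq> S ! i" using e ix(1) by (simp add: delta_le_def)
    then have "(i, x) \<in> ?A" using ix by blast
    then show "e \<in> ?up ` ?A" using ix(4) by (intro image_eqI[of _ _ "(i, x)"]) simp_all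
  qed
  then have "card {e \<in> delta_edges ns. delta_le v e \<and> delta_le e S} = card ?A"
    using card_image[OF inj] by simp
  also have "\<dots> = (\<Sum>i<length ns. card (S ! i - v ! i))"
    using fin(1) by (subst card_SigmaI) auto
  also have "\<dots> = (\<Sum>i<length ns. card (S ! i) - 1)"
    by (intro sum.cong refl) (use vcard vsub vfin in \<open>simp add: card_Diff_subset\<close>)
  finally show ?thesis using delta_face_dim_nat[OF S] by simp
qed

text \<open>Compared with \<open>card_vertices_ge\<close>, this will show that the image of an edge
  has dimension at most 1.\<close>

lemma card_vertices_edge:
  assumes e: "e \<in> delta_edges ns"
  shows "card {v \<in> delta_vertices ns. delta_le v e} \<le> 2"
proof -
  have ef: "e \<in> delta_faces ns" using e by (simp add: delta_edges_def)
  obtain v where v: "v \<in> delta_vertices ns" "delta_le v e" using delta_vertex_exists[OF ef] .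
  then obtain i x where ix: "i < length ns" "x \<notin> v ! i" "x \<in> e ! i" "e = v[i := insert x (v ! i)]"
    using delta_edge_cases[OF e v] by blast
  have vf: "v \<in> delta_faces ns" using v by (simp add: delta_vertices_def)
  have len: "length v = length ns" using length_delta_face[OF vf] .
  have "{w \<in> delta_vertices ns. delta_le w e} \<subseteq> {v, v[i := {x}]}"
  proof
    fix w assume w: "w \<in> {w \<in> delta_vertices ns. delta_le w e}"
    then have wf: "w \<in> delta_faces ns" by (simp add: delta_vertices_def)
    have lenw: "length w = length ns" using length_delta_face[OF wf] .
    obtain y where y: "w ! i = {y}" using delta_vertex_card[of w ns i] w ix(1) by (auto simp: card_1_singleton_iff)
    have sub: "w ! l \<subseteq> e ! l" if "l < length ns" for l
      using w that by (simp add: delta_le_def lenw)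
    then consider "y = x" | "y \<in> v ! i" using y ix(1,4) len by fastforce
    then show "w \<in> {v, v[i := {x}]}"
    proof cases
      case 1
      have "delta_le w (v[i := {x}])"
        unfolding delta_le_def
      proof (intro conjI allI impI)
        fix l assume "l < length w"
        then show "w ! l \<subseteq> v[i := {x}] ! l"
          using sub[of l] 1 y ix(4) len lenw by (cases "l = i") auto
      qed (simp add: len lenw)
      moreover have "v[i := {x}] \<in> delta_vertices ns"
      proof -
        have "x \<le> ns ! i" using delta_faces_finite_nth(4)[OF ef ix(1)] ix(3) by auto
        then have "v[i := {x}] \<in> delta_faces ns"
          using vf len ix(1) by (auto simp: delta_faces_def nth_list_update)
        moreover have "delta_face_dim (v[i := {x}]) = 0"
          using delta_face_dim_update[OF vf ix(1)] delta_vertex_card[OF v(1) ix(1)] v(1)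
          by (simp add: delta_vertices_def)
        ultimately show ?thesis by (simp add: delta_vertices_def)
      qed
      ultimately show ?thesis using delta_vertex_minimal wf by blast
    next
      case 2
      have "delta_le w v"
        unfolding delta_le_def
      proof (intro conjI allI impI)
        fix l assume "l < length w"
        then show "w ! l \<subseteq> v ! l"
          using sub[of l] 2 y ix(4) len lenw by (cases "l = i") auto
      qed (simp add: len lenw)
      then show ?thesis using delta_vertex_minimal[OF v(1)] wf by blast
    qed
  qed
  then have "card {w \<in> delta_vertices ns. delta_le w e} \<le> card {v, v[i := {x}]}"
    by (intro card_mono) auto
  also have "\<dots> \<le> 2" by (simp add: card_insert_if)
  finally show ?thesis .
qed

text \<open>A face is determined by its vertices, so each step down a chain of faces to dimension 0
  loses at least one vertex, and one is left at the end.\<close>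

lemma card_vertices_ge:
  assumes "S \<in> delta_faces ns"
  shows "delta_face_dim S < int (card {v \<in> delta_vertices ns. delta_le v S})"
proof -
  have fin: "finite {v \<in> delta_vertices ns. delta_le v S}" for S
    using finite_delta_faces by (simp add: delta_vertices_def)
  have "int d < int (card {v \<in> delta_vertices ns. delta_le v S})"
    if "S \<in> delta_faces ns" "delta_face_dim S = int d" for d S
    using that
  proof (induction d arbitrary: S)
    case 0
    then show ?case using fin[of S] delta_vertex_exists[OF 0(1)] by (auto simp: card_gt_0_iff)
  next
    case (Suc d)
    obtain S' where S': "S' \<in> delta_faces ns" "delta_le S' S" "S' \<noteq> S" "delta_face_dim S' = int d"
      using delta_face_reduce[OF Suc.prems(1)] Suc.prems(2) by force
    have "\<not> {v \<in> delta_vertices ns. delta_le v S} \<subseteq> {v \<in> delta_vertices ns. delta_le v S'}"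
    proof
      assume sub: "{v \<in> delta_vertices ns. delta_le v S} \<subseteq> {v \<in> delta_vertices ns. delta_le v S'}"
      have "delta_le S S'"
        by (rule delta_le_iff_vertices[OF Suc.prems(1) S'(1)]) (use sub in blast)
      then show False using S'(2,3) delta_le_antisym by blast
    qed
    moreover have "{v \<in> delta_vertices ns. delta_le v S'} \<subseteq> {v \<in> delta_vertices ns. delta_le v S}"
      using S'(2) delta_le_trans by blast
    ultimately have "card {v \<in> delta_vertices ns. delta_le v S'} < card {v \<in> delta_vertices ns. delta_le v S}"
      by (intro psubset_card_mono fin) auto
    then show ?case using Suc.IH[OF S'(1,4)] by simp
  qed
  moreover obtain d where "delta_face_dim S = int d" using delta_face_dim_nat[OF assms] by blast
  ultimately show ?thesis using assms by metis
qed

text \<open>A graph isomorphism argument: an embedding of the \<open>k\<close>-skeleton that separates vertices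
  permutes vertices, hence (for \<open>k \<ge> 1\<close>) edges, and the dimension of a face is the degree of its
  graph, as products of simplices are simple.\<close>

lemma delta_skel_embedding:
  fixes k :: nat
  assumes h: "\<And>S. S \<in> delta_skel (int k) ns \<Longrightarrow> h S \<in> delta_faces ns"
    and emb: "\<And>S T. S \<in> delta_skel (int k) ns \<Longrightarrow> T \<in> delta_skel (int k) ns \<Longrightarrow>
      delta_le (h S) (h T) \<longleftrightarrow> delta_le S T"
    and sep: "\<And>v w S. v \<in> delta_vertices ns \<Longrightarrow> w \<in> delta_vertices ns \<Longrightarrow> S \<in> delta_faces ns \<Longrightarrow>
      delta_le S (h v) \<Longrightarrow> delta_le S (h w) \<Longrightarrow> v = w"
  shows "h ` delta_skel (int k) ns = delta_skel (int k) ns"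
    and "\<And>S. S \<in> delta_skel (int k) ns \<Longrightarrow> delta_face_dim (h S) = delta_face_dim S"
proof -
  let ?X = "delta_skel (int k) ns" and ?V = "delta_vertices ns" and ?E = "delta_edges ns"
  have VX: "?V \<subseteq> ?X" by (auto simp: delta_vertices_def delta_skel_def)
  have finX: "finite ?X" "finite ?V" "finite ?E"
    using finite_delta_faces by (simp_all add: delta_skel_def delta_vertices_def delta_edges_def)
  have Xf: "S \<in> delta_faces ns" if "S \<in> ?X" for S using that by (simp add: delta_skel_def)
  have injX: "inj_on h ?X"
    by (intro inj_onI) (metis delta_le_antisym delta_le_refl emb)
  \<comment> \<open>Choose a vertex \<open>w v\<close> below each \<open>h v\<close>. Separation
    makes w injective, hence a permutation of the finite set of vertices. Any vertex below
    \<open>h v\<close> is then some \<open>w v'\<close>, and separation gives v' = v, so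
    \<open>h v\<close> is itself a vertex.\<close>
  have "\<forall>v\<in>?V. \<exists>w. w \<in> ?V \<and> delta_le w (h v)"
    using delta_vertex_exists h VX by (metis subsetD)
  then obtain w where w: "\<And>v. v \<in> ?V \<Longrightarrow> w v \<in> ?V \<and> delta_le (w v) (h v)" by metis
  have Vf: "v \<in> delta_faces ns" if "v \<in> ?V" for v using that by (simp add: delta_vertices_def)
  have "inj_on w ?V"
    using w sep Vf by (intro inj_onI) metis
  then have wV: "w ` ?V = ?V" using finX(2) w by (intro endo_inj_surj) auto
  have hw: "h v = w v" if v: "v \<in> ?V" for v
  proof (rule delta_le_antisym)
    show "delta_le (w v) (h v)" using w v by blast
    show "delta_le (h v) (w v)"
    proof (rule delta_le_iff_vertices)
      show "h v \<in> delta_faces ns" "w v \<in> delta_faces ns" using h VX v w Vf by auto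
      fix u assume u: "u \<in> ?V" "delta_le u (h v)"
      then obtain v' where v': "v' \<in> ?V" "u = w v'" using wV by blast
      then have "v' = v" using sep[of v' v u] w u v Vf by blast
      then show "delta_le u (w v)" using v' delta_le_refl by simp
    qed
  qed
  then have hV: "h ` ?V = ?V" using wV by (simp cong: image_cong)
  have vh: "{u \<in> ?V. delta_le u (h S)} = h ` {v \<in> ?V. delta_le v S}" if "S \<in> ?X" for S
  proof (intro equalityI subsetI)
    fix u assume u: "u \<in> {u \<in> ?V. delta_le u (h S)}"
    then obtain v where v: "v \<in> ?V" "u = h v" using hV by blast
    then have "v \<in> ?X" using VX by blast
    then have "delta_le v S" using u v(2) emb[OF _ that] by blast
    then show "u \<in> h ` {v \<in> ?V. delta_le v S}" using v by blast
  next
    fix u assume "u \<in> h ` {v \<in> ?V. delta_le v S}"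
    then obtain v where v: "v \<in> ?V" "u = h v" "delta_le v S" by blast
    then have "v \<in> ?X" using VX by blast
    then have "delta_le u (h S)" using v emb[OF _ that] by blast
    moreover have "u \<in> ?V" using hV v by blast
    ultimately show "u \<in> {u \<in> ?V. delta_le u (h S)}" by simp
  qed
  have dim: "delta_face_dim (h S) = delta_face_dim S" if S: "S \<in> ?X" for S
  proof (cases "k = 0")
    \<comment> \<open>Without edges in the skeleton there is nothing to count, but S is then a
      vertex.\<close>
    case True
    then have "S \<in> ?V" using S delta_face_dim_nonneg[OF Xf[OF S]]
      by (simp add: delta_skel_def delta_vertices_def)
    moreover from this have "h S \<in> ?V" using hV by blast
    ultimately show ?thesis by (simp add: delta_vertices_def)
  next
    case False
    then have EX: "?E \<subseteq> ?X" by (auto simp: delta_edges_def delta_skel_def)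
    have "h e \<in> ?E" if e: "e \<in> ?E" for e
    proof -
      have hf: "h e \<in> delta_faces ns" using h e EX by blast
      have "card {u \<in> ?V. delta_le u (h e)} \<le> card {v \<in> ?V. delta_le v e}"
        unfolding vh[OF subsetD[OF EX e]] using finX(2) by (intro card_image_le) simp
      then have le: "delta_face_dim (h e) \<le> 1"
        using card_vertices_ge[OF hf] card_vertices_edge[OF e] by linarith
      \<comment> \<open>All vertices are already images of vertices, so injectivity keeps
        \<open>h e\<close> from being one.\<close>
      moreover have "delta_face_dim (h e) \<noteq> 0"
      proof
        assume "delta_face_dim (h e) = 0"
        then have he: "h e \<in> ?V" using hf by (simp add: delta_vertices_def)
        then obtain v where v: "v \<in> ?V" "h e = h v" using hV by blast
        then have "e = v" using injX e EX VX by (meson inj_onD subsetD)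
        then show False using e v by (simp add: delta_edges_def delta_vertices_def)
      qed
      moreover note delta_face_dim_nonneg[OF hf]
      ultimately show ?thesis using hf by (simp add: delta_edges_def)
    qed
    then have hE: "h ` ?E = ?E"
      using finX(3) EX by (intro endo_inj_surj inj_on_subset[OF injX]) auto
    obtain v where v: "v \<in> ?V" "delta_le v S" using delta_vertex_exists[OF Xf[OF S]] .
    have hv: "h v \<in> ?V" "delta_le (h v) (h S)" using hV v emb S VX by auto
    \<comment> \<open>Edges are permuted, so h carries the edges of S at v onto the edges of
      \<open>h S\<close> at \<open>h v\<close>; their numbers are the two dimensions.\<close>
    have "{e \<in> ?E. delta_le (h v) e \<and> delta_le e (h S)} = h ` {e \<in> ?E. delta_le v e \<and> delta_le e S}"
    proof (intro equalityI subsetI)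
      fix e assume e: "e \<in> {e \<in> ?E. delta_le (h v) e \<and> delta_le e (h S)}"
      then obtain e' where e': "e' \<in> ?E" "e = h e'" using hE by blast
      then have "delta_le v e'" "delta_le e' S" using e emb S VX EX v by auto
      then show "e \<in> h ` {e \<in> ?E. delta_le v e \<and> delta_le e S}" using e' by blast
    next
      fix e assume "e \<in> h ` {e \<in> ?E. delta_le v e \<and> delta_le e S}"
      then obtain e' where e': "e' \<in> ?E" "e = h e'" "delta_le v e'" "delta_le e' S" by auto
      moreover have "h e' \<in> ?E" using hE e' by blast
      ultimately show "e \<in> {e \<in> ?E. delta_le (h v) e \<and> delta_le e (h S)}"
        using emb S VX EX v by auto
    qed
    moreover have "inj_on h {e \<in> ?E. delta_le v e \<and> delta_le e S}"
      using EX by (intro inj_on_subset[OF injX]) auto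
    ultimately have "card {e \<in> ?E. delta_le (h v) e \<and> delta_le e (h S)} = card {e \<in> ?E. delta_le v e \<and> delta_le e S}"
      by (simp add: card_image)
    then show ?thesis
      using card_edges_at_vertex[OF hv(1) h[OF S] hv(2)] card_edges_at_vertex[OF v(1) Xf[OF S] v(2)] by simp
  qed
  then show "\<And>S. S \<in> ?X \<Longrightarrow> delta_face_dim (h S) = delta_face_dim S" .
  show "h ` ?X = ?X"
    using dim h by (intro endo_inj_surj finX injX) (auto simp: delta_skel_def)
qed

section \<open>Faces preserved by a projection\<close>

lemma dim_kernel_ge:
  fixes f :: "'a::euclidean_space \<Rightarrow> 'b::euclidean_space"
  assumes f: "linear f" and D: "subspace D"
  shows "dim D \<le> dim {x \<in> D. f x = 0} + dim (f ` D)"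
proof -
  let ?K = "{x \<in> D. f x = 0}" and ?C = "{y \<in> D. \<forall>x\<in>{x \<in> D. f x = 0}. orthogonal x y}"
  have K: "subspace ?K"
    using D f by (auto simp: subspace_def linear_0 linear_add linear_cmul)
  have C: "subspace ?C"
    using D by (auto simp: subspace_def orthogonal_clauses)
  have "dim ?C + dim ?K = dim D"
    by (rule dim_subspace_orthogonal_to_vectors[OF K D]) auto
  moreover have "inj_on f ?C"
  proof (rule inj_onI)
    fix x y assume xy: "x \<in> ?C" "y \<in> ?C" "f x = f y"
    then have c: "x - y \<in> ?C" using C by (simp add: subspace_diff del: mem_Collect_eq)
    moreover have "x - y \<in> ?K" using xy D f by (simp add: subspace_diff linear_diff)
    ultimately have "orthogonal (x - y) (x - y)" by blast
    then show "x = y" by (simp add: orthogonal_self)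
  qed
  then have "dim (f ` ?C) = dim ?C"
    using C by (intro dim_image_eq f) (simp add: span_eq_iff[THEN iffD2])
  moreover have "dim (f ` ?C) \<le> dim (f ` D)" by (intro dim_subset image_mono) auto
  ultimately show ?thesis by linarith
qed

lemma aff_dim_eq_dim_direction:
  fixes X :: "'a::euclidean_space set"
  assumes "x \<in> X"
  shows "aff_dim X = int (dim (span ((\<lambda>z. - x + z) ` X)))"
  using aff_dim_eq_dim[of x X] assms by (simp add: hull_inc)

lemma aff_dim_linear_image_eq_dim:
  fixes f :: "'a::euclidean_space \<Rightarrow> 'b::euclidean_space"
  assumes f: "linear f" and x: "x \<in> X"
  shows "aff_dim (f ` X) = int (dim (f ` span ((\<lambda>z. - x + z) ` X)))"
proof -
  have "(\<lambda>z. - f x + z) ` f ` X = f ` ((\<lambda>z. - x + z) ` X)"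
    by (simp add: image_image linear_diff[OF f])
  then show ?thesis
    using aff_dim_eq_dim_direction[of "f x" "f ` X"] x by (simp add: linear_span_image[OF f])
qed

text \<open>The difference w of x and y is a kernel vector among the directions D of X. Projecting D
  orthogonally to w lowers its dimension without changing its image under f.\<close>

lemma aff_dim_linear_image_less:
  fixes f :: "'a::euclidean_space \<Rightarrow> 'b::euclidean_space"
  assumes f: "linear f" and xy: "x \<in> X" "y \<in> X" "x \<noteq> y" "f x = f y"
  shows "aff_dim (f ` X) < aff_dim X"
proof -
  define D where "D = span ((\<lambda>z. - x + z) ` X)"
  define w where "w = - x + y"
  have w: "w \<in> D" "w \<noteq> 0" "f w = 0"
    using xy f by (auto simp: D_def w_def linear_diff intro: span_base)
  define C where "C = D \<inter> {z. w \<bullet> z = 0}"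
  have D: "subspace D" by (simp add: D_def)
  have C: "subspace C" unfolding C_def by (intro subspace_inter D subspace_hyperplane)
  have "f ` D \<subseteq> f ` C"
  proof
    fix b assume "b \<in> f ` D"
    then obtain z where z: "z \<in> D" "b = f z" by blast
    define z' where "z' = z - ((w \<bullet> z) / (w \<bullet> w)) *\<^sub>R w"
    have "z' \<in> C"
      using z w D by (simp add: C_def z'_def subspace_diff subspace_scale inner_diff_right)
    moreover have "f z' = b" using z w f by (simp add: z'_def linear_diff linear_cmul)
    ultimately show "b \<in> f ` C" by blast
  qed
  then have "dim (f ` D) \<le> dim (f ` C)" by (rule dim_subset)
  also have "\<dots> \<le> dim C" using f by (rule dim_image_le)
  also have "dim C < dim D"
  proof (rule dim_psubset)
    have "w \<notin> C" using w by (simp add: C_def)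
    moreover have "C \<subseteq> D" by (simp add: C_def)
    ultimately have "C \<subset> D" using w(1) by blast
    moreover have "span C = C" "span D = D" using C D by (simp_all only: span_eq_iff)
    ultimately show "span C \<subset> span D" by (simp only:)
  qed
  finally show ?thesis
    using aff_dim_linear_image_eq_dim[OF f xy(1)] aff_dim_eq_dim_direction[OF xy(1)] by (simp add: D_def)
qed

lemma face_of_linear_vimage:
  assumes f: "linear f" and Q: "convex Q" and F: "F face_of f ` Q"
  shows "{x \<in> Q. f x \<in> F} face_of Q"
  unfolding face_of_def
proof (intro conjI ballI impI)
  show "convex {x \<in> Q. f x \<in> F}"
    using convex_Int[OF Q convex_linear_vimage[OF f face_of_imp_convex[OF F]]]
    by (simp add: vimage_def Int_def)
  fix a b x assume ab: "a \<in> Q" "b \<in> Q" and x: "x \<in> {x \<in> Q. f x \<in> F}" and seg: "x \<in> open_segment a b"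
  have "f a \<in> F \<and> f b \<in> F"
  proof (cases "f a = f b")
    case True
    obtain u where "x = (1 - u) *\<^sub>R a + u *\<^sub>R b" using seg by (auto simp: in_segment)
    then have "f x = (1 - u) *\<^sub>R f a + u *\<^sub>R f b" using f by (simp add: linear_add linear_cmul)
    then have "f x = f a" using True by (simp flip: scaleR_add_left)
    then show ?thesis using x True by simp
  next
    case False
    obtain u where u: "x = (1 - u) *\<^sub>R a + u *\<^sub>R b" "0 < u" "u < 1" using seg by (auto simp: in_segment)
    then have "f x = (1 - u) *\<^sub>R f a + u *\<^sub>R f b" using f by (simp add: linear_add linear_cmul)
    then have "f x \<in> open_segment (f a) (f b)" using u False by (auto simp: in_segment)
    then show ?thesis using F ab x unfolding face_of_def by blast
  qed
  then show "a \<in> {x \<in> Q. f x \<in> F}" "b \<in> {x \<in> Q. f x \<in> F}" using ab by auto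
qed auto

lemma delta_face_dim_strict_mono:
  assumes S: "S \<in> delta_faces ns" and T: "T \<in> delta_faces ns" and le: "delta_le S T" "S \<noteq> T"
  shows "delta_face_dim S < delta_face_dim T"
proof -
  have len: "length S = length ns" "length T = length ns" using length_delta_face S T by auto
  have sub: "S ! i \<subseteq> T ! i" if "i < length ns" for i using le that by (simp add: delta_le_def len)
  have "\<exists>i<length ns. S ! i \<noteq> T ! i" using le(2) len by (metis nth_equalityI)
  then obtain i where i: "i < length ns" "S ! i \<noteq> T ! i" by auto
  show ?thesis
    unfolding delta_face_dim_def len
  proof (rule sum_strict_mono_ex1)
    show "\<forall>i\<in>{..<length ns}. int (card (S ! i)) - 1 \<le> int (card (T ! i)) - 1"
    proof
      fix i assume "i \<in> {..<length ns}"
      then have "card (S ! i) \<le> card (T ! i)"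
        using sub delta_faces_finite_nth(1)[OF T] by (intro card_mono) auto
      then show "int (card (S ! i)) - 1 \<le> int (card (T ! i)) - 1" by simp
    qed
    have "card (S ! i) < card (T ! i)"
      using sub[OF i(1)] i(2) delta_faces_finite_nth(1)[OF T i(1)] by (intro psubset_card_mono) auto
    then show "\<exists>i\<in>{..<length ns}. int (card (S ! i)) - 1 < int (card (T ! i)) - 1" using i(1) by auto
  qed simp
qed

lemma delta_face_dim_top: "delta_face_dim (delta_top ns) = int (sum_list ns)"
  by (simp add: delta_face_dim_def delta_top_def sum_list_sum_nth atLeast0LessThan)

text \<open>A chain of labels becomes a chain of distinct faces, and a proper face has smaller
  dimension. A partial skeleton yields only this one inequality between the two dimensions.\<close>

lemma skel_equiv_delta_faces:
  fixes P :: "'a::euclidean_space set"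
  assumes P: "convex P" and e: "skel_equiv_delta k ns P"
  obtains FP where "\<And>S. S \<in> delta_skel k ns \<Longrightarrow> FP S \<in> skel k P"
    "\<And>S T. S \<in> delta_skel k ns \<Longrightarrow> T \<in> delta_skel k ns \<Longrightarrow> FP S \<subseteq> FP T \<longleftrightarrow> delta_le S T"
    "\<And>F. F \<in> skel k P \<Longrightarrow> \<exists>S\<in>delta_skel k ns. F = FP S"
    "\<And>S. S \<in> delta_skel k ns \<Longrightarrow> delta_face_dim S \<le> aff_dim (FP S)"
proof -
  obtain g where g: "bij_betw g (skel k P) (delta_skel k ns)"
    and le: "\<forall>F\<in>skel k P. \<forall>G\<in>skel k P. F \<subseteq> G \<longleftrightarrow> delta_le (g F) (g G)"
    using e unfolding skel_equiv_delta_def by blast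
  define FP where "FP = the_inv_into (skel k P) g"
  have bij: "bij_betw FP (delta_skel k ns) (skel k P)"
    unfolding FP_def by (rule bij_betw_the_inv_into[OF g])
  have gF: "g (FP S) = S" if "S \<in> delta_skel k ns" for S
    using that g unfolding FP_def bij_betw_def by (metis f_the_inv_into_f)
  have 1: "FP S \<in> skel k P" if "S \<in> delta_skel k ns" for S
    using bij that by (auto simp: bij_betw_def)
  have 2: "FP S \<subseteq> FP T \<longleftrightarrow> delta_le S T" if "S \<in> delta_skel k ns" "T \<in> delta_skel k ns" for S T
    using le 1 gF that by metis
  have 3: "\<exists>S\<in>delta_skel k ns. F = FP S" if "F \<in> skel k P" for F
    using bij that by (auto simp: bij_betw_def)
  have "int d \<le> aff_dim (FP S)" if "S \<in> delta_skel k ns" "delta_face_dim S = int d" for d S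
    using that
  proof (induction d arbitrary: S)
    case 0
    have "FP S \<noteq> {}" using 1[OF 0(1)] by (simp add: skel_def)
    then have "aff_dim (FP S) \<noteq> -1" by (simp add: aff_dim_empty)
    then show ?case using aff_dim_geq[of "FP S"] by linarith
  next
    case (Suc d)
    have Sf: "S \<in> delta_faces ns" using Suc.prems by (simp add: delta_skel_def)
    obtain S' where S': "S' \<in> delta_faces ns" "delta_le S' S" "S' \<noteq> S" "delta_face_dim S' = int d"
      using delta_face_reduce[OF Sf] Suc.prems(2) by force
    then have S'k: "S' \<in> delta_skel k ns" using Suc.prems by (simp add: delta_skel_def)
    have sub: "FP S' \<subseteq> FP S" using 2[OF S'k Suc.prems(1)] S'(2) by simp
    have faces: "FP S' face_of P" "FP S face_of P" using 1 S'k Suc.prems(1) by (auto simp: skel_def)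
    have "FP S' face_of FP S"
      using faces(1) sub face_of_imp_subset[OF faces(2)] by (rule face_of_subset)
    moreover have "FP S' \<noteq> FP S" using gF S'k Suc.prems(1) S'(3) by metis
    ultimately have "aff_dim (FP S') < aff_dim (FP S)"
      using face_of_imp_convex[OF faces(2)] by (intro face_of_aff_dim_lt)
    then show ?case using Suc.IH[OF S'k S'(4)] by simp
  qed
  then have 4: "delta_face_dim S \<le> aff_dim (FP S)" if "S \<in> delta_skel k ns" for S
    using that delta_face_dim_nat[of S ns] unfolding delta_skel_def by (metis (no_types, lifting) mem_Collect_eq)
  show ?thesis using that 1 2 3 4 by blast
qed

text \<open>Equality of dimensions is not part of \<open>comb_equiv_delta\<close>; it is a
  consequence of the order on all faces, see \<open>comb_equiv_delta_labelling\<close>.\<close>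

definition delta_labelling :: "nat list \<Rightarrow> 'a::euclidean_space set \<Rightarrow> (nat set list \<Rightarrow> 'a set) \<Rightarrow> bool" where
  "delta_labelling ns Q FQ \<longleftrightarrow>
     (\<forall>S\<in>delta_faces ns. FQ S face_of Q \<and> FQ S \<noteq> {} \<and> aff_dim (FQ S) = delta_face_dim S) \<and>
     (\<forall>S\<in>delta_faces ns. \<forall>T\<in>delta_faces ns. FQ S \<subseteq> FQ T \<longleftrightarrow> delta_le S T) \<and>
     (\<forall>F. F face_of Q \<and> F \<noteq> {} \<longrightarrow> (\<exists>S\<in>delta_faces ns. F = FQ S))"

text \<open>Once all faces are labelled, the opposite bound on the dimension follows by descending
  through facets: a facet of \<open>FQ S\<close> carries a strictly smaller label.\<close>

lemma comb_equiv_delta_labelling: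
  fixes Q :: "'a::euclidean_space set"
  assumes "comb_equiv_delta ns Q"
  obtains FQ where "delta_labelling ns Q FQ"
proof -
  let ?k = "max (int (sum_list ns)) (aff_dim Q)"
  have Q: "polytope Q" and e: "skel_equiv_delta ?k ns Q"
    using assms by (auto simp: comb_equiv_delta_def)
  have "delta_face_dim S \<le> ?k" if "S \<in> delta_faces ns" for S
    using delta_face_dim_mono[OF that delta_top_in delta_le_top[OF that]]
    by (simp add: delta_face_dim_top)
  then have sk: "delta_skel ?k ns = delta_faces ns" by (auto simp: delta_skel_def)
  have "aff_dim F \<le> ?k" if "F face_of Q" for F
    using aff_dim_subset[OF face_of_imp_subset[OF that]] by simp
  then have skQ: "skel ?k Q = {F. F face_of Q \<and> F \<noteq> {}}" by (auto simp: skel_def)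
  obtain FQ where FQ: "\<And>S. S \<in> delta_faces ns \<Longrightarrow> FQ S face_of Q \<and> FQ S \<noteq> {}"
    "\<And>S T. S \<in> delta_faces ns \<Longrightarrow> T \<in> delta_faces ns \<Longrightarrow> FQ S \<subseteq> FQ T \<longleftrightarrow> delta_le S T"
    "\<And>F. F face_of Q \<Longrightarrow> F \<noteq> {} \<Longrightarrow> \<exists>S\<in>delta_faces ns. F = FQ S"
    "\<And>S. S \<in> delta_faces ns \<Longrightarrow> delta_face_dim S \<le> aff_dim (FQ S)"
    by (rule skel_equiv_delta_faces[OF polytope_imp_convex[OF Q] e, unfolded sk skQ]) blast
  have "int d \<le> delta_face_dim S" if "S \<in> delta_faces ns" "aff_dim (FQ S) = int d" for d S
    using that
  proof (induction d arbitrary: S)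
    case 0
    then show ?case using delta_face_dim_nonneg[of S ns] by simp
  next
    case (Suc d)
    have "polytope (FQ S)" using Q FQ(1)[OF Suc.prems(1)] face_of_polytope_polytope by blast
    then obtain F where F: "F facet_of FQ S"
      using polytope_facet_exists[of "FQ S"] Suc.prems(2) by auto
    then have F': "F face_of FQ S" "F \<noteq> {}" "aff_dim F = int d"
      using Suc.prems(2) by (auto simp: facet_of_def)
    then have "F face_of Q" using FQ(1)[OF Suc.prems(1)] face_of_trans by blast
    then obtain S' where S': "S' \<in> delta_faces ns" "F = FQ S'" using FQ(3) F'(2) by blast
    have "delta_le S' S" using FQ(2)[OF S'(1) Suc.prems(1)] face_of_imp_subset[OF F'(1)] S'(2) by simp
    moreover have "S' \<noteq> S" using F'(3) Suc.prems(2) S'(2) by auto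
    ultimately have "delta_face_dim S' < delta_face_dim S"
      by (intro delta_face_dim_strict_mono[OF S'(1) Suc.prems(1)])
    moreover have "int d \<le> delta_face_dim S'"
      by (rule Suc.IH[OF S'(1)]) (use F'(3) S'(2) in simp)
    ultimately show ?case by simp
  qed
  moreover have "0 \<le> aff_dim (FQ S)" if "S \<in> delta_faces ns" for S
    using FQ(4)[OF that] delta_face_dim_nonneg[OF that] by linarith
  ultimately have "aff_dim (FQ S) \<le> delta_face_dim S" if "S \<in> delta_faces ns" for S
    using that by (metis zero_le_imp_eq_int)
  then have "aff_dim (FQ S) = delta_face_dim S" if "S \<in> delta_faces ns" for S
    using FQ(4) that by (simp add: order_antisym)
  then have "delta_labelling ns Q FQ" unfolding delta_labelling_def using FQ(1-3) by blast
  then show ?thesis using that by blast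
qed

text \<open>Preimages of faces of the projection are faces of Q, and their labels define an order
  embedding h. Distinct vertices of the projection are disjoint, which is the separation that
  \<open>delta_skel_embedding\<close> asks for. Hence \<open>FQ S\<close> is the full preimage of a
  face of no smaller dimension, and f cannot identify two of its points.\<close>

lemma labelled_skeleton_preserved:
  fixes f :: "'b::euclidean_space \<Rightarrow> 'a::euclidean_space"
  assumes PSN: "PSN (int k) ns (f ` Q)" and f: "linear f" and Q: "polytope Q"
    and lab: "delta_labelling ns Q FQ"
    and S: "S \<in> delta_skel (int k) ns" and x: "x \<in> FQ S" and y: "y \<in> Q" and eq: "f x = f y"
  shows "x = y"
proof -
  let ?P = "f ` Q" and ?X = "delta_skel (int k) ns"
  note FQ = lab[unfolded delta_labelling_def]
  have polyP: "polytope ?P" using PSN by (simp add: PSN_def)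
  have convP: "convex ?P" using polyP by (rule polytope_imp_convex)
  have convQ: "convex Q" using Q by (rule polytope_imp_convex)
  have e: "skel_equiv_delta (int k) ns ?P" using PSN by (simp add: PSN_def)
  obtain FP where FP: "\<And>S. S \<in> ?X \<Longrightarrow> FP S \<in> skel (int k) ?P"
    "\<And>S T. S \<in> ?X \<Longrightarrow> T \<in> ?X \<Longrightarrow> FP S \<subseteq> FP T \<longleftrightarrow> delta_le S T"
    "\<And>F. F \<in> skel (int k) ?P \<Longrightarrow> \<exists>S\<in>?X. F = FP S"
    "\<And>S. S \<in> ?X \<Longrightarrow> delta_face_dim S \<le> aff_dim (FP S)"
    by (rule skel_equiv_delta_faces[OF convP e]) blast
  define pre where "pre F = {x \<in> Q. f x \<in> F}" for F
  have FPsub: "FP S \<subseteq> ?P" "FP S \<noteq> {}" "FP S face_of ?P" "aff_dim (FP S) \<le> int k" if "S \<in> ?X" for S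
    using FP(1)[OF that] face_of_imp_subset by (auto simp: skel_def)
  have im: "f ` pre F = F" if "F \<subseteq> ?P" for F using that by (auto simp: pre_def)
  have "\<exists>T\<in>delta_faces ns. pre (FP S) = FQ T" if S: "S \<in> ?X" for S
  proof -
    have "pre (FP S) face_of Q"
      unfolding pre_def by (rule face_of_linear_vimage[OF f convQ FPsub(3)[OF S]])
    moreover have "pre (FP S) \<noteq> {}" using im[OF FPsub(1)[OF S]] FPsub(2)[OF S] by auto
    ultimately show ?thesis using FQ by blast
  qed
  then obtain h where h: "\<And>S. S \<in> ?X \<Longrightarrow> h S \<in> delta_faces ns" "\<And>S. S \<in> ?X \<Longrightarrow> pre (FP S) = FQ (h S)"
    by metis
  have emb: "delta_le (h S) (h T) \<longleftrightarrow> delta_le S T" if "S \<in> ?X" "T \<in> ?X" for S T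
  proof -
    have "delta_le (h S) (h T) \<longleftrightarrow> pre (FP S) \<subseteq> pre (FP T)"
      using FQ h that by metis
    also have "\<dots> \<longleftrightarrow> FP S \<subseteq> FP T"
      using im[OF FPsub(1)[OF that(1)]] im[OF FPsub(1)[OF that(2)]] by (auto simp: pre_def)
    finally show ?thesis using FP(2)[OF that] by simp
  qed
  have VX: "delta_vertices ns \<subseteq> ?X" by (auto simp: delta_vertices_def delta_skel_def)
  have sep: "v = w" if v: "v \<in> delta_vertices ns" and w: "w \<in> delta_vertices ns" and T: "T \<in> delta_faces ns"
    and le: "delta_le T (h v)" "delta_le T (h w)" for v w T
  proof -
    have vX: "v \<in> ?X" and wX: "w \<in> ?X" using v w VX by auto
    have "FQ T \<subseteq> pre (FP v)" "FQ T \<subseteq> pre (FP w)"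
      using FQ T le h vX wX by metis+
    moreover have "FQ T \<noteq> {}" using FQ T by blast
    ultimately have ne: "FP v \<inter> FP w \<noteq> {}" by (auto simp: pre_def)
    have "aff_dim (FP v \<inter> FP w) \<le> int k"
      using aff_dim_subset[of "FP v \<inter> FP w" "FP v"] FPsub(4)[OF vX] by auto
    then have "FP v \<inter> FP w \<in> skel (int k) ?P"
      using ne face_of_Int[OF FPsub(3)[OF vX] FPsub(3)[OF wX]] by (simp add: skel_def)
    then obtain U where U: "U \<in> ?X" "FP v \<inter> FP w = FP U" using FP(3) by blast
    then have "delta_le U v" "delta_le U w" using FP(2) vX wX by blast+
    then show "v = w"
      using delta_vertex_minimal[OF v] delta_vertex_minimal[OF w] U(1) by (auto simp: delta_skel_def)
  qed
  have "h ` ?X = ?X"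
    by (rule delta_skel_embedding(1)) (rule h(1), assumption, rule emb, assumption+, rule sep, assumption+)
  then obtain T where T: "T \<in> ?X" "S = h T" using S by blast
  have dimT: "delta_face_dim S = delta_face_dim T"
    unfolding T(2)
    by (rule delta_skel_embedding(2))
       (rule h(1), assumption, rule emb, assumption+, rule sep, assumption+, rule T(1))
  have pre: "pre (FP T) = FQ S" using h(2)[OF T(1)] T(2) by simp
  then have fS: "f ` FQ S = FP T" using im[OF FPsub(1)[OF T(1)]] by simp
  have "y \<in> FQ S" using x y eq unfolding pre[symmetric] pre_def by simp
  show ?thesis
  proof (rule ccontr)
    assume "x \<noteq> y"
    then have "aff_dim (f ` FQ S) < aff_dim (FQ S)"
      using aff_dim_linear_image_less[OF f x \<open>y \<in> FQ S\<close> _ eq] by blast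
    moreover have "aff_dim (FQ S) = delta_face_dim S" using FQ S by (simp add: delta_skel_def)
    ultimately show False using FP(4)[OF T(1)] fS dimT by simp
  qed
qed

section \<open>Facet normals\<close>

text \<open>By irredundancy some z violates h alone. The segment to z from a relative interior point
  of S meets the boundary of h in a point of S that is strictly inside all other halfspaces, so no
  other halfspace cuts out the same facet.\<close>

lemma minimal_halfspaces_distinct_facets:
  fixes S :: "'a::euclidean_space set"
  assumes fin: "finite H" and ne: "S \<noteq> {}" and conv: "convex S"
    and seq: "S = affine hull S \<inter> \<Inter>H"
    and ab: "\<And>h. h \<in> H \<Longrightarrow> a h \<noteq> 0 \<and> h = {x. a h \<bullet> x \<le> b h}"
    and psub: "\<And>H'. H' \<subset> H \<Longrightarrow> S \<subset> affine hull S \<inter> \<Inter>H'"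
    and h: "h \<in> H" "g \<in> H" and eq: "S \<inter> {x. a h \<bullet> x = b h} = S \<inter> {x. a g \<bullet> x = b g}"
  shows "h = g"
proof (rule ccontr)
  assume "h \<noteq> g"
  have inH: "a l \<bullet> x \<le> b l" if "l \<in> H" "x \<in> l" for l x
    using conjunct2[OF ab[OF that(1)], THEN equalityD1] that(2) by blast
  have Hin: "x \<in> l" if "l \<in> H" "a l \<bullet> x \<le> b l" for l x
    using conjunct2[OF ab[OF that(1)], THEN equalityD2] that(2) by blast
  have "H - {h} \<subset> H" using h by blast
  from psub[OF this] obtain z where z: "z \<in> affine hull S" "z \<in> \<Inter>(H - {h})" "z \<notin> S"
    by blast
  then have "z \<notin> h" using seq by blast
  then have zh: "a h \<bullet> z > b h" using Hin[OF h(1)] not_le by blast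
  have "rel_interior S \<noteq> {}" using ne conv by (simp add: rel_interior_eq_empty)
  then obtain x where x: "x \<in> S" "\<And>l. l \<in> H \<Longrightarrow> a l \<bullet> x < b l"
    using rel_interior_polyhedron_explicit[OF fin seq ab psub] by auto
  have xh: "a h \<bullet> x < b h" by (rule x(2)[OF h(1)])
  define t where "t = (b h - a h \<bullet> x) / (a h \<bullet> z - a h \<bullet> x)"
  have t: "0 < t" "t < 1" using zh xh by (auto simp: t_def field_simps)
  define p where "p = (1 - t) *\<^sub>R x + t *\<^sub>R z"
  have "a h \<bullet> p = a h \<bullet> x + t * (a h \<bullet> z - a h \<bullet> x)"
    by (simp add: p_def inner_add_right algebra_simps)
  also have "\<dots> = b h" using zh xh by (simp add: t_def)
  finally have ph: "a h \<bullet> p = b h" .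
  have pl: "a l \<bullet> p < b l" if l: "l \<in> H" "l \<noteq> h" for l
  proof -
    have "a l \<bullet> z \<le> b l" using z(2) l by (intro inH) auto
    then have "t * (a l \<bullet> z) \<le> t * b l" using t by simp
    moreover have "(1 - t) * (a l \<bullet> x) < (1 - t) * b l" using x(2)[OF l(1)] t by simp
    ultimately show ?thesis by (simp add: p_def inner_add_right algebra_simps)
  qed
  have "p \<in> affine hull S"
    unfolding p_def using z(1) x(1) by (intro mem_affine) (auto simp: hull_inc)
  moreover have "p \<in> l" if "l \<in> H" for l
  proof -
    have "a l \<bullet> p \<le> b l" using pl[OF that] ph by (cases "l = h") auto
    then show ?thesis by (rule Hin[OF that])
  qed
  ultimately have "p \<in> S" using seq by blast
  then have "a g \<bullet> p = b g" using ph eq by blast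
  then show False using pl[OF h(2)] \<open>h \<noteq> g\<close> by simp
qed

text \<open>A facet through a relative interior point x of \<open>FQ S\<close> contains
  \<open>FQ S\<close> and hence omits a vertex j of some block i with j outside S ! i. If v does not
  point outward at these facets, a short step along v stays in Q, as the inequalities of the other
  facets are strict at x.\<close>

lemma labelled_facet_normals:
  fixes Q :: "'a::euclidean_space set"
  assumes Q: "polytope Q" and lab: "delta_labelling ns Q FQ"
    and pos: "\<And>i. i < length ns \<Longrightarrow> 1 \<le> ns ! i" and q0: "q0 \<in> Q"
  obtains A :: "nat \<Rightarrow> nat \<Rightarrow> 'a" where
    "\<And>S x v. S \<in> delta_faces ns \<Longrightarrow> x \<in> rel_interior (FQ S) \<Longrightarrow> v \<in> span ((\<lambda>z. - q0 + z) ` Q) \<Longrightarrow>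
      (\<And>i j. i < length ns \<Longrightarrow> j \<le> ns ! i \<Longrightarrow> j \<notin> S ! i \<Longrightarrow> A i j \<bullet> v \<le> 0) \<Longrightarrow>
      \<exists>\<epsilon>>0. x + \<epsilon> *\<^sub>R v \<in> Q"
proof -
  have face: "FQ S face_of Q" and dimF: "aff_dim (FQ S) = delta_face_dim S" if "S \<in> delta_faces ns" for S
    using lab that by (auto simp: delta_labelling_def)
  have mono: "FQ S \<subseteq> FQ T \<longleftrightarrow> delta_le S T" if "S \<in> delta_faces ns" "T \<in> delta_faces ns" for S T
    using lab that by (auto simp: delta_labelling_def)
  have label: "\<exists>S\<in>delta_faces ns. F = FQ S" if "F face_of Q" "F \<noteq> {}" for F
    using lab that by (auto simp: delta_labelling_def)
  have conv: "convex Q" using Q by (rule polytope_imp_convex)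
  have ne: "Q \<noteq> {}" using q0 by auto
  have "polyhedron Q" using Q by (rule polytope_imp_polyhedron)
  then obtain H where fin: "finite H" and seq: "Q = affine hull Q \<inter> \<Inter>H"
    and hs: "\<forall>h\<in>H. \<exists>a b. a \<noteq> 0 \<and> h = {x. a \<bullet> x \<le> b}"
    and psub: "\<And>H'. H' \<subset> H \<Longrightarrow> Q \<subset> affine hull Q \<inter> \<Inter>H'"
    unfolding polyhedron_Int_affine_minimal by blast
  obtain a b where ab: "\<And>h. h \<in> H \<Longrightarrow> a h \<noteq> 0 \<and> h = {x. a h \<bullet> x \<le> b h}"
    using hs by metis
  define fc where "fc h = Q \<inter> {x. a h \<bullet> x = b h}" for h
  have facet: "fc h facet_of Q" if "h \<in> H" for h
    using facet_of_polyhedron_explicit[OF fin seq ab psub] that by (auto simp: fc_def)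
  \<comment> \<open>The largest label omitting vertex j of block i.\<close>
  let ?C = "\<lambda>i j. (delta_top ns)[i := {0..ns ! i} - {j}]"
  have lent: "length (delta_top ns) = length ns" by (simp add: delta_top_def)
  have C: "?C i j \<in> delta_faces ns" if ij: "i < length ns" for i j
  proof -
    have "{0..ns ! i} - {j} \<noteq> {}"
    proof (cases "j = 0")
      case True
      then have "1 \<in> {0..ns ! i} - {j}" using pos[OF ij] by simp
      then show ?thesis by blast
    next
      case False
      then have "0 \<in> {0..ns ! i} - {j}" by simp
      then show ?thesis by blast
    qed
    then show ?thesis using ij by (auto simp: delta_faces_def lent nth_list_update delta_top_def)
  qed
  have Cle: "j \<notin> S ! i" if "delta_le S (?C i j)" "i < length ns" "S \<in> delta_faces ns" for S i j
  proof -
    have "i < length S" using that(2) length_delta_face[OF that(3)] by simp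
    then have "S ! i \<subseteq> ?C i j ! i" using that(1) unfolding delta_le_def by blast
    then show ?thesis using that(2) lent by auto
  qed
  have Qtop: "FQ (delta_top ns) = Q"
  proof
    show "FQ (delta_top ns) \<subseteq> Q" by (rule face_of_imp_subset[OF face[OF delta_top_in]])
    obtain T where T: "T \<in> delta_faces ns" "Q = FQ T" using label[OF face_of_refl[OF conv] ne] by blast
    have "FQ T \<subseteq> FQ (delta_top ns)" using mono[OF T(1) delta_top_in] delta_le_top[OF T(1)] by simp
    then show "Q \<subseteq> FQ (delta_top ns)" using T(2) by simp
  qed
  have "\<exists>i j. i < length ns \<and> fc h = FQ (?C i j)" if h: "h \<in> H" for h
  proof -
    have f: "fc h face_of Q" "fc h \<noteq> {}" "aff_dim (fc h) = aff_dim Q - 1"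
      using facet[OF h] by (auto simp: facet_of_def)
    obtain S where S: "S \<in> delta_faces ns" "fc h = FQ S" using label[OF f(1,2)] by blast
    have "S \<noteq> delta_top ns" using f(3) S(2) Qtop by auto
    then have "\<not> delta_le (delta_top ns) S" using delta_le_top[OF S(1)] delta_le_antisym by blast
    then obtain i j where ij: "i < length ns" "j \<le> ns ! i" "j \<notin> S ! i"
      using length_delta_face[OF S(1)] by (auto simp: delta_le_def lent) (auto simp: delta_top_def)
    have le: "delta_le S (?C i j)"
      unfolding delta_le_def
    proof (intro conjI allI impI)
      fix l assume "l < length S"
      then have l: "l < length ns" by (simp add: length_delta_face[OF S(1)])
      then show "S ! l \<subseteq> ?C i j ! l"
        using delta_faces_finite_nth(4)[OF S(1) l] ij
        by (cases "l = i") (auto simp: lent delta_top_def nth_list_update)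
    qed (simp add: lent length_delta_face[OF S(1)])
    \<comment> \<open>The label \<open>?C i j\<close> is strictly below the top label. A label of
      codimension 1 therefore cannot be strictly below \<open>?C i j\<close>.\<close>
    have "S = ?C i j"
    proof (rule ccontr)
      assume "S \<noteq> ?C i j"
      then have "delta_face_dim S < delta_face_dim (?C i j)"
        by (rule delta_face_dim_strict_mono[OF S(1) C[OF ij(1)] le])
      moreover have "delta_face_dim (?C i j) < delta_face_dim (delta_top ns)"
      proof (rule delta_face_dim_strict_mono[OF C[OF ij(1)] delta_top_in delta_le_top[OF C[OF ij(1)]]])
        have "j \<notin> ?C i j ! i" "j \<in> delta_top ns ! i" using ij by (auto simp: lent delta_top_def)
        then show "?C i j \<noteq> delta_top ns" by metis
      qed
      moreover have "aff_dim (FQ S) = delta_face_dim S" "aff_dim (FQ (delta_top ns)) = delta_face_dim (delta_top ns)"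
        using dimF[OF S(1)] dimF[OF delta_top_in] by simp_all
      ultimately show False using f(3) S(2) Qtop by simp
    qed
    then show ?thesis using S(2) ij(1) by blast
  qed
  then obtain I J where IJ: "\<And>h. h \<in> H \<Longrightarrow> I h < length ns" "\<And>h. h \<in> H \<Longrightarrow> fc h = FQ (?C (I h) (J h))"
    by metis
  have uniq: "h = g" if "h \<in> H" "g \<in> H" "I h = I g" "J h = J g" for h g
  proof (rule minimal_halfspaces_distinct_facets[OF fin ne conv seq ab psub that(1,2)])
    show "Q \<inter> {x. a h \<bullet> x = b h} = Q \<inter> {x. a g \<bullet> x = b g}"
      using IJ(2)[OF that(1)] IJ(2)[OF that(2)] that(3,4) by (simp add: fc_def)
  qed
  \<comment> \<open>Pairs that belong to no halfspace get the normal 0, whose sign condition is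
    vacuous. For the others \<open>uniq\<close> makes the choice unambiguous.\<close>
  define A where "A i j = (if \<exists>h\<in>H. I h = i \<and> J h = j then a (SOME h. h \<in> H \<and> I h = i \<and> J h = j) else 0)" for i j
  have A: "A (I h) (J h) = a h" if h: "h \<in> H" for h
  proof -
    have "(SOME g. g \<in> H \<and> I g = I h \<and> J g = J h) = h"
      by (rule some_equality) (use h uniq in auto)
    then show ?thesis using h by (auto simp: A_def)
  qed
  show ?thesis
  proof (rule that[of A])
    fix S x v assume S: "S \<in> delta_faces ns" and x: "x \<in> rel_interior (FQ S)"
      and v: "v \<in> span ((\<lambda>z. - q0 + z) ` Q)"
      and le: "\<And>i j. i < length ns \<Longrightarrow> j \<le> ns ! i \<Longrightarrow> j \<notin> S ! i \<Longrightarrow> A i j \<bullet> v \<le> 0"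
    have FS: "FQ S face_of Q" by (rule face[OF S])
    have xF: "x \<in> FQ S" using x rel_interior_subset by blast
    have xQ: "x \<in> Q" using xF face_of_imp_subset[OF FS] by blast
    have affQ: "affine hull Q = (\<lambda>z. q0 + z) ` span ((\<lambda>z. - q0 + z) ` Q)"
      using q0 by (intro affine_hull_span_gen) (simp add: hull_inc)
    have inaff: "x + \<epsilon> *\<^sub>R v \<in> affine hull Q" for \<epsilon>
    proof -
      have "x \<in> affine hull Q" using xQ by (simp add: hull_inc)
      then obtain d where d: "d \<in> span ((\<lambda>z. - q0 + z) ` Q)" "x = q0 + d" using affQ by blast
      have "d + \<epsilon> *\<^sub>R v \<in> span ((\<lambda>z. - q0 + z) ` Q)" by (intro span_add span_scale d(1) v)
      then have "q0 + (d + \<epsilon> *\<^sub>R v) \<in> affine hull Q" unfolding affQ by (rule imageI)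
      then show ?thesis by (simp add: d(2) add.assoc)
    qed
    have xle: "a h \<bullet> x \<le> b h" if "h \<in> H" for h
    proof -
      have "x \<in> h" using xQ seq that by blast
      then show ?thesis using conjunct2[OF ab[OF that], THEN equalityD1] by blast
    qed
    have "\<exists>e>0. \<forall>\<epsilon>. 0 < \<epsilon> \<longrightarrow> \<epsilon> \<le> e \<longrightarrow> a h \<bullet> (x + \<epsilon> *\<^sub>R v) \<le> b h" if h: "h \<in> H" for h
    proof (cases "a h \<bullet> v \<le> 0")
      case True
      then have "a h \<bullet> (x + \<epsilon> *\<^sub>R v) \<le> b h" if "0 < \<epsilon>" for \<epsilon>
        using xle[OF h] that mult_nonneg_nonpos[of \<epsilon> "a h \<bullet> v"] by (simp add: inner_add_right)
      then show ?thesis by (intro exI[of _ 1]) auto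
    next
      case False
      have "a h \<bullet> x \<noteq> b h"
      proof
        assume "a h \<bullet> x = b h"
        then have "x \<in> fc h" using xQ by (simp add: fc_def)
        then have meets: "fc h \<inter> rel_interior (FQ S) \<noteq> {}" using x by blast
        have "fc h face_of Q" using facet[OF h] by (simp add: facet_of_def)
        then have "FQ S \<subseteq> fc h"
          by (rule subset_of_face_of[OF _ face_of_imp_subset[OF FS] meets])
        then have "FQ S \<subseteq> FQ (?C (I h) (J h))" using IJ(2)[OF h] by simp
        then have "delta_le S (?C (I h) (J h))" using mono[OF S C[OF IJ(1)[OF h]]] by simp
        then have "J h \<notin> S ! I h" using Cle IJ(1)[OF h] S by blast
        \<comment> \<open>\<open>IJ\<close> leaves \<open>J h\<close> unbounded, but an index out of
          range deletes nothing, and the facet would be all of Q.\<close>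
        moreover have "J h \<le> ns ! I h"
        proof (rule ccontr)
          assume "\<not> J h \<le> ns ! I h"
          then have "?C (I h) (J h) = delta_top ns"
            using IJ(1)[OF h] by (simp add: delta_top_def list_update_same_conv)
          then have "fc h = Q" using IJ(2)[OF h] Qtop by simp
          then show False using facet[OF h] by (simp add: facet_of_def)
        qed
        ultimately have "A (I h) (J h) \<bullet> v \<le> 0" using le IJ(1)[OF h] by blast
        then show False using False A[OF h] by simp
      qed
      then have lt: "a h \<bullet> x < b h" using xle[OF h] by simp
      have pos: "0 < a h \<bullet> v" using False by simp
      show ?thesis
      proof (intro exI[of _ "(b h - a h \<bullet> x) / (a h \<bullet> v)"] conjI allI impI)
        show "0 < (b h - a h \<bullet> x) / (a h \<bullet> v)" using lt pos by simp
        fix \<epsilon> assume "\<epsilon> \<le> (b h - a h \<bullet> x) / (a h \<bullet> v)"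
        then show "a h \<bullet> (x + \<epsilon> *\<^sub>R v) \<le> b h"
          using pos by (simp add: inner_add_right field_simps)
      qed
    qed
    then obtain e where e: "\<And>h. h \<in> H \<Longrightarrow> e h > 0"
      "\<And>h \<epsilon>. h \<in> H \<Longrightarrow> 0 < \<epsilon> \<Longrightarrow> \<epsilon> \<le> e h \<Longrightarrow> a h \<bullet> (x + \<epsilon> *\<^sub>R v) \<le> b h"
      by metis
    \<comment> \<open>The 1 keeps the minimum defined when H is empty.\<close>
    define \<epsilon> where "\<epsilon> = Min (insert 1 (e ` H))"
    have \<epsilon>: "0 < \<epsilon>" "\<And>h. h \<in> H \<Longrightarrow> \<epsilon> \<le> e h"
      using fin e(1) by (auto simp: \<epsilon>_def)
    have "x + \<epsilon> *\<^sub>R v \<in> h" if "h \<in> H" for h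
      using e(2)[OF that \<epsilon>(1) \<epsilon>(2)[OF that]] conjunct2[OF ab[OF that], THEN equalityD2] by blast
    then have "x + \<epsilon> *\<^sub>R v \<in> Q" using inaff seq by blast
    then show "\<exists>\<epsilon>>0. x + \<epsilon> *\<^sub>R v \<in> Q" using \<epsilon>(1) by blast
  qed
qed

section \<open>The lower bound\<close>

text \<open>A continuous surrogate for the median of \<open>2 c + 1\<close> numbers:
  \<open>majority c x - majority c (- x)\<close> is odd in \<open>x\<close> and positive iff more than \<open>c\<close> entries are.\<close>

definition majority :: "nat \<Rightarrow> (nat \<Rightarrow> real) \<Rightarrow> real" where
  "majority c x = (\<Sum>B | B \<subseteq> {..2 * c} \<and> card B = Suc c. \<Prod>j\<in>B. max 0 (x j))"

text \<open>A set B of c + 1 positive entries has a positive product. Any two (c + 1)-subsets of 2c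
  + 1 indices meet, so for -x every product contains a factor 0.\<close>

lemma card_positive_le:
  assumes "majority c x \<le> majority c (\<lambda>j. - x j)"
  shows "card {j. j \<le> 2 * c \<and> 0 < x j} \<le> c"
proof (rule ccontr)
  assume "\<not> ?thesis"
  then have "Suc c \<le> card {j. j \<le> 2 * c \<and> 0 < x j}" by simp
  then obtain B where B: "B \<subseteq> {j. j \<le> 2 * c \<and> 0 < x j}" "card B = Suc c" "finite B"
    by (rule obtain_subset_with_card_n)
  let ?F = "{B. B \<subseteq> {..2 * c} \<and> card B = Suc c}"
  have finF: "finite ?F" by (rule finite_subset[of _ "Pow {..2 * c}"]) auto
  have "0 < (\<Prod>j\<in>B. max 0 (x j))" using B by (intro prod_pos) auto
  moreover have "B \<in> ?F" using B by auto
  ultimately have "0 < majority c x"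
    unfolding majority_def using finF by (intro sum_pos2[of _ B]) (auto intro: prod_nonneg)
  moreover have "majority c (\<lambda>j. - x j) = 0"
    unfolding majority_def
  proof (intro sum.neutral ballI)
    fix B' assume B': "B' \<in> ?F"
    then have finB': "finite B'" by (auto intro: finite_subset)
    have "B \<inter> B' \<noteq> {}"
    proof
      assume "B \<inter> B' = {}"
      then have "card (B \<union> B') = Suc c + Suc c"
        using B B' finB' by (simp add: card_Un_disjoint)
      moreover have "card (B \<union> B') \<le> card {..2 * c}"
        using B B' by (intro card_mono) auto
      ultimately show False by simp
    qed
    then obtain j where "j \<in> B'" "0 < x j" using B by auto
    then have "\<exists>j\<in>B'. max 0 (- x j) = 0" by (intro bexI[of _ j]) auto
    then show "(\<Prod>j\<in>B'. max 0 (- x j)) = 0" using finB' by (intro prod_zero)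
  qed
  ultimately show False using assms by simp
qed

lemma split_sum_below:
  fixes b :: "nat \<Rightarrow> nat"
  assumes "k \<le> (\<Sum>i<r. b i)"
  obtains c where "\<And>i. i < r \<Longrightarrow> c i \<le> b i" "(\<Sum>i<r. c i) = k"
proof -
  have "\<exists>c. (\<forall>i<r. c i \<le> b i) \<and> (\<Sum>i<r. c i) = k"
    using assms
  proof (induction r arbitrary: k)
    case (Suc r)
    have "k - min k (b r) \<le> (\<Sum>i<r. b i)" using Suc.prems by auto
    from Suc.IH[OF this] obtain c where c: "\<forall>i<r. c i \<le> b i" "(\<Sum>i<r. c i) = k - min k (b r)" by blast
    have "(\<Sum>i<r. (c(r := min k (b r))) i) = (\<Sum>i<r. c i)" by (intro sum.cong) auto
    then show ?case using c by (intro exI[of _ "c(r := min k (b r))"]) (auto simp: less_Suc_eq)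
  qed simp
  then show ?thesis using that by blast
qed

theorem PPSN_aff_dim_ge:
  fixes P :: "'a::euclidean_space set" and Q :: "'b::euclidean_space set"
  assumes r: "length ns \<ge> 1" and n2: "\<And>i. i < length ns \<Longrightarrow> ns ! i \<ge> 2"
    and k: "k \<le> (\<Sum>i<length ns. (ns ! i - 2) div 2)"
    and PPSN: "PPSN_via (int k) ns Q P"
  shows "aff_dim P \<ge> int (2 * k + length ns + 1)"
proof (rule ccontr)
  assume "\<not> ?thesis"
  then have small: "aff_dim P \<le> int (2 * k + length ns)" by simp
  let ?r = "length ns" and ?N = "sum_list ns"
  obtain f :: "'b \<Rightarrow> 'a" where f: "linear f" "P = f ` Q" and PSN: "PSN (int k) ns P"
    and ceq: "comb_equiv_delta ns Q"
    using PPSN unfolding PPSN_via_def by blast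
  have Q: "polytope Q" using ceq by (simp add: comb_equiv_delta_def)
  obtain FQ where lab: "delta_labelling ns Q FQ" by (rule comb_equiv_delta_labelling[OF ceq])
  have face: "FQ S face_of Q" "FQ S \<noteq> {}" and dimF: "aff_dim (FQ S) = delta_face_dim S"
    if "S \<in> delta_faces ns" for S
    using lab that by (auto simp: delta_labelling_def)
  obtain q0 where q0: "q0 \<in> Q" using face[OF delta_top_in] face_of_imp_subset by blast
  define D where "D = span ((\<lambda>z. - q0 + z) ` Q)"
  have D: "subspace D" by (simp add: D_def)
  have dimD: "?N \<le> dim D"
  proof -
    have "int ?N = aff_dim (FQ (delta_top ns))" using dimF[OF delta_top_in] by (simp add: delta_face_dim_top)
    also have "\<dots> \<le> aff_dim Q" by (intro aff_dim_subset face_of_imp_subset face(1) delta_top_in)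
    also have "\<dots> = int (dim D)" unfolding D_def by (rule aff_dim_eq_dim_direction[OF q0])
    finally show ?thesis by simp
  qed
  have dimfD: "dim (f ` D) \<le> 2 * k + ?r"
    using small aff_dim_linear_image_eq_dim[OF f(1) q0] by (simp add: D_def f(2))
  obtain A :: "nat \<Rightarrow> nat \<Rightarrow> 'b" where A: "\<And>S x v. S \<in> delta_faces ns \<Longrightarrow> x \<in> rel_interior (FQ S) \<Longrightarrow> v \<in> D \<Longrightarrow>
      (\<And>i j. i < ?r \<Longrightarrow> j \<le> ns ! i \<Longrightarrow> j \<notin> S ! i \<Longrightarrow> A i j \<bullet> v \<le> 0) \<Longrightarrow>
      \<exists>\<epsilon>>0. x + \<epsilon> *\<^sub>R v \<in> Q"
  proof (rule labelled_facet_normals[OF Q lab _ q0])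
    show "1 \<le> ns ! i" if "i < ?r" for i using n2[OF that] by simp
  qed (unfold D_def, blast)
  obtain c where c: "\<And>i. i < ?r \<Longrightarrow> c i \<le> (ns ! i - 2) div 2" "(\<Sum>i<?r. c i) = k"
    using split_sum_below[OF k] by blast
  \<comment> \<open>Block i thus has at least 2 c_i + 3 vertices, and the truncated subtractions
    below are exact.\<close>
  have cn: "2 * c i + 2 \<le> ns ! i" if "i < ?r" for i using c(1)[OF that] n2[OF that] by linarith
  define L where "L = {x \<in> D. f x = 0}"
  have L: "subspace L"
    using D f(1) by (auto simp: L_def subspace_def linear_0 linear_add linear_cmul)
  \<comment> \<open>The normals beyond index 2 c_i + 2 are annihilated; the 2 (c_i + 1) + 1
    remaining ones are those that \<open>majority (c i + 1)\<close> reads.\<close>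
  define V where "V = (\<Union>i<?r. A i ` {2 * c i + 3..ns ! i})"
  define L1 where "L1 = L \<inter> {x. \<forall>v\<in>V. v \<bullet> x = 0}"
  have finV: "finite V" by (simp add: V_def)
  have "card V \<le> (\<Sum>i<?r. card (A i ` {2 * c i + 3..ns ! i}))"
    unfolding V_def by (intro card_UN_le) simp
  also have "\<dots> \<le> (\<Sum>i<?r. ns ! i - 2 * c i - 2)"
  proof (intro sum_mono)
    fix i assume "i \<in> {..<?r}"
    have "card (A i ` {2 * c i + 3..ns ! i}) \<le> card {2 * c i + 3..ns ! i}" by (intro card_image_le) simp
    then show "card (A i ` {2 * c i + 3..ns ! i}) \<le> ns ! i - 2 * c i - 2" by simp
  qed
  finally have cardV: "card V \<le> (\<Sum>i<?r. ns ! i - 2 * c i - 2)" .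
  have "?N = (\<Sum>i<?r. ns ! i)" by (simp add: sum_list_sum_nth atLeast0LessThan)
  also have "\<dots> = (\<Sum>i<?r. (ns ! i - 2 * c i - 2) + 2 * c i + 2)"
  proof (rule sum.cong[OF refl])
    fix i assume "i \<in> {..<?r}"
    then have "2 * c i + 2 \<le> ns ! i" using cn[of i] by simp
    then show "ns ! i = ns ! i - 2 * c i - 2 + 2 * c i + 2" by linarith
  qed
  also have "\<dots> = (\<Sum>i<?r. ns ! i - 2 * c i - 2) + 2 * (\<Sum>i<?r. c i) + 2 * ?r"
    by (simp only: sum.distrib sum_distrib_left) simp
  finally have sumN: "(\<Sum>i<?r. ns ! i - 2 * c i - 2) + 2 * k + 2 * ?r = ?N" by (simp only: c(2))
  have "dim D \<le> dim L + dim (f ` D)" unfolding L_def by (rule dim_kernel_ge[OF f(1) D])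
  moreover have "dim L \<le> dim L1 + card V" unfolding L1_def by (rule dim_Int_hyperplanes[OF L finV])
  ultimately have "?r \<le> dim L1" using dimD dimfD cardV sumN by linarith
  have "subspace {x. \<forall>v\<in>V. v \<bullet> x = 0}" unfolding subspace_def by (simp add: inner_add_right)
  then have L1: "subspace L1" unfolding L1_def by (rule subspace_inter[OF L])
  obtain L2 where L2: "subspace L2" "L2 \<subseteq> span L1" "dim L2 = ?r"
    using choose_subspace_of_subspace[OF \<open>?r \<le> dim L1\<close>] by blast
  have "span L1 = L1" using L1 by (simp only: span_eq_iff)
  then have L2L1: "L2 \<subseteq> L1" using L2(2) by (simp only:)
  define s where "s i v = majority (c i + 1) (\<lambda>j. A i j \<bullet> v) - majority (c i + 1) (\<lambda>j. - (A i j \<bullet> v))" for i v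
  have conts: "continuous_on UNIV (s i)" for i
    unfolding s_def majority_def by (intro continuous_intros)
  have odds: "s i (- v) = - s i v" for i v by (simp add: s_def)
  obtain v where v: "v \<in> L2" "v \<noteq> 0" "\<And>i. i < ?r - 1 \<Longrightarrow> s i v - s (?r - 1) v = 0"
  proof (rule Borsuk_Ulam_subspace[OF L2(1), of "?r - 1" "\<lambda>i v. s i v - s (?r - 1) v"])
    show "dim L2 = Suc (?r - 1)" using L2(3) r by simp
    show "continuous_on UNIV (\<lambda>v. s i v - s (?r - 1) v)" for i
      by (intro continuous_on_diff conts)
  qed (simp_all add: odds)
  have same: "s i v = s (?r - 1) v" if "i < ?r" for i
    using v(3)[of i] that by (cases "i = ?r - 1") auto
  define u where "u = (if s (?r - 1) v \<le> 0 then v else - v)"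
  have u: "u \<in> L1" "u \<noteq> 0"
    using v L2L1 L1 by (auto simp: u_def subspace_neg)
  have su: "s i u \<le> 0" if "i < ?r" for i
    using same[OF that] by (auto simp: u_def odds)
  define Pos where "Pos i = {j. j \<le> ns ! i \<and> 0 < A i j \<bullet> u}" for i
  have cardPos: "card (Pos i) \<le> c i + 1" if i: "i < ?r" for i
  proof -
    have "Pos i \<subseteq> {j. j \<le> 2 * (c i + 1) \<and> 0 < A i j \<bullet> u}"
    proof
      fix j assume j: "j \<in> Pos i"
      have "j \<le> 2 * (c i + 1)"
      proof (rule ccontr)
        assume "\<not> j \<le> 2 * (c i + 1)"
        then have "j \<in> {2 * c i + 3..ns ! i}" using j by (simp add: Pos_def)
        then have "A i j \<in> V" using i unfolding V_def by blast
        then have "A i j \<bullet> u = 0" using u(1) by (simp add: L1_def)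
        then show False using j by (simp add: Pos_def)
      qed
      then show "j \<in> {j. j \<le> 2 * (c i + 1) \<and> 0 < A i j \<bullet> u}" using j by (simp add: Pos_def)
    qed
    then have "card (Pos i) \<le> card {j. j \<le> 2 * (c i + 1) \<and> 0 < A i j \<bullet> u}"
      by (intro card_mono) auto
    also have "\<dots> \<le> c i + 1"
      using su[OF i] by (intro card_positive_le) (simp add: s_def)
    finally show ?thesis .
  qed
  \<comment> \<open>A block without positive values receives the single vertex 0, as labels have
    nonempty entries; it contributes 0 to the dimension.\<close>
  define S where "S = map (\<lambda>i. if Pos i = {} then {0} else Pos i) [0..<?r]"
  have nth: "S ! i = (if Pos i = {} then {0} else Pos i)" if "i < ?r" for i
    using that by (simp add: S_def)
  have Sf: "S \<in> delta_faces ns" by (auto simp: delta_faces_def nth) (auto simp: S_def Pos_def)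
  have "(\<Sum>i<?r. card (S ! i) - 1) \<le> (\<Sum>i<?r. c i)"
    using cardPos by (intro sum_mono) (auto simp: nth le_diff_conv)
  then have Sk: "S \<in> delta_skel (int k) ns"
    unfolding delta_skel_def using Sf delta_face_dim_nat[OF Sf] c(2) by (simp del: of_nat_sum)
  have "convex (FQ S)" using face_of_imp_convex[OF face(1)[OF Sf]] .
  then have "rel_interior (FQ S) \<noteq> {}" using face(2)[OF Sf] by (simp add: rel_interior_eq_empty)
  then obtain x where x: "x \<in> rel_interior (FQ S)" by blast
  have uD: "u \<in> D" "f u = 0" using u(1) by (auto simp: L1_def L_def)
  have "\<exists>\<epsilon>>0. x + \<epsilon> *\<^sub>R u \<in> Q"
  proof (rule A[OF Sf x uD(1)])
    fix i j assume "i < ?r" "j \<le> ns ! i" "j \<notin> S ! i"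
    then show "A i j \<bullet> u \<le> 0" by (auto simp: nth Pos_def split: if_splits)
  qed
  then obtain \<epsilon> where \<epsilon>: "\<epsilon> > 0" "x + \<epsilon> *\<^sub>R u \<in> Q" by blast
  \<comment> \<open>Moving along the kernel vector u does not change the image, but over a face of
    the k-skeleton f identifies no further points of Q.\<close>
  have "x = x + \<epsilon> *\<^sub>R u"
  proof (rule labelled_skeleton_preserved[OF PSN[unfolded f(2)] f(1) Q lab Sk _ \<epsilon>(2)])
    show "x \<in> FQ S" using x rel_interior_subset by blast
    show "f x = f (x + \<epsilon> *\<^sub>R u)" using uD(2) f(1) by (simp add: linear_add linear_cmul)
  qed
  then show False using \<epsilon>(1) u(2) by simp
qed

text \<open>The smallest dimension is expressed by attainment in all ambient spaces that are large
  enough, together with a bound valid in arbitrary ambient spaces; \<open>aff_dim\<close> makes both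
  independent of the ambient dimension.\<close>

theorem theorem1p1:
  fixes ns :: "nat list" and k :: nat
  assumes "length ns \<ge> 1"
    and "\<forall>i<length ns. ns ! i \<ge> 2"
    and "k \<le> (\<Sum>i<length ns. (ns ! i - 2) div 2)"
    and "DIM('a::euclidean_space) \<ge> 2 * k + length ns + 1"
    and "DIM('b::euclidean_space) \<ge> sum_list ns"
  shows "(\<exists>(P::'a set) (Q::'b set). PPSN_via (int k) ns Q P \<and>
            aff_dim P = int (2 * k + length ns + 1))
       \<and> (\<forall>(P::'c::euclidean_space set) (Q::'d::euclidean_space set).
            PPSN_via (int k) ns Q P \<longrightarrow> aff_dim P \<ge> int (2 * k + length ns + 1))"
proof
  have pos: "\<And>i. i < length ns \<Longrightarrow> 2 \<le> ns ! i" using assms(2) by blast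
  \<comment> \<open>The construction bounds the dimension only from above; the lower bound, applied
    to the same P and Q, turns this into an equality.\<close>
  obtain P :: "'a set" and Q :: "'b set"
    where "PPSN_via (int k) ns Q P" "aff_dim P \<le> int (2 * k + length ns + 1)"
    by (rule PPSN_exists[OF assms(4,5)])
  moreover from this have "aff_dim P \<ge> int (2 * k + length ns + 1)"
    by (intro PPSN_aff_dim_ge[OF assms(1) pos assms(3)])
  ultimately show "\<exists>(P::'a set) (Q::'b set). PPSN_via (int k) ns Q P \<and>
      aff_dim P = int (2 * k + length ns + 1)"
    by force
  show "\<forall>(P::'c set) (Q::'d set). PPSN_via (int k) ns Q P \<longrightarrow>
      aff_dim P \<ge> int (2 * k + length ns + 1)"
    using PPSN_aff_dim_ge[OF assms(1) pos assms(3)] by blast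
qed

end
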